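(* Let $\alpha\in\mathbb{R}$ and $\kappa>0$, and consider the linear problem \begin{align*} \partial_t V + y\,\partial_x V + (V_2,0) + \nabla p &= \alpha\,\partial_x B,\\ \partial_t B + y\,\partial_x B - (B_2,0) &= \kappa\Delta B + \alpha\,\partial_x V,\\ \operatorname{div}(B)=\operatorname{div}(V)&=0, \end{align*} for $(t,x,y)\in\mathbb{R}_+\times\mathbb{T}\times\mathbb{R}$, with $V=(V_1,V_2)$ and $B=(B_1,B_2)$. Then these equations are stable in $H^s$ for every $s\in\mathbb{R}$ in the following sense: for any choice of initial data and all times $t>0$, $$\|(\nabla^\perp\cdot V)(t,x-ty,y)\|_{H^s}^2+\|(\nabla^\perp\cdot B)(t,x-ty,y)\|_{H^s}^2\le (1+\kappa^{-2/3})^2\Big(\|\nabla^\perp\cdot V|_{t=0}\|_{H^s}^2+\|\nabla^\perp\cdot B|_{t=0}\|_{H^s}^2\Big).$$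
   Context: Here $\nabla^\perp=(-\partial_y,\partial_x)$, so $W=\nabla^\perp\cdot V$ is the vorticity and $J=\nabla^\perp\cdot B$ is the current. The functions in the norms on the left-hand side are $W$ and $J$ expressed in the coordinates $(x-ty,y)$ moving with the shear, i.e. with the transport operator $y\partial_x$ removed. $H^s=H^s(\mathbb{T}\times\mathbb{R})$ is the usual Sobolev space defined by the Fourier transform. Initial data are divergence-free with $W|_{t=0},J|_{t=0}\in H^s$, and suitable decay at infinity is assumed so that the equations are equivalent to the corresponding equations for $W$ and $J$. *)

theory Defs
  imports "HOL-Analysis.Analysis"
begin

text \<open>
  The torus is \<open>\<real> / 2\<pi>\<int>\<close>, so functions on \<open>\<T> \<times> \<real>\<close> are functions of two real variables that are
  \<open>2\<pi>\<close>-periodic in the first one, and the frequencies are \<open>(k, \<xi>) \<in> \<int> \<times> \<real>\<close>.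

  Since \<open>H\<^sup>s\<close> contains genuine distributions when \<open>s\<close> is negative, all fields take values in the
  tempered distributions on \<open>\<T> \<times> \<real>\<close>.  Temperedness is the decay condition at infinity: it excludes
  the exponentially growing harmonic functions, so that the velocity formulation and the
  vorticity-current formulation are equivalent.
\<close>

section \<open>Test functions and tempered distributions\<close>

definition pdx :: "(real \<Rightarrow> real \<Rightarrow> complex) \<Rightarrow> real \<Rightarrow> real \<Rightarrow> complex" where
  "pdx \<phi> = (\<lambda>x y. vector_derivative (\<lambda>x'. \<phi> x' y) (at x))"

definition pdy :: "(real \<Rightarrow> real \<Rightarrow> complex) \<Rightarrow> real \<Rightarrow> real \<Rightarrow> complex" where
  "pdy \<phi> = (\<lambda>x y. vector_derivative (\<lambda>y'. \<phi> x y') (at y))"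

text \<open>
  The Schwartz space of \<open>\<T> \<times> \<real>\<close>.  Being coinductive, the definition says that all iterated partial
  derivatives, in any order, are periodic, (Frechet) differentiable and rapidly decaying in \<open>y\<close>.
\<close>

coinductive test_function :: "(real \<Rightarrow> real \<Rightarrow> complex) \<Rightarrow> bool" where
  "\<lbrakk>\<forall>x y. \<phi> (x + 2 * pi) y = \<phi> x y;
    \<forall>z. (\<lambda>(x, y). \<phi> x y) differentiable at z;
    \<forall>m::nat. \<exists>C. \<forall>x y. \<bar>y\<bar> ^ m * cmod (\<phi> x y) \<le> C;
    test_function (pdx \<phi>);
    test_function (pdy \<phi>)\<rbrakk> \<Longrightarrow> test_function \<phi>"

text \<open>The Schwartz space of \<open>\<real>\<close>.\<close>

coinductive schwartz_line :: "(real \<Rightarrow> complex) \<Rightarrow> bool" where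
  "\<lbrakk>\<forall>\<xi>. \<eta> differentiable at \<xi>;
    \<forall>m::nat. \<exists>C. \<forall>\<xi>. \<bar>\<xi>\<bar> ^ m * cmod (\<eta> \<xi>) \<le> C;
    schwartz_line (\<lambda>\<xi>. vector_derivative \<eta> (at \<xi>))\<rbrakk> \<Longrightarrow> schwartz_line \<eta>"

definition schwartz_seminorm :: "nat \<Rightarrow> (real \<Rightarrow> real \<Rightarrow> complex) \<Rightarrow> real" where
  "schwartz_seminorm N \<phi> =
    (\<Sum>m\<le>N. \<Sum>i\<le>N. \<Sum>j\<le>N. SUP (x, y). \<bar>y\<bar> ^ m * cmod ((pdx ^^ i) ((pdy ^^ j) \<phi>) x y))"

text \<open>Only the values on test functions matter.  The pairing with functions is bilinear,
  \<open>u \<phi> = \<integral>\<integral> u(x,y) \<phi>(x,y) dx dy\<close>.\<close>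

type_synonym distribution = "(real \<Rightarrow> real \<Rightarrow> complex) \<Rightarrow> complex"

definition linear_on_tests :: "distribution \<Rightarrow> bool" where
  "linear_on_tests u \<longleftrightarrow>
    (\<forall>\<phi> \<psi>. test_function \<phi> \<longrightarrow> test_function \<psi> \<longrightarrow> u (\<lambda>x y. \<phi> x y + \<psi> x y) = u \<phi> + u \<psi>) \<and>
    (\<forall>c \<phi>. test_function \<phi> \<longrightarrow> u (\<lambda>x y. c * \<phi> x y) = c * u \<phi>)"

definition tempered :: "distribution \<Rightarrow> bool" where
  "tempered u \<longleftrightarrow> linear_on_tests u \<and>
    (\<exists>N C. \<forall>\<phi>. test_function \<phi> \<longrightarrow> cmod (u \<phi>) \<le> C * schwartz_seminorm N \<phi>)"

text \<open>
  Continuous curves \<open>[0, \<infinity>) \<rightarrow> S'\<close>.  The bound, uniform on compact time intervals, follows from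
  pointwise continuity by the Banach-Steinhaus theorem; it is stated explicitly for convenience.
\<close>

definition continuous_tempered_curve :: "(real \<Rightarrow> distribution) \<Rightarrow> bool" where
  "continuous_tempered_curve u \<longleftrightarrow>
    (\<forall>t\<ge>0. tempered (u t)) \<and>
    (\<forall>\<phi>. test_function \<phi> \<longrightarrow> continuous_on {0..} (\<lambda>t. u t \<phi>)) \<and>
    (\<forall>T. \<exists>N C. \<forall>t\<in>{0..T}. \<forall>\<phi>. test_function \<phi> \<longrightarrow> cmod (u t \<phi>) \<le> C * schwartz_seminorm N \<phi>)"

definition dist_dx :: "distribution \<Rightarrow> distribution" where
  "dist_dx u = (\<lambda>\<phi>. - u (pdx \<phi>))"

definition dist_dy :: "distribution \<Rightarrow> distribution" where
  "dist_dy u = (\<lambda>\<phi>. - u (pdy \<phi>))"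

definition dist_laplace :: "distribution \<Rightarrow> distribution" where
  "dist_laplace u = (\<lambda>\<phi>. dist_dx (dist_dx u) \<phi> + dist_dy (dist_dy u) \<phi>)"

definition mult_y :: "distribution \<Rightarrow> distribution" where
  "mult_y u = (\<lambda>\<phi>. u (\<lambda>x y. of_real y * \<phi> x y))"

definition dist_div :: "distribution \<Rightarrow> distribution \<Rightarrow> distribution" where
  "dist_div u1 u2 = (\<lambda>\<phi>. dist_dx u1 \<phi> + dist_dy u2 \<phi>)"

text \<open>\<open>\<nabla>\<^sup>\<bottom> \<cdot> u\<close> with \<open>\<nabla>\<^sup>\<bottom> = (-\<partial>\<^sub>y, \<partial>\<^sub>x)\<close>.\<close>

definition dist_curl :: "distribution \<Rightarrow> distribution \<Rightarrow> distribution" where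
  "dist_curl u1 u2 = (\<lambda>\<phi>. - dist_dy u1 \<phi> + dist_dx u2 \<phi>)"

text \<open>
  The profile \<open>g\<close> of \<open>u\<close> in the coordinates moving with the shear, defined by
  \<open>g(x - t y, y) = u(x, y)\<close>, i.e. \<open>g(x, y) = u(x + t y, y)\<close>.  Since the shear preserves area,
  \<open>\<integral>\<integral> g(x,y) \<phi>(x,y) dx dy = \<integral>\<integral> u(x,y) \<phi>(x - t y, y) dx dy\<close>.
\<close>

definition shear_profile :: "real \<Rightarrow> distribution \<Rightarrow> distribution" where
  "shear_profile t u = (\<lambda>\<phi>. u (\<lambda>x y. \<phi> (x - t * y) y))"

section \<open>Fourier transform and Sobolev spaces\<close>

definition fourier_line :: "(real \<Rightarrow> complex) \<Rightarrow> real \<Rightarrow> complex" where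
  "fourier_line \<eta> = (\<lambda>y. LINT \<xi>|lborel. \<eta> \<xi> * cis (- \<xi> * y))"

text \<open>
  The Fourier transform of \<open>u\<close> is the function \<open>f\<close>: for each \<open>k\<close> the Fourier transform in \<open>y\<close>
  of the \<open>k\<close>-th Fourier coefficient of \<open>u\<close> in \<open>x\<close>, taken by duality, is \<open>f k\<close>.  Formally
  \<open>f k \<xi> = \<integral>\<integral> u(x,y) exp(-i (k x + \<xi> y)) dx dy\<close>.
\<close>

definition is_fourier_transform :: "distribution \<Rightarrow> (int \<Rightarrow> real \<Rightarrow> complex) \<Rightarrow> bool" where
  "is_fourier_transform u f \<longleftrightarrow>
    (\<forall>k. f k \<in> borel_measurable borel) \<and>
    (\<forall>k \<eta>. schwartz_line \<eta> \<longrightarrow>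
       integrable lborel (\<lambda>\<xi>. f k \<xi> * \<eta> \<xi>) \<and>
       u (\<lambda>x y. cis (- of_int k * x) * fourier_line \<eta> y) = (LINT \<xi>|lborel. f k \<xi> * \<eta> \<xi>))"

text \<open>The transform is unique up to null sets, which do not affect the integral below.\<close>

definition fourier_transform :: "distribution \<Rightarrow> int \<Rightarrow> real \<Rightarrow> complex" where
  "fourier_transform u = (SOME f. is_fourier_transform u f)"

definition sobolev_energy :: "real \<Rightarrow> (int \<Rightarrow> real \<Rightarrow> complex) \<Rightarrow> ennreal" where
  "sobolev_energy s f =
    (\<integral>\<^sup>+k. (\<integral>\<^sup>+\<xi>. ennreal ((1 + (of_int k)\<^sup>2 + \<xi>\<^sup>2) powr s * (cmod (f k \<xi>))\<^sup>2) \<partial>lborel)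
      \<partial>count_space UNIV)"

definition sobolev_space :: "real \<Rightarrow> distribution set" where
  "sobolev_space s = {u. tempered u \<and> (\<exists>f. is_fourier_transform u f) \<and>
    sobolev_energy s (fourier_transform u) < \<infinity>}"

definition sobolev_norm :: "real \<Rightarrow> distribution \<Rightarrow> real" where
  "sobolev_norm s u = sqrt (enn2real (sobolev_energy s (fourier_transform u)))"

section \<open>The linearized MHD equations\<close>

definition linear_mhd_solution ::
  "real \<Rightarrow> real \<Rightarrow> (real \<Rightarrow> distribution) \<Rightarrow> (real \<Rightarrow> distribution) \<Rightarrow>
    (real \<Rightarrow> distribution) \<Rightarrow> (real \<Rightarrow> distribution) \<Rightarrow> (real \<Rightarrow> distribution) \<Rightarrow> bool" where
  "linear_mhd_solution \<alpha> \<kappa> V1 V2 B1 B2 p \<longleftrightarrow>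
    continuous_tempered_curve V1 \<and> continuous_tempered_curve V2 \<and>
    continuous_tempered_curve B1 \<and> continuous_tempered_curve B2 \<and>
    (\<forall>t>0. tempered (p t)) \<and>
    (\<forall>t>0. \<forall>\<phi>. test_function \<phi> \<longrightarrow>
      ((\<lambda>\<tau>. V1 \<tau> \<phi>) has_vector_derivative
         (- mult_y (dist_dx (V1 t)) \<phi> - V2 t \<phi> - dist_dx (p t) \<phi>
          + of_real \<alpha> * dist_dx (B1 t) \<phi>)) (at t) \<and>
      ((\<lambda>\<tau>. V2 \<tau> \<phi>) has_vector_derivative
         (- mult_y (dist_dx (V2 t)) \<phi> - dist_dy (p t) \<phi>
          + of_real \<alpha> * dist_dx (B2 t) \<phi>)) (at t) \<and>
      ((\<lambda>\<tau>. B1 \<tau> \<phi>) has_vector_derivative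
         (- mult_y (dist_dx (B1 t)) \<phi> + B2 t \<phi> + of_real \<kappa> * dist_laplace (B1 t) \<phi>
          + of_real \<alpha> * dist_dx (V1 t) \<phi>)) (at t) \<and>
      ((\<lambda>\<tau>. B2 \<tau> \<phi>) has_vector_derivative
         (- mult_y (dist_dx (B2 t)) \<phi> + of_real \<kappa> * dist_laplace (B2 t) \<phi>
          + of_real \<alpha> * dist_dx (V2 t) \<phi>)) (at t)) \<and>
    (\<forall>t\<ge>0. \<forall>\<phi>. test_function \<phi> \<longrightarrow>
      dist_div (V1 t) (V2 t) \<phi> = 0 \<and> dist_div (B1 t) (B2 t) \<phi> = 0)"

end

theory Submission
  imports Defs "HOL-Complex_Analysis.Complex_Analysis" "HOL-Probability.Probability"
begin

text \<open>
  In the moving frame the Fourier transforms of vorticity and current satisfy, for each fixed frequency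
  \<open>(k, \<xi>)\<close>, the system \<open>w' = i\<alpha>k j\<close>, \<open>j' = i\<alpha>k w - c j\<close> with
  \<open>c = \<kappa> q + 2k(\<xi> - kt)/q\<close> and \<open>q = k\<^sup>2 + (\<xi> - kt)\<^sup>2\<close>. The \<open>\<alpha>\<close>-coupling is
  skew-adjoint, so \<open>|w|\<^sup>2 + |j|\<^sup>2\<close> grows at most at twice the rate
  \<open>2\<tau>/(1 + \<tau>\<^sup>2) - \<kappa>(1 + \<tau>\<^sup>2)\<close>, \<open>\<tau> = t - \<xi>/k\<close>, and only while this rate is
  nonnegative; that happens on a single time interval, over which the rate integrates to at most
  \<open>ln (1 + \<kappa>\<^sup>-\<^sup>2\<^sup>/\<^sup>3)\<close>.

  A distributional solution is identified with the solution of this system by duality. The adjoint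
  (backward) system has solutions that are holomorphic and bounded for \<open>|Im \<xi>| < 1/2\<close>, so by Cauchy's
  estimates they are multipliers of the Schwartz space. Testing the solution against them gives a quantity
  constant in time, which expresses the Fourier transform at time \<open>t\<close> as a bounded matrix
  function of \<open>(k, \<xi>)\<close> applied to the Fourier transform of the initial data.
\<close>

section \<open>Smooth functions and Schwartz functions on the line\<close>

text \<open>At positive times nothing says beforehand that the Fourier transforms are functions, so
  the mode system cannot be written down at a fixed \<xi>: it only makes sense for functionals on
  Schwartz functions of the frequency. This forces the duality and the need for multipliers with
  control of all derivatives. Complexifying \<xi> replaces derivatives of the solution in \<xi> by a
  sup bound. It is possible because the zeros kt + ik and kt - ik of the symbol k^2 + (z - kt)^2
  stay at distance at least 1 from the real axis when k is a nonzero integer. Two energy estimates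
  coexist: a crude one on the whole strip, which only yields multipliers, and the sharp one at real
  frequencies, which yields the constant. W and J behave differently because of the stretching
  terms: with div V = 0 the term (V_2, 0) cancels the commutator of the curl with y d_x, while
  -(B_2, 0) has the opposite sign and leaves 2 d_x B_1, which Biot-Savart turns into the rational
  part of c. The constant is squared because the energy, being quadratic, changes at twice the
  rate.\<close>

definition vd :: "(real \<Rightarrow> complex) \<Rightarrow> real \<Rightarrow> complex" where
  "vd \<eta> = (\<lambda>\<xi>. vector_derivative \<eta> (at \<xi>))"

lemma vd_eqI: "(\<And>x. (f has_vector_derivative f' x) (at x)) \<Longrightarrow> vd f = f'"
  unfolding vd_def by (auto intro: vector_derivative_at)

lemma has_vd: "f differentiable at x \<Longrightarrow> (f has_vector_derivative vd f x) (at x)"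
  unfolding vd_def by (simp add: vector_derivative_works)

text \<open>\<open>csmooth n\<close> asks for n + 1 derivatives, as level 0 is already
  differentiability. The finite levels serve products: the Leibniz rule leaves the class of
  products, so induction on the level is simpler than a coinductive invariant closed under
  sums.\<close>

primrec csmooth :: "nat \<Rightarrow> (real \<Rightarrow> complex) \<Rightarrow> bool" where
  "csmooth 0 f \<longleftrightarrow> (\<forall>x. f differentiable at x)"
| "csmooth (Suc n) f \<longleftrightarrow> (\<forall>x. f differentiable at x) \<and> csmooth n (vd f)"

definition smooth :: "(real \<Rightarrow> complex) \<Rightarrow> bool" where
  "smooth f \<longleftrightarrow> (\<forall>n. csmooth n f)"

lemma csmooth_differentiable: "csmooth n f \<Longrightarrow> f differentiable at x"
  by (cases n) auto

lemma csmooth_Suc_D: "csmooth (Suc n) f \<Longrightarrow> csmooth n f"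
  by (induction n arbitrary: f) auto

lemma smooth_differentiable: "smooth f \<Longrightarrow> f differentiable at x"
  using csmooth_differentiable unfolding smooth_def by blast

lemma smooth_vd: "smooth f \<Longrightarrow> smooth (vd f)"
  unfolding smooth_def using csmooth.simps(2) by blast

lemma smooth_has_vd: "smooth f \<Longrightarrow> (f has_vector_derivative vd f x) (at x)"
  by (simp add: has_vd smooth_differentiable)

lemma smoothI: "(\<And>x. f differentiable at x) \<Longrightarrow> smooth (vd f) \<Longrightarrow> smooth f"
  unfolding smooth_def by (metis csmooth.simps(2) csmooth_Suc_D)

lemma smooth_funpow_vd: "smooth f \<Longrightarrow> smooth ((vd ^^ n) f)"
  by (induction n) (auto intro: smooth_vd)

text \<open>The tool for families given by a formula that \<open>vd\<close> preserves: constants,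
  translates, restrictions of holomorphic functions.\<close>

lemma smooth_coinduct_set:
  assumes "P f"
    and "\<And>f x. P f \<Longrightarrow> f differentiable at x"
    and "\<And>f. P f \<Longrightarrow> P (vd f)"
  shows "smooth f"
proof -
  have "P f \<Longrightarrow> csmooth n f" for n f
    by (induction n arbitrary: f) (use assms in auto)
  then show ?thesis using assms(1) by (simp add: smooth_def)
qed

lemma vd_add: "f differentiable at x \<Longrightarrow> g differentiable at x \<Longrightarrow> vd (\<lambda>x. f x + g x) x = vd f x + vd g x"
  unfolding vd_def by (rule vector_derivative_at) (intro has_vector_derivative_add; simp add: vector_derivative_works)

lemma vd_mult: "f differentiable at x \<Longrightarrow> g differentiable at x \<Longrightarrow>
   vd (\<lambda>x. f x * g x) x = vd f x * g x + f x * vd g x"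
proof -
  assume "f differentiable at x" "g differentiable at x"
  then have "((\<lambda>x. f x * g x) has_vector_derivative (f x * vd g x + vd f x * g x)) (at x)"
    by (intro has_vector_derivative_mult has_vd)
  then show ?thesis unfolding vd_def by (metis vector_derivative_at add.commute)
qed

lemma vd_cmult: "smooth f \<Longrightarrow> vd (\<lambda>x. c * f x) = (\<lambda>x. c * vd f x)"
  by (intro vd_eqI has_vector_derivative_mult_right smooth_has_vd)

lemma csmooth_add: "csmooth n f \<Longrightarrow> csmooth n g \<Longrightarrow> csmooth n (\<lambda>x. f x + g x)"
proof (induction n arbitrary: f g)
  case 0 then show ?case by auto
next
  case (Suc n)
  have "vd (\<lambda>x. f x + g x) = (\<lambda>x. vd f x + vd g x)"
    using Suc.prems by (auto intro!: vd_add)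
  then show ?case using Suc by auto
qed

lemma csmooth_mult: "csmooth n f \<Longrightarrow> csmooth n g \<Longrightarrow> csmooth n (\<lambda>x. f x * g x)"
proof (induction n arbitrary: f g)
  case 0 then show ?case by auto
next
  case (Suc n)
  have "vd (\<lambda>x. f x * g x) = (\<lambda>x. vd f x * g x + f x * vd g x)"
    using Suc.prems by (auto intro!: vd_mult)
  then show ?case using Suc.prems Suc.IH csmooth_Suc_D by (auto intro!: csmooth_add)
qed

lemma smooth_add: "smooth f \<Longrightarrow> smooth g \<Longrightarrow> smooth (\<lambda>x. f x + g x)"
  by (simp add: smooth_def csmooth_add)

lemma smooth_mult: "smooth f \<Longrightarrow> smooth g \<Longrightarrow> smooth (\<lambda>x. f x * g x)"
  by (simp add: smooth_def csmooth_mult)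

lemma vd_const: "vd (\<lambda>x. c) = (\<lambda>x. 0)"
  by (rule vd_eqI) (rule has_vector_derivative_const)

lemma smooth_const: "smooth (\<lambda>x. c)"
  by (rule smooth_coinduct_set[where P="\<lambda>f. \<exists>c. f = (\<lambda>x. c)"]) (auto simp: vd_const)

lemma smooth_cmult: "smooth f \<Longrightarrow> smooth (\<lambda>x. c * f x)"
  by (intro smooth_mult smooth_const)

lemma smooth_diff: "smooth f \<Longrightarrow> smooth g \<Longrightarrow> smooth (\<lambda>x. f x - g x)"
  using smooth_add[of f "\<lambda>x. (-1) * g x"] smooth_cmult[of g "-1"] by simp

lemma funpow_vd_add:
  "smooth f \<Longrightarrow> smooth g \<Longrightarrow> (vd ^^ n) (\<lambda>x. f x + g x) = (\<lambda>x. (vd ^^ n) f x + (vd ^^ n) g x)"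
proof (induction n)
  case (Suc n)
  then show ?case
    using vd_add[OF smooth_differentiable smooth_differentiable, OF smooth_funpow_vd smooth_funpow_vd]
    by (simp add: ext)
qed simp

lemma funpow_vd_cmult:
  "smooth f \<Longrightarrow> (vd ^^ n) (\<lambda>x. c * f x) = (\<lambda>x. c * (vd ^^ n) f x)"
  by (induction n) (auto simp: vd_cmult smooth_funpow_vd)

lemma funpow_vd_diff:
  "smooth f \<Longrightarrow> smooth g \<Longrightarrow> (vd ^^ n) (\<lambda>x. f x - g x) = (\<lambda>x. (vd ^^ n) f x - (vd ^^ n) g x)"
  using funpow_vd_add[of f "\<lambda>x. (-1) * g x" n] funpow_vd_cmult[of g n "-1"] smooth_cmult[of g "-1"]
  by simp

text \<open>One Leibniz step turns a product into two products, so n steps leave 2^n terms, each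
  bounded by \<open>a * b\<close>. Binomial coefficients are not tracked.\<close>

lemma funpow_vd_mult_bound:
  assumes "smooth f" "smooth g" "\<And>i. i \<le> n \<Longrightarrow> cmod ((vd ^^ i) f x) \<le> a"
    "\<And>i. i \<le> n \<Longrightarrow> cmod ((vd ^^ i) g x) \<le> b"
  shows "cmod ((vd ^^ n) (\<lambda>x. f x * g x) x) \<le> 2 ^ n * (a * b)"
  using assms
proof (induction n arbitrary: f g)
  case 0
  then show ?case using 0(3)[of 0] 0(4)[of 0] by (auto simp: norm_mult intro!: mult_mono' )
next
  case (Suc n)
  have eq: "vd (\<lambda>x. f x * g x) = (\<lambda>x. vd f x * g x + f x * vd g x)"
    using Suc.prems by (auto intro!: vd_mult smooth_differentiable)
  have "(vd ^^ Suc n) (\<lambda>x. f x * g x) = (vd ^^ n) (vd (\<lambda>x. f x * g x))"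
    by (simp only: funpow_Suc_right o_apply)
  also have "\<dots> = (\<lambda>x. (vd ^^ n) (\<lambda>x. vd f x * g x) x + (vd ^^ n) (\<lambda>x. f x * vd g x) x)"
    unfolding eq by (intro funpow_vd_add smooth_mult smooth_vd Suc.prems)
  finally have 1: "(vd ^^ Suc n) (\<lambda>x. f x * g x) x
     = (vd ^^ n) (\<lambda>x. vd f x * g x) x + (vd ^^ n) (\<lambda>x. f x * vd g x) x" by simp
  have f': "cmod ((vd ^^ i) (vd f) x) \<le> a" if "i \<le> n" for i
    using Suc.prems(3)[of "Suc i"] that by (simp only: funpow_Suc_right o_apply Suc_le_mono)
  have g': "cmod ((vd ^^ i) (vd g) x) \<le> b" if "i \<le> n" for i
    using Suc.prems(4)[of "Suc i"] that by (simp only: funpow_Suc_right o_apply Suc_le_mono)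
  have 2: "cmod ((vd ^^ n) (\<lambda>x. vd f x * g x) x) \<le> 2 ^ n * (a * b)"
    using f' Suc.prems by (intro Suc.IH smooth_vd) auto
  have 3: "cmod ((vd ^^ n) (\<lambda>x. f x * vd g x) x) \<le> 2 ^ n * (a * b)"
    using g' Suc.prems by (intro Suc.IH smooth_vd) auto
  show ?case unfolding 1 using norm_triangle_le[OF add_mono[OF 2 3]] by (simp add: mult.commute mult.left_commute)
qed

text \<open>Translation by kt in frequency is what the shear does to the k-th Fourier mode, see
  \<open>shear_mode\<close>.\<close>

definition translate :: "real \<Rightarrow> (real \<Rightarrow> complex) \<Rightarrow> real \<Rightarrow> complex" where
  "translate h f = (\<lambda>x. f (x + h))"

lemma vd_translate: "smooth f \<Longrightarrow> vd (translate h f) = translate h (vd f)"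
proof (rule vd_eqI)
  fix x assume f: "smooth f"
  have "((f \<circ> (\<lambda>x. x + h)) has_vector_derivative (1 *\<^sub>R vd f (x + h))) (at x)"
    by (rule vector_diff_chain_at) (auto intro!: derivative_eq_intros smooth_has_vd f)
  then show "(translate h f has_vector_derivative translate h (vd f) x) (at x)"
    by (simp add: translate_def o_def)
qed

lemma smooth_translate:
  assumes "smooth f" shows "smooth (translate h f)"
proof (rule smooth_coinduct_set[where P="\<lambda>f. \<exists>g. smooth g \<and> f = translate h g"])
  fix f x assume "\<exists>g. smooth g \<and> f = translate h g"
  then obtain g where g: "smooth g" "f = translate h g" by blast
  have "((g \<circ> (\<lambda>x. x + h)) has_vector_derivative (1 *\<^sub>R vd g (x + h))) (at x)"
    by (rule vector_diff_chain_at) (auto intro!: derivative_eq_intros smooth_has_vd g)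
  then show "f differentiable at x" using g
    by (auto simp: translate_def o_def intro!: differentiableI_vector)
qed (use assms smooth_vd vd_translate in auto)

lemma funpow_vd_translate: "smooth f \<Longrightarrow> (vd ^^ n) (translate h f) = translate h ((vd ^^ n) f)"
  by (induction n) (auto simp: vd_translate smooth_funpow_vd)

section \<open>Schwartz seminorms on the line\<close>

text \<open>One index caps both the number of derivatives and the power of the weight.
  \<open>K\<close> is any upper bound instead of a supremum, so that a bound can be stated before
  anything is known to be finite.\<close>

definition line_bound :: "nat \<Rightarrow> (real \<Rightarrow> complex) \<Rightarrow> real \<Rightarrow> bool" where
  "line_bound N f K \<longleftrightarrow> (\<forall>i\<le>N. \<forall>x. (1 + x\<^sup>2) ^ N * cmod ((vd ^^ i) f x) \<le> K)"

lemma schwartz_line_vd: "schwartz_line f \<Longrightarrow> schwartz_line (vd f)"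
  unfolding vd_def by (erule schwartz_line.cases) auto

lemma schwartz_line_funpow: "schwartz_line f \<Longrightarrow> schwartz_line ((vd ^^ n) f)"
  by (induction n) (auto intro: schwartz_line_vd)

lemma schwartz_line_smooth: "schwartz_line f \<Longrightarrow> smooth f"
  by (rule smooth_coinduct_set[where P=schwartz_line])
    (auto intro: schwartz_line_vd elim: schwartz_line.cases)

lemma schwartz_line_decay: "schwartz_line f \<Longrightarrow> \<exists>C. \<forall>x. \<bar>x\<bar> ^ m * cmod (f x) \<le> C"
  by (erule schwartz_line.cases) auto

lemma schwartz_line_decay_square:
  assumes "schwartz_line f" shows "\<exists>C. \<forall>x. (1 + x\<^sup>2) ^ m * cmod (f x) \<le> C"
proof -
  obtain C0 C1 where C: "\<And>x. cmod (f x) \<le> C0" "\<And>x. \<bar>x\<bar> ^ (2 * m) * cmod (f x) \<le> C1"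
    using schwartz_line_decay[OF assms, of 0] schwartz_line_decay[OF assms, of "2 * m"] by auto
  have "(1 + x\<^sup>2) ^ m * cmod (f x) \<le> 2 ^ m * (C0 + C1)" for x
  proof -
    have "(1 + x\<^sup>2) ^ m \<le> 2 ^ m * (1 + \<bar>x\<bar> ^ (2 * m))"
    proof (cases "\<bar>x\<bar> \<le> 1")
      case True
      then have "1 + x\<^sup>2 \<le> 2" using abs_square_le_1 by auto
      then have "(1 + x\<^sup>2) ^ m \<le> 2 ^ m" by (intro power_mono) auto
      also have "\<dots> \<le> 2 ^ m * (1 + \<bar>x\<bar> ^ (2 * m))" by simp
      finally show ?thesis .
    next
      case False
      then have "1 + x\<^sup>2 \<le> 2 * x\<^sup>2" using abs_square_le_1[of x] by auto
      then have "(1 + x\<^sup>2) ^ m \<le> (2 * x\<^sup>2) ^ m" by (intro power_mono) auto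
      also have "\<dots> = 2 ^ m * (\<bar>x\<bar> ^ (2 * m))"
        by (simp add: power_mult_distrib power_mult)
      also have "\<dots> \<le> 2 ^ m * (1 + \<bar>x\<bar> ^ (2 * m))" by simp
      finally show ?thesis .
    qed
    then have "(1 + x\<^sup>2) ^ m * cmod (f x) \<le> 2 ^ m * (1 + \<bar>x\<bar> ^ (2 * m)) * cmod (f x)"
      by (rule mult_right_mono) auto
    also have "\<dots> = 2 ^ m * (cmod (f x) + \<bar>x\<bar> ^ (2 * m) * cmod (f x))"
      by (simp add: algebra_simps)
    also have "\<dots> \<le> 2 ^ m * (C0 + C1)"
      by (intro mult_left_mono add_mono C) auto
    finally show ?thesis .
  qed
  then show ?thesis by blast
qed

lemma schwartz_line_bound:
  assumes "schwartz_line f" shows "\<exists>K. line_bound N f K"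
proof -
  have "\<forall>i. \<exists>C. \<forall>x. (1 + x\<^sup>2) ^ N * cmod ((vd ^^ i) f x) \<le> C"
    using schwartz_line_decay_square schwartz_line_funpow assms by blast
  then obtain C where C: "\<And>i x. (1 + x\<^sup>2) ^ N * cmod ((vd ^^ i) f x) \<le> C i" by metis
  have "line_bound N f (Max (C ` {..N}))" unfolding line_bound_def
    by (meson C Max_ge atMost_iff finite_atMost finite_imageI imageI order_trans)
  then show ?thesis by blast
qed

lemma schwartz_lineI:
  assumes "smooth f" "\<And>N. \<exists>K. line_bound N f K" shows "schwartz_line f"
proof -
  \<comment> \<open>The weight exponent and the order of differentiation are decoupled here:
    \<open>line_bound\<close> at a fixed N does not pass from f to \<open>vd f\<close>, whereas this
    form is stable under \<open>vd\<close>.\<close>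
  define P where "P f \<longleftrightarrow> smooth f \<and> (\<forall>N i. \<exists>K. \<forall>x. (1 + x\<^sup>2) ^ N * cmod ((vd ^^ i) f x) \<le> K)"
    for f :: "real \<Rightarrow> complex"
  have "\<exists>K. \<forall>x. (1 + x\<^sup>2) ^ N * cmod ((vd ^^ i) f x) \<le> K" for N i
  proof -
    obtain K where K: "line_bound (max N i) f K" using assms(2) by blast
    have "(1 + x\<^sup>2) ^ N * cmod ((vd ^^ i) f x) \<le> K" for x
    proof -
      have "(1 + x\<^sup>2) ^ N * cmod ((vd ^^ i) f x) \<le> (1 + x\<^sup>2) ^ (max N i) * cmod ((vd ^^ i) f x)"
        by (intro mult_right_mono power_increasing) auto
      also have "\<dots> \<le> K" using K by (auto simp: line_bound_def)
      finally show ?thesis .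
    qed
    then show ?thesis by blast
  qed
  then have "P f" using assms by (auto simp: P_def)
  then show ?thesis
  proof (coinduction arbitrary: f rule: schwartz_line.coinduct)
    case (schwartz_line f)
    have "P (vd f)" unfolding P_def
    proof (intro conjI allI)
      show "smooth (vd f)" using schwartz_line smooth_vd P_def by blast
      fix N i
      show "\<exists>K. \<forall>x. (1 + x\<^sup>2) ^ N * cmod ((vd ^^ i) (vd f) x) \<le> K"
        using schwartz_line unfolding P_def by (metis funpow_Suc_right o_apply)
    qed
    moreover have "\<exists>C. \<forall>\<xi>. \<bar>\<xi>\<bar> ^ m * cmod (f \<xi>) \<le> C" for m
    proof -
      obtain K where K: "\<And>x. (1 + x\<^sup>2) ^ m * cmod (f x) \<le> K"
        using schwartz_line unfolding P_def by (metis funpow_0)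
      have "\<bar>\<xi>\<bar> ^ m * cmod (f \<xi>) \<le> K" for \<xi>
      proof -
        have "\<bar>\<xi>\<bar> \<le> 1 + \<xi>\<^sup>2"
          using zero_le_power2[of "\<bar>\<xi>\<bar> - 1"] unfolding power2_diff by simp
        then have "\<bar>\<xi>\<bar> ^ m * cmod (f \<xi>) \<le> (1 + \<xi>\<^sup>2) ^ m * cmod (f \<xi>)"
          by (intro mult_right_mono power_mono) auto
        then show ?thesis using K[of \<xi>] by linarith
      qed
      then show ?thesis by blast
    qed
    ultimately show ?case using schwartz_line smooth_differentiable by (auto simp: P_def vd_def)
  qed
qed

lemma line_bound_nonneg: "line_bound N f K \<Longrightarrow> 0 \<le> K"
  unfolding line_bound_def by (meson order_trans le0 mult_nonneg_nonneg norm_ge_zero zero_le_power add_nonneg_nonneg zero_le_one zero_le_power2)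

lemma line_bound_mono:
  assumes "line_bound N f K" "M \<le> N" "K \<le> L" shows "line_bound M f L"
  unfolding line_bound_def
proof (intro allI impI)
  fix i :: nat and x :: real assume "i \<le> M"
  have "(1 + x\<^sup>2) ^ M * cmod ((vd ^^ i) f x) \<le> (1 + x\<^sup>2) ^ N * cmod ((vd ^^ i) f x)"
    using assms by (intro mult_right_mono power_increasing) auto
  also have "\<dots> \<le> K" using assms \<open>i \<le> M\<close> by (auto simp: line_bound_def)
  finally show "(1 + x\<^sup>2) ^ M * cmod ((vd ^^ i) f x) \<le> L" using assms by linarith
qed

lemma line_bound_add:
  assumes "line_bound N f K" "line_bound N g L" "smooth f" "smooth g"
  shows "line_bound N (\<lambda>x. f x + g x) (K + L)"
  unfolding line_bound_def
proof (intro allI impI)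
  fix i :: nat and x :: real assume "i \<le> N"
  have "(1 + x\<^sup>2) ^ N * cmod ((vd ^^ i) (\<lambda>x. f x + g x) x) \<le>
     (1 + x\<^sup>2) ^ N * cmod ((vd ^^ i) f x) + (1 + x\<^sup>2) ^ N * cmod ((vd ^^ i) g x)"
    using assms by (simp add: funpow_vd_add norm_triangle_ineq mult_left_mono flip: distrib_left)
  also have "\<dots> \<le> K + L" using assms \<open>i \<le> N\<close> by (intro add_mono) (auto simp: line_bound_def)
  finally show "(1 + x\<^sup>2) ^ N * cmod ((vd ^^ i) (\<lambda>x. f x + g x) x) \<le> K + L" .
qed

lemma line_bound_cmult:
  assumes "line_bound N f K" "smooth f"
  shows "line_bound N (\<lambda>x. c * f x) (cmod c * K)"
  using assms unfolding line_bound_def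
  by (auto simp: funpow_vd_cmult norm_mult mult.left_commute mult_left_mono)

lemma line_bound_vd: "line_bound (Suc N) f K \<Longrightarrow> line_bound N (vd f) K"
  unfolding line_bound_def
proof (intro allI impI)
  fix i :: nat and x :: real assume *: "\<forall>i\<le>Suc N. \<forall>x. (1 + x\<^sup>2) ^ Suc N * cmod ((vd ^^ i) f x) \<le> K" and "i \<le> N"
  have "(1 + x\<^sup>2) ^ N * cmod ((vd ^^ i) (vd f) x) \<le> (1 + x\<^sup>2) ^ Suc N * cmod ((vd ^^ i) (vd f) x)"
    by (intro mult_right_mono power_increasing) auto
  also have "\<dots> = (1 + x\<^sup>2) ^ Suc N * cmod ((vd ^^ Suc i) f x)"
    by (simp only: funpow_Suc_right o_apply)
  also have "\<dots> \<le> K" using * \<open>i \<le> N\<close> by auto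
  finally show "(1 + x\<^sup>2) ^ N * cmod ((vd ^^ i) (vd f) x) \<le> K" .
qed

text \<open>The growth of \<open>f\<close> is paid for with m surplus powers of the weight on
  \<open>g\<close>; 2^N is the Leibniz factor.\<close>

lemma line_bound_mult:
  assumes "smooth f" "smooth g" "line_bound (N + m) g L"
    "\<And>i x. i \<le> N \<Longrightarrow> cmod ((vd ^^ i) f x) \<le> K * (1 + x\<^sup>2) ^ m"
  shows "line_bound N (\<lambda>x. f x * g x) (2 ^ N * K * L)"
  unfolding line_bound_def
proof (intro allI impI)
  fix i :: nat and x :: real assume i: "i \<le> N"
  have pos: "(1 + x\<^sup>2) ^ j > 0" for j by (intro zero_less_power add_pos_nonneg) auto
  have L: "0 \<le> L" by (rule line_bound_nonneg[OF assms(3)])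
  have K: "0 \<le> K"
  proof -
    have "0 \<le> K * (1 + x\<^sup>2) ^ m" using assms(4)[of 0 x] norm_ge_zero order_trans by blast
    then show ?thesis using pos[of m] by (simp add: zero_le_mult_iff)
  qed
  have g: "cmod ((vd ^^ j) g x) \<le> L / (1 + x\<^sup>2) ^ (N + m)" if "j \<le> i" for j
    using assms(3) that i pos[of "N + m"] by (simp add: line_bound_def pos_le_divide_eq mult.commute)
  have "cmod ((vd ^^ i) (\<lambda>x. f x * g x) x) \<le> 2 ^ i * (K * (1 + x\<^sup>2) ^ m * (L / (1 + x\<^sup>2) ^ (N + m)))"
    using assms(1,2,4) g i by (intro funpow_vd_mult_bound) auto
  then have "(1 + x\<^sup>2) ^ N * cmod ((vd ^^ i) (\<lambda>x. f x * g x) x) \<le>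
      (1 + x\<^sup>2) ^ N * (2 ^ i * (K * (1 + x\<^sup>2) ^ m * (L / (1 + x\<^sup>2) ^ (N + m))))"
    using pos[of N] by (intro mult_left_mono) auto
  also have "\<dots> = 2 ^ i * K * L"
    using pos[of 1] pos[of N] pos[of m] by (simp add: power_add field_simps)
  also have "\<dots> \<le> 2 ^ N * K * L"
    using i K L by (intro mult_right_mono power_increasing) auto
  finally show "(1 + x\<^sup>2) ^ N * cmod ((vd ^^ i) (\<lambda>x. f x * g x) x) \<le> 2 ^ N * K * L" .
qed

section \<open>Multipliers of the Schwartz space\<close>

text \<open>Slowly increasing functions with one growth exponent common to all derivatives. This is
  stronger than the usual multiplier condition, but it is what Cauchy's estimates on discs of fixed
  radius deliver.\<close>

definition tame :: "(real \<Rightarrow> complex) \<Rightarrow> bool" where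
  "tame f \<longleftrightarrow> smooth f \<and> (\<exists>m. \<forall>N. \<exists>K. \<forall>i\<le>N. \<forall>x. cmod ((vd ^^ i) f x) \<le> K * (1 + x\<^sup>2) ^ m)"

lemma tame_mult_bound:
  assumes "tame f"
  shows "\<exists>m C. \<forall>g L. smooth g \<longrightarrow> line_bound (N + m) g L \<longrightarrow> line_bound N (\<lambda>x. f x * g x) (C * L)"
proof -
  obtain m K where m: "\<And>i x. i \<le> N \<Longrightarrow> cmod ((vd ^^ i) f x) \<le> K * (1 + x\<^sup>2) ^ m"
    using assms unfolding tame_def by meson
  then have "\<forall>g L. smooth g \<longrightarrow> line_bound (N + m) g L \<longrightarrow> line_bound N (\<lambda>x. f x * g x) (2 ^ N * K * L)"
    using assms by (auto simp: tame_def intro!: line_bound_mult)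
  then show ?thesis by blast
qed

lemma schwartz_line_tame_mult:
  assumes "tame f" "schwartz_line g" shows "schwartz_line (\<lambda>x. f x * g x)"
proof (rule schwartz_lineI)
  show "smooth (\<lambda>x. f x * g x)" using assms by (metis smooth_mult schwartz_line_smooth tame_def)
  fix N
  show "\<exists>K. line_bound N (\<lambda>x. f x * g x) K"
    using tame_mult_bound[OF assms(1)] schwartz_line_bound[OF assms(2)] schwartz_line_smooth[OF assms(2)]
    by meson
qed

lemma schwartz_line_add: "schwartz_line f \<Longrightarrow> schwartz_line g \<Longrightarrow> schwartz_line (\<lambda>x. f x + g x)"
proof (rule schwartz_lineI)
  assume *: "schwartz_line f" "schwartz_line g"
  note s = *[THEN schwartz_line_smooth]
  show "smooth (\<lambda>x. f x + g x)" by (intro smooth_add s)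
  show "\<exists>K. line_bound N (\<lambda>x. f x + g x) K" for N
    using *[THEN schwartz_line_bound, of N] line_bound_add s by blast
qed

lemma schwartz_line_cmult: "schwartz_line f \<Longrightarrow> schwartz_line (\<lambda>x. c * f x)"
proof (rule schwartz_lineI)
  assume *: "schwartz_line f"
  note s = *[THEN schwartz_line_smooth]
  show "smooth (\<lambda>x. c * f x)" by (intro smooth_cmult s)
  show "\<exists>K. line_bound N (\<lambda>x. c * f x) K" for N
    using *[THEN schwartz_line_bound, of N] line_bound_cmult s by blast
qed

lemma schwartz_line_diff: "schwartz_line f \<Longrightarrow> schwartz_line g \<Longrightarrow> schwartz_line (\<lambda>x. f x - g x)"
  using schwartz_line_add[of f "\<lambda>x. (-1) * g x"] schwartz_line_cmult[of g "-1"] by simp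

section \<open>Translations and Taylor remainders\<close>

text \<open>Peetre's inequality: the difference of the two sides is 1 plus a sum of squares. It
  moves the weight from x to x + h at a cost that is uniform for bounded h.\<close>

lemma peetre: "1 + (x::real)\<^sup>2 \<le> 2 * (1 + h\<^sup>2) * (1 + (x + h)\<^sup>2)"
proof -
  have "2 * (1 + h\<^sup>2) * (1 + (x + h)\<^sup>2) - (1 + x\<^sup>2) = 1 + (x + 2 * h)\<^sup>2 + 2 * (h * (x + h))\<^sup>2"
    by (simp add: power2_eq_square algebra_simps)
  then show ?thesis by (smt (verit) zero_le_power2)
qed

lemma line_bound_translate:
  assumes "line_bound N f K" "smooth f" "\<bar>h\<bar> \<le> H"
  shows "line_bound N (translate h f) ((2 * (1 + H\<^sup>2)) ^ N * K)"
  unfolding line_bound_def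
proof (intro allI impI)
  fix i :: nat and x :: real assume i: "i \<le> N"
  have "h\<^sup>2 \<le> H\<^sup>2" using assms(3) by (metis abs_ge_zero power2_abs power_mono)
  have "(1 + x\<^sup>2) ^ N \<le> (2 * (1 + H\<^sup>2) * (1 + (x + h)\<^sup>2)) ^ N"
  proof (rule power_mono)
    have "2 * (1 + h\<^sup>2) * (1 + (x + h)\<^sup>2) \<le> 2 * (1 + H\<^sup>2) * (1 + (x + h)\<^sup>2)"
      using \<open>h\<^sup>2 \<le> H\<^sup>2\<close> by (intro mult_right_mono) auto
    then show "1 + x\<^sup>2 \<le> 2 * (1 + H\<^sup>2) * (1 + (x + h)\<^sup>2)" using peetre[of x h] by linarith
  qed auto
  then have "(1 + x\<^sup>2) ^ N * cmod ((vd ^^ i) (translate h f) x) \<le>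
     (2 * (1 + H\<^sup>2) * (1 + (x + h)\<^sup>2)) ^ N * cmod ((vd ^^ i) f (x + h))"
    by (simp only: funpow_vd_translate[OF assms(2)]) (simp only: translate_def mult_right_mono norm_ge_zero)
  also have "\<dots> = (2 * (1 + H\<^sup>2)) ^ N * ((1 + (x + h)\<^sup>2) ^ N * cmod ((vd ^^ i) f (x + h)))"
    by (simp add: power_mult_distrib)
  also have "\<dots> \<le> (2 * (1 + H\<^sup>2)) ^ N * K"
    using assms(1) i by (intro mult_left_mono) (auto simp: line_bound_def)
  finally show "(1 + x\<^sup>2) ^ N * cmod ((vd ^^ i) (translate h f) x) \<le> (2 * (1 + H\<^sup>2)) ^ N * K" .
qed

lemma schwartz_line_translate: "schwartz_line f \<Longrightarrow> schwartz_line (translate h f)"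
proof (rule schwartz_lineI)
  assume *: "schwartz_line f"
  note s = *[THEN schwartz_line_smooth]
  show "smooth (translate h f)" by (intro smooth_translate s)
  show "\<exists>K. line_bound N (translate h f) K" for N
    using *[THEN schwartz_line_bound, of N] line_bound_translate[OF _ s order_refl] by blast
qed

text \<open>With an O(h^2) remainder the difference quotient converges at rate |h|. Fourier
  transforms and pairings of curves are differentiated through this criterion, so explicit bounds
  take the place of dominated convergence.\<close>

lemma quadratic_remainder_imp_has_vector_derivative:
  fixes f :: "real \<Rightarrow> 'a::real_normed_vector"
  assumes "d > 0" "\<And>h. \<bar>h\<bar> \<le> d \<Longrightarrow> norm (f (x + h) - f x - h *\<^sub>R f') \<le> C * h\<^sup>2"
  shows "(f has_vector_derivative f') (at x)"
  unfolding has_vector_derivative_def has_derivative_at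
proof
  show "bounded_linear (\<lambda>h. h *\<^sub>R f')" by (rule bounded_linear_scaleR_left)
  show "(\<lambda>h. norm (f (x + h) - f x - h *\<^sub>R f') / norm h) \<midarrow>0\<rightarrow> 0"
  proof (rule Lim_null_comparison)
    show "\<forall>\<^sub>F h in at 0. norm (norm (f (x + h) - f x - h *\<^sub>R f') / norm h) \<le> C * \<bar>h\<bar>"
      unfolding eventually_at
    proof (intro exI[of _ d] conjI ballI impI assms(1))
      fix h :: real assume "h \<noteq> 0 \<and> dist h 0 < d"
      then have "norm (f (x + h) - f x - h *\<^sub>R f') \<le> C * \<bar>h\<bar> * \<bar>h\<bar>" "h \<noteq> 0"
        using assms(2)[of h] by (auto simp: power2_eq_square)
      then show "norm (norm (f (x + h) - f x - h *\<^sub>R f') / norm h) \<le> C * \<bar>h\<bar>"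
        by (simp add: pos_divide_le_eq)
    qed
    show "(\<lambda>h. C * \<bar>h\<bar>) \<midarrow>0\<rightarrow> 0"
      by (rule tendsto_eq_intros | simp)+
  qed
qed

lemma lipschitz_of_derivative_bound:
  fixes f :: "real \<Rightarrow> 'a::real_normed_vector"
  assumes "\<And>r. r \<in> closed_segment s t \<Longrightarrow> (f has_vector_derivative f' r) (at r)"
    and "\<And>r. r \<in> closed_segment s t \<Longrightarrow> norm (f' r) \<le> L"
  shows "norm (f t - f s) \<le> L * \<bar>t - s\<bar>"
proof -
  have "norm (f t - f s) \<le> L * norm (t - s)"
  proof (rule differentiable_bound[OF convex_closed_segment])
    show "(f has_derivative (\<lambda>h. h *\<^sub>R f' r)) (at r within closed_segment s t)" if "r \<in> closed_segment s t" for r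
      using assms(1)[OF that] unfolding has_vector_derivative_def by (rule has_derivative_at_withinI)
    show "onorm (\<lambda>h. h *\<^sub>R f' r) \<le> L" if "r \<in> closed_segment s t" for r
      using mult_right_mono[OF assms(2)[OF that] abs_ge_zero] by (intro onorm_le) (simp add: mult.commute)
  qed auto
  then show ?thesis by simp
qed

text \<open>Mean value inequality for f(t) - t f'(s), whose derivative is at most L |t - s| on the
  segment. The constant is L rather than L/2 because nothing is integrated.\<close>

lemma quadratic_remainder_of_lipschitz_derivative:
  fixes f :: "real \<Rightarrow> 'a::real_normed_vector"
  assumes "\<And>r. r \<in> closed_segment s t \<Longrightarrow> (f has_vector_derivative f' r) (at r)"
    and "\<And>r. r \<in> closed_segment s t \<Longrightarrow> norm (f' r - f' s) \<le> L * \<bar>r - s\<bar>" and "L \<ge> 0"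
  shows "norm (f t - f s - (t - s) *\<^sub>R f' s) \<le> L * (t - s)\<^sup>2"
proof -
  have "norm ((f t - t *\<^sub>R f' s) - (f s - s *\<^sub>R f' s)) \<le> (L * \<bar>t - s\<bar>) * \<bar>t - s\<bar>"
  proof (rule lipschitz_of_derivative_bound)
    fix r assume r: "r \<in> closed_segment s t"
    show "((\<lambda>t. f t - t *\<^sub>R f' s) has_vector_derivative (f' r - f' s)) (at r)"
      by (auto intro!: derivative_eq_intros assms(1)[OF r])
    have "\<bar>r - s\<bar> \<le> \<bar>t - s\<bar>" using r by (auto simp: closed_segment_eq_real_ivl split: if_splits)
    then show "norm (f' r - f' s) \<le> L * \<bar>t - s\<bar>"
      using assms(2)[OF r] assms(3) by (meson mult_left_mono order_trans)
  qed
  moreover have "(f t - t *\<^sub>R f' s) - (f s - s *\<^sub>R f' s) = f t - f s - (t - s) *\<^sub>R f' s"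
    by (simp add: algebra_simps)
  ultimately show ?thesis by (simp add: power2_eq_square)
qed

text \<open>First-order Taylor expansion in the Schwartz topology. Two further derivatives of
  \<open>f\<close> bound the remainder, and the translation bound moves the weight from the
  intermediate points x + r back to x.\<close>

lemma line_bound_translate_remainder:
  assumes f: "smooth f" and K: "line_bound (N + 2) f K" and h: "\<bar>h\<bar> \<le> H"
  shows "line_bound N (\<lambda>x. translate h f x - f x - of_real h * vd f x) ((2 * (1 + H\<^sup>2)) ^ (N + 2) * K * h\<^sup>2)"
  unfolding line_bound_def
proof (intro allI impI)
  fix i :: nat and x :: real assume i: "i \<le> N"
  define w where "w = (1 + x\<^sup>2) ^ N"
  define L where "L = (2 * (1 + H\<^sup>2)) ^ (N + 2) * K / w"
  have w: "w > 0" unfolding w_def by (intro zero_less_power add_pos_nonneg) auto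
  have L: "L \<ge> 0" using line_bound_nonneg[OF K] w by (auto simp: L_def)
  define F where "F = (vd ^^ i) f"
  have F: "smooth F" by (simp add: F_def smooth_funpow_vd f)
  have bnd: "cmod (vd (vd F) (x + r)) \<le> L" if r: "\<bar>r\<bar> \<le> \<bar>h\<bar>" for r
  proof -
    have "line_bound (N + 2) (translate r f) ((2 * (1 + H\<^sup>2)) ^ (N + 2) * K)"
      using r h by (intro line_bound_translate K f) auto
    then have "(1 + x\<^sup>2) ^ (N + 2) * cmod ((vd ^^ (Suc (Suc i))) (translate r f) x) \<le> (2 * (1 + H\<^sup>2)) ^ (N + 2) * K"
      unfolding line_bound_def
    proof (elim allE impE)
      show "Suc (Suc i) \<le> N + 2" using i by simp
    qed
    moreover have "(vd ^^ (Suc (Suc i))) (translate r f) x = vd (vd F) (x + r)"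
      by (simp only: funpow_vd_translate[OF f]) (simp add: F_def translate_def)
    moreover have "w * cmod (vd (vd F) (x + r)) \<le> (1 + x\<^sup>2) ^ (N + 2) * cmod (vd (vd F) (x + r))"
      unfolding w_def by (intro mult_right_mono power_increasing) auto
    ultimately show ?thesis using w by (simp add: L_def pos_le_divide_eq mult.commute)
  qed
  have d: "(F has_vector_derivative vd F r) (at r)" "(vd F has_vector_derivative vd (vd F) r) (at r)" for r
    by (auto intro!: smooth_has_vd smooth_vd F)
  have seg: "\<bar>r - x\<bar> \<le> \<bar>h\<bar>" if "r \<in> closed_segment x (x + h)" for r
    using that by (auto simp: closed_segment_eq_real_ivl split: if_splits)
  have "norm (F (x + h) - F x - (x + h - x) *\<^sub>R vd F x) \<le> L * (x + h - x)\<^sup>2"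
  proof (rule quadratic_remainder_of_lipschitz_derivative[OF d(1) _ L])
    fix r assume r: "r \<in> closed_segment x (x + h)"
    show "norm (vd F r - vd F x) \<le> L * \<bar>r - x\<bar>"
    proof (rule lipschitz_of_derivative_bound[OF d(2)])
      fix r' assume "r' \<in> closed_segment x r"
      then have "\<bar>r' - x\<bar> \<le> \<bar>r - x\<bar>" by (auto simp: closed_segment_eq_real_ivl split: if_splits)
      then show "cmod (vd (vd F) r') \<le> L" using bnd[of "r' - x"] seg[OF r] by simp
    qed
  qed
  then have "w * cmod (F (x + h) - F x - h *\<^sub>R vd F x) \<le> w * (L * h\<^sup>2)"
    using w by simp
  also have "w * (L * h\<^sup>2) = (2 * (1 + H\<^sup>2)) ^ (N + 2) * K * h\<^sup>2"
    using w by (simp add: L_def)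
  finally have 1: "w * cmod (F (x + h) - F x - h *\<^sub>R vd F x) \<le> (2 * (1 + H\<^sup>2)) ^ (N + 2) * K * h\<^sup>2" .
  have "(vd ^^ i) (\<lambda>x. translate h f x - f x - of_real h * vd f x) x
      = translate h F x - F x - of_real h * (vd ^^ i) (vd f) x"
    by (simp add: funpow_vd_diff funpow_vd_cmult funpow_vd_translate smooth_diff smooth_cmult smooth_translate
        smooth_vd f F_def)
  also have "(vd ^^ i) (vd f) x = vd F x"
    unfolding F_def by (metis funpow_swap1)
  finally show "(1 + x\<^sup>2) ^ N * cmod ((vd ^^ i) (\<lambda>x. translate h f x - f x - of_real h * vd f x) x)
     \<le> (2 * (1 + H\<^sup>2)) ^ (N + 2) * K * h\<^sup>2"
    using 1 by (simp add: translate_def w_def scaleR_conv_of_real)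
qed

section \<open>Test functions on the cylinder\<close>

lemma test_function_unfold:
  assumes "test_function \<phi>"
  shows "\<phi> (x + 2 * pi) y = \<phi> x y" "(\<lambda>(x, y). \<phi> x y) differentiable at z"
    "\<exists>C. \<forall>x y. \<bar>y\<bar> ^ m * cmod (\<phi> x y) \<le> C" "test_function (pdx \<phi>)" "test_function (pdy \<phi>)"
proof -
  from assms have "(\<forall>x y. \<phi> (x + 2 * pi) y = \<phi> x y) \<and> (\<forall>z. (\<lambda>(x, y). \<phi> x y) differentiable at z) \<and>
      (\<forall>m::nat. \<exists>C. \<forall>x y. \<bar>y\<bar> ^ m * cmod (\<phi> x y) \<le> C) \<and> test_function (pdx \<phi>) \<and> test_function (pdy \<phi>)"
    by (subst (asm) test_function.simps) blast
  then show "\<phi> (x + 2 * pi) y = \<phi> x y" "(\<lambda>(x, y). \<phi> x y) differentiable at z"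
    "\<exists>C. \<forall>x y. \<bar>y\<bar> ^ m * cmod (\<phi> x y) \<le> C" "test_function (pdx \<phi>)" "test_function (pdy \<phi>)" by iprover+
qed

lemma test_function_coinduct_set:
  assumes "P f" and "\<And>f x y. P f \<Longrightarrow> f (x + 2 * pi) y = f x y"
    and "\<And>f z. P f \<Longrightarrow> (\<lambda>(x, y). f x y) differentiable at z"
    and "\<And>f m. P f \<Longrightarrow> \<exists>C. \<forall>x y. \<bar>y\<bar> ^ m * cmod (f x y) \<le> C"
    and "\<And>f. P f \<Longrightarrow> P (pdx f)" "\<And>f. P f \<Longrightarrow> P (pdy f)"
  shows "test_function f"
  by (rule test_function.coinduct[of P, OF assms(1)], rule exI, rule conjI, rule refl, intro conjI allI disjI1 assms(2-))

lemmas test_function_periodic = test_function_unfold(1)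
lemmas test_function_differentiable = test_function_unfold(2)
lemmas test_function_decay = test_function_unfold(3)
lemmas test_function_pdx = test_function_unfold(4)
lemmas test_function_pdy = test_function_unfold(5)

lemma has_partial_derivatives:
  assumes "((\<lambda>(x, y). \<phi> x y) has_derivative D) (at (x, y))"
  shows "((\<lambda>x'. \<phi> x' y) has_vector_derivative D (1, 0)) (at x)"
    "((\<lambda>y'. \<phi> x y') has_vector_derivative D (0, 1)) (at y)"
proof -
  interpret bounded_linear D using assms by (rule has_derivative_bounded_linear)
  have "((\<lambda>(x, y). \<phi> x y) \<circ> (\<lambda>x'. (x', y)) has_derivative D \<circ> (\<lambda>h. (h, 0))) (at x)"
    using assms by (intro diff_chain_at) (auto intro!: derivative_eq_intros)
  moreover have "D \<circ> (\<lambda>h. (h, 0)) = (\<lambda>h. h *\<^sub>R D (1, 0))"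
    by (rule ext) (simp add: scaleR[symmetric])
  ultimately show "((\<lambda>x'. \<phi> x' y) has_vector_derivative D (1, 0)) (at x)"
    by (simp add: has_vector_derivative_def o_def)
  have "((\<lambda>(x, y). \<phi> x y) \<circ> (\<lambda>y'. (x, y')) has_derivative D \<circ> (\<lambda>h. (0, h))) (at y)"
    using assms by (intro diff_chain_at) (auto intro!: derivative_eq_intros)
  moreover have "D \<circ> (\<lambda>h. (0, h)) = (\<lambda>h. h *\<^sub>R D (0, 1))"
    by (rule ext) (simp add: scaleR[symmetric])
  ultimately show "((\<lambda>y'. \<phi> x y') has_vector_derivative D (0, 1)) (at y)"
    by (simp add: has_vector_derivative_def o_def)
qed

text \<open>Expresses the total derivative through \<open>pdx\<close> and \<open>pdy\<close>, in the
  form that the chain rule for the shear needs.\<close>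

lemma test_function_has_derivative:
  assumes "test_function \<phi>"
  shows "((\<lambda>(x, y). \<phi> x y) has_derivative (\<lambda>(h, k). h *\<^sub>R pdx \<phi> x y + k *\<^sub>R pdy \<phi> x y)) (at (x, y))"
proof -
  obtain D where D: "((\<lambda>(x, y). \<phi> x y) has_derivative D) (at (x, y))"
    using test_function_differentiable[OF assms] unfolding differentiable_def by blast
  interpret bounded_linear D using D by (rule has_derivative_bounded_linear)
  have pd: "pdx \<phi> x y = D (1, 0)" "pdy \<phi> x y = D (0, 1)"
    unfolding pdx_def pdy_def by (intro vector_derivative_at has_partial_derivatives D)+
  have lin: "D z = fst z *\<^sub>R D (1, 0) + snd z *\<^sub>R D (0, 1)" for z
  proof -
    have "D z = D (fst z *\<^sub>R (1, 0) + snd z *\<^sub>R (0, 1))" by simp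
    also have "\<dots> = fst z *\<^sub>R D (1, 0) + snd z *\<^sub>R D (0, 1)" by (simp only: add scaleR)
    finally show ?thesis .
  qed
  have "D = (\<lambda>(h, k). h *\<^sub>R pdx \<phi> x y + k *\<^sub>R pdy \<phi> x y)"
    unfolding pd split_beta by (rule ext) (rule lin)
  then show ?thesis using D by simp
qed

lemma has_pdx: "test_function \<phi> \<Longrightarrow> ((\<lambda>x'. \<phi> x' y) has_vector_derivative pdx \<phi> x y) (at x)"
  using has_partial_derivatives(1)[OF test_function_has_derivative] by simp

lemma has_pdy: "test_function \<phi> \<Longrightarrow> ((\<lambda>y'. \<phi> x y') has_vector_derivative pdy \<phi> x y) (at y)"
  using has_partial_derivatives(2)[OF test_function_has_derivative] by simp

lemma pdx_eqI: "(\<And>x y. ((\<lambda>x'. \<phi> x' y) has_vector_derivative \<psi> x y) (at x)) \<Longrightarrow> pdx \<phi> = \<psi>"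
  unfolding pdx_def by (intro ext vector_derivative_at) auto

lemma pdy_eqI: "(\<And>x y. ((\<lambda>y'. \<phi> x y') has_vector_derivative \<psi> x y) (at y)) \<Longrightarrow> pdy \<phi> = \<psi>"
  unfolding pdy_def by (intro ext vector_derivative_at) auto

lemma pd_linear:
  assumes "test_function \<phi>" "test_function \<psi>"
  shows "pdx (\<lambda>x y. a * \<phi> x y + b * \<psi> x y) = (\<lambda>x y. a * pdx \<phi> x y + b * pdx \<psi> x y)"
    "pdy (\<lambda>x y. a * \<phi> x y + b * \<psi> x y) = (\<lambda>x y. a * pdy \<phi> x y + b * pdy \<psi> x y)"
   apply (rule pdx_eqI, intro has_vector_derivative_add has_vector_derivative_mult_right has_pdx assms)
  apply (rule pdy_eqI, intro has_vector_derivative_add has_vector_derivative_mult_right has_pdy assms)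
  done

lemma test_function_linear:
  assumes "test_function \<phi>" "test_function \<psi>"
  shows "test_function (\<lambda>x y. a * \<phi> x y + b * \<psi> x y)"
proof -
  define P where "P f \<longleftrightarrow> (\<exists>\<phi> \<psi>. test_function \<phi> \<and> test_function \<psi> \<and> f = (\<lambda>x y. a * \<phi> x y + b * \<psi> x y))" for f
  have "P (\<lambda>x y. a * \<phi> x y + b * \<psi> x y)" using assms unfolding P_def by blast
  then show ?thesis
  proof (rule test_function_coinduct_set[of P])
    fix f assume "P f"
    then obtain \<phi> \<psi> where t: "test_function \<phi>" "test_function \<psi>" and f: "f = (\<lambda>x y. a * \<phi> x y + b * \<psi> x y)"
      unfolding P_def by blast
    show "f (x + 2 * pi) y = f x y" for x y using t by (simp add: f test_function_periodic)
    have eq: "(\<lambda>(x, y). f x y) = (\<lambda>z. a * (\<lambda>(x, y). \<phi> x y) z + b * (\<lambda>(x, y). \<psi> x y) z)"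
      by (auto simp: f)
    show "(\<lambda>(x, y). f x y) differentiable at z" for z
      unfolding eq by (intro differentiable_add differentiable_mult differentiable_const test_function_differentiable t)
    show "\<exists>C. \<forall>x y. \<bar>y\<bar> ^ m * cmod (f x y) \<le> C" for m
    proof -
      obtain C D where C: "\<And>x y. \<bar>y\<bar> ^ m * cmod (\<phi> x y) \<le> C" and D: "\<And>x y. \<bar>y\<bar> ^ m * cmod (\<psi> x y) \<le> D"
        using test_function_decay t by metis
      have "\<bar>y\<bar> ^ m * cmod (f x y) \<le> cmod a * C + cmod b * D" for x y
      proof -
        have "cmod (f x y) \<le> cmod a * cmod (\<phi> x y) + cmod b * cmod (\<psi> x y)"
          unfolding f by (metis norm_triangle_ineq norm_mult)
        then have "\<bar>y\<bar> ^ m * cmod (f x y) \<le> \<bar>y\<bar> ^ m * (cmod a * cmod (\<phi> x y) + cmod b * cmod (\<psi> x y))"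
          by (intro mult_left_mono) auto
        also have "\<dots> = cmod a * (\<bar>y\<bar> ^ m * cmod (\<phi> x y)) + cmod b * (\<bar>y\<bar> ^ m * cmod (\<psi> x y))"
          by (simp add: algebra_simps)
        also have "\<dots> \<le> cmod a * C + cmod b * D" by (intro add_mono mult_left_mono C D) auto
        finally show ?thesis .
      qed
      then show ?thesis by blast
    qed
    show "P (pdx f)" "P (pdy f)"
      using t unfolding f pd_linear[OF t] P_def by (blast intro: test_function_pdx test_function_pdy)+
  qed
qed

lemma pdx_add: "test_function \<phi> \<Longrightarrow> test_function \<psi> \<Longrightarrow> pdx (\<lambda>x y. \<phi> x y + \<psi> x y) = (\<lambda>x y. pdx \<phi> x y + pdx \<psi> x y)"
  and pdy_add: "test_function \<phi> \<Longrightarrow> test_function \<psi> \<Longrightarrow> pdy (\<lambda>x y. \<phi> x y + \<psi> x y) = (\<lambda>x y. pdy \<phi> x y + pdy \<psi> x y)"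
  and pdx_cmult: "test_function \<phi> \<Longrightarrow> pdx (\<lambda>x y. c * \<phi> x y) = (\<lambda>x y. c * pdx \<phi> x y)"
  and pdy_cmult: "test_function \<phi> \<Longrightarrow> pdy (\<lambda>x y. c * \<phi> x y) = (\<lambda>x y. c * pdy \<phi> x y)"
  using pd_linear[of \<phi> \<psi> 1 1] pd_linear[of \<phi> \<phi> c 0] by simp_all

lemma test_function_continuous:
  assumes "test_function \<phi>" shows "continuous_on A (\<lambda>(x, y). \<phi> x y)"
  using test_function_differentiable[OF assms]
  by (intro continuous_at_imp_continuous_on ballI differentiable_imp_continuous_within)

text \<open>Schwarz's theorem. The mixed derivative is continuous because it is again a test
  function. Integrating \<open>pdx\<close> in x and differentiating under the integral in y exhibits
  \<open>pdy (pdx \<phi>)\<close> as the x-derivative of \<open>pdy \<phi>\<close>.\<close>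

lemma pdx_pdy_commute:
  assumes \<phi>: "test_function \<phi>" shows "pdx (pdy \<phi>) = pdy (pdx \<phi>)"
proof (rule pdx_eqI)
  fix x0 y0 :: real
  note t = \<phi> test_function_pdx[OF \<phi>] test_function_pdy[OF \<phi>] test_function_pdy[OF test_function_pdx[OF \<phi>]]
  \<comment> \<open>A base point strictly to the left of \<open>x0\<close>, so that
    \<open>x0\<close> is interior to the range of the upper limit and the derivative there is
    two-sided.\<close>
  define a where "a = x0 - 1"
  have ftc: "integral {a..x} (\<lambda>s. pdx \<phi> s y) = \<phi> x y - \<phi> a y" if "a \<le> x" for x y
    by (rule integral_unique) (rule fundamental_theorem_of_calculus[OF that], rule has_vector_derivative_at_within, rule has_pdx[OF \<phi>])
  have cont: "continuous_on {a..x} (\<lambda>s. \<psi> s y)" if "test_function \<psi>" for \<psi> x y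
  proof -
    have "continuous_on {a..x} ((\<lambda>(x, y). \<psi> x y) \<circ> (\<lambda>s. (s, y)))"
      by (intro continuous_on_compose continuous_intros test_function_continuous[OF that])
    then show ?thesis by (simp add: o_def)
  qed
  have eq: "integral {a..x} (\<lambda>s. pdy (pdx \<phi>) s y0) = pdy \<phi> x y0 - pdy \<phi> a y0" if "a \<le> x" for x
  proof -
    have "((\<lambda>y. integral (cbox a x) (\<lambda>s. pdx \<phi> s y)) has_vector_derivative
        integral (cbox a x) (\<lambda>s. pdy (pdx \<phi>) s y0)) (at y0 within UNIV)"
    proof (rule leibniz_rule_vector_derivative)
      show "((\<lambda>y. pdx \<phi> s y) has_vector_derivative pdy (pdx \<phi>) s y) (at y within UNIV)" for y s
        using has_pdy[OF t(2)] by simp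
      show "(\<lambda>s. pdx \<phi> s y) integrable_on cbox a x" for y
        by (intro integrable_continuous) (simp add: cont[OF t(2)])
      show "continuous_on (UNIV \<times> cbox a x) (\<lambda>(y, s). pdy (pdx \<phi>) s y)"
      proof -
        have "continuous_on (UNIV \<times> cbox a x) ((\<lambda>(x, y). pdy (pdx \<phi>) x y) \<circ> (\<lambda>p. (snd p, fst p)))"
          by (intro continuous_on_compose continuous_intros test_function_continuous[OF t(4)])
        then show ?thesis by (simp add: o_def case_prod_unfold)
      qed
    qed auto
    moreover have "((\<lambda>y. integral (cbox a x) (\<lambda>s. pdx \<phi> s y)) has_vector_derivative (pdy \<phi> x y0 - pdy \<phi> a y0)) (at y0)"
      using that by (simp add: ftc) (intro has_vector_derivative_diff has_pdy[OF \<phi>])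
    ultimately show ?thesis using vector_derivative_unique_at by fastforce
  qed
  have "((\<lambda>x. integral {a..x} (\<lambda>s. pdy (pdx \<phi>) s y0)) has_vector_derivative pdy (pdx \<phi>) x0 y0) (at x0 within {a..x0 + 1})"
    by (rule integral_has_vector_derivative[OF cont[OF t(4)]]) (simp add: a_def)
  then have "((\<lambda>x. integral {a..x} (\<lambda>s. pdy (pdx \<phi>) s y0)) has_vector_derivative pdy (pdx \<phi>) x0 y0) (at x0)"
    using at_within_Icc_at[of a x0 "x0 + 1"] by (simp add: a_def)
  then have "((\<lambda>x. pdy \<phi> x y0 - pdy \<phi> a y0) has_vector_derivative pdy (pdx \<phi>) x0 y0) (at x0)"
    by (rule has_vector_derivative_transform_within_open[of _ _ _ "{a<..}"]) (auto simp: eq, auto simp: a_def)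
  then have "((\<lambda>x. (pdy \<phi> x y0 - pdy \<phi> a y0) + pdy \<phi> a y0) has_vector_derivative pdy (pdx \<phi>) x0 y0 + 0) (at x0)"
    by (intro has_vector_derivative_add has_vector_derivative_const)
  then show "((\<lambda>x'. pdy \<phi> x' y0) has_vector_derivative pdy (pdx \<phi>) x0 y0) (at x0)" by simp
qed

section \<open>The shear on test functions\<close>

definition shear :: "real \<Rightarrow> (real \<Rightarrow> real \<Rightarrow> complex) \<Rightarrow> real \<Rightarrow> real \<Rightarrow> complex" where
  "shear t \<phi> = (\<lambda>x y. \<phi> (x - t * y) y)"

text \<open>The operator d_y - t d_x, which is d_y conjugated by the shear. The coefficient 1 is
  spelled out so that the body is an instance of \<open>test_function_linear\<close>.\<close>

definition sheared_pdy :: "real \<Rightarrow> (real \<Rightarrow> real \<Rightarrow> complex) \<Rightarrow> real \<Rightarrow> real \<Rightarrow> complex" where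
  "sheared_pdy t \<phi> = (\<lambda>x y. 1 * pdy \<phi> x y + (- of_real t) * pdx \<phi> x y)"

lemma test_function_sheared_pdy: "test_function \<phi> \<Longrightarrow> test_function (sheared_pdy t \<phi>)"
  unfolding sheared_pdy_def by (intro test_function_linear test_function_pdx test_function_pdy)

lemma shear_has_derivative:
  assumes "test_function \<phi>"
  shows "((\<lambda>(x, y). shear t \<phi> x y) has_derivative
     (\<lambda>(h, k). (h - t * k) *\<^sub>R pdx \<phi> (x - t * y) y + k *\<^sub>R pdy \<phi> (x - t * y) y)) (at (x, y))"
proof -
  have 1: "((\<lambda>z. (fst z - t * snd z, snd z)) has_derivative (\<lambda>z. (fst z - t * snd z, snd z))) (at (x, y))"
    by (auto intro!: derivative_eq_intros)
  have 2: "((\<lambda>(x, y). \<phi> x y) has_derivative (\<lambda>(h, k). h *\<^sub>R pdx \<phi> (x - t * y) y + k *\<^sub>R pdy \<phi> (x - t * y) y))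
     (at (fst (x, y) - t * snd (x, y), snd (x, y)))"
    using test_function_has_derivative[OF assms, of "x - t * y" y] by simp
  show ?thesis using diff_chain_at[OF 1 2] by (simp add: o_def shear_def case_prod_unfold)
qed

lemma pd_shear:
  assumes "test_function \<phi>"
  shows "pdx (shear t \<phi>) = shear t (pdx \<phi>)" "pdy (shear t \<phi>) = shear t (sheared_pdy t \<phi>)"
proof -
  show "pdx (shear t \<phi>) = shear t (pdx \<phi>)"
    by (rule pdx_eqI) (use has_partial_derivatives(1)[OF shear_has_derivative[OF assms]] in \<open>simp add: shear_def\<close>)
  show "pdy (shear t \<phi>) = shear t (sheared_pdy t \<phi>)"
    by (rule pdy_eqI) (use has_partial_derivatives(2)[OF shear_has_derivative[OF assms]] in
        \<open>simp add: shear_def sheared_pdy_def scaleR_conv_of_real\<close>)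
qed

lemma test_function_shear:
  assumes "test_function \<phi>" shows "test_function (shear t \<phi>)"
proof -
  define P where "P f \<longleftrightarrow> (\<exists>\<phi>. test_function \<phi> \<and> f = shear t \<phi>)" for f
  have "P (shear t \<phi>)" using assms unfolding P_def by blast
  then show ?thesis
  proof (rule test_function_coinduct_set[of P])
    fix f assume "P f"
    then obtain \<phi> where t: "test_function \<phi>" and f: "f = shear t \<phi>" unfolding P_def by blast
    show "f (x + 2 * pi) y = f x y" for x y
      using test_function_periodic[OF t, of "x - t * y" y] by (simp add: f shear_def algebra_simps)
    show "(\<lambda>(x, y). f x y) differentiable at z" for z
      using shear_has_derivative[OF t, of t "fst z" "snd z"] unfolding f differentiable_def by auto
    show "\<exists>C. \<forall>x y. \<bar>y\<bar> ^ m * cmod (f x y) \<le> C" for m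
      using test_function_decay[OF t, of m] unfolding f shear_def by blast
    show "P (pdx f)" "P (pdy f)"
      using t unfolding f pd_shear[OF t] P_def by (blast intro: test_function_pdx test_function_sheared_pdy)+
  qed
qed

lemma test_function_funpow:
  "test_function \<phi> \<Longrightarrow> test_function ((pdx ^^ i) \<phi>)" "test_function \<phi> \<Longrightarrow> test_function ((pdy ^^ i) \<phi>)"
  "test_function \<phi> \<Longrightarrow> test_function ((sheared_pdy t ^^ i) \<phi>)"
  by (induction i) (auto intro: test_function_pdx test_function_pdy test_function_sheared_pdy)

section \<open>Schwartz seminorms on the cylinder\<close>

definition weighted_sup :: "nat \<Rightarrow> (real \<Rightarrow> real \<Rightarrow> complex) \<Rightarrow> real" where
  "weighted_sup m \<phi> = (SUP (x, y). \<bar>y\<bar> ^ m * cmod (\<phi> x y))"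

lemma schwartz_seminorm_eq:
  "schwartz_seminorm N \<phi> = (\<Sum>m\<le>N. \<Sum>i\<le>N. \<Sum>j\<le>N. weighted_sup m ((pdx ^^ i) ((pdy ^^ j) \<phi>)))"
  by (simp add: schwartz_seminorm_def weighted_sup_def)

lemma weighted_sup_upper:
  assumes "test_function \<phi>" shows "\<bar>y\<bar> ^ m * cmod (\<phi> x y) \<le> weighted_sup m \<phi>"
proof -
  obtain C where "\<And>x y. \<bar>y\<bar> ^ m * cmod (\<phi> x y) \<le> C" using test_function_decay[OF assms] by metis
  then have "bdd_above (range (\<lambda>(x, y). \<bar>y\<bar> ^ m * cmod (\<phi> x y)))" by (intro bdd_aboveI[of _ C]) auto
  then show ?thesis unfolding weighted_sup_def using cSUP_upper[of "(x, y)" UNIV "\<lambda>(x, y). \<bar>y\<bar> ^ m * cmod (\<phi> x y)"] by simp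
qed

lemma weighted_sup_least: "(\<And>x y. \<bar>y\<bar> ^ m * cmod (\<phi> x y) \<le> K) \<Longrightarrow> weighted_sup m \<phi> \<le> K"
  unfolding weighted_sup_def by (rule cSUP_least) auto

lemma weighted_sup_nonneg: "test_function \<phi> \<Longrightarrow> 0 \<le> weighted_sup m \<phi>"
  using weighted_sup_upper[of \<phi> 0 m 0] by (meson mult_nonneg_nonneg norm_ge_zero order_trans zero_le_power abs_ge_zero)

lemma weighted_sup_le_seminorm:
  assumes "test_function \<phi>" "m \<le> N" "i \<le> N" "j \<le> N"
  shows "weighted_sup m ((pdx ^^ i) ((pdy ^^ j) \<phi>)) \<le> schwartz_seminorm N \<phi>"
proof -
  have nn: "0 \<le> weighted_sup m ((pdx ^^ i) ((pdy ^^ j) \<phi>))" for m i j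
    by (intro weighted_sup_nonneg test_function_funpow assms)
  have "weighted_sup m ((pdx ^^ i) ((pdy ^^ j) \<phi>)) \<le> (\<Sum>j\<le>N. weighted_sup m ((pdx ^^ i) ((pdy ^^ j) \<phi>)))"
    using assms nn by (intro member_le_sum[of j _ "\<lambda>j. weighted_sup m ((pdx ^^ i) ((pdy ^^ j) \<phi>))"]) auto
  also have "\<dots> \<le> (\<Sum>i\<le>N. \<Sum>j\<le>N. weighted_sup m ((pdx ^^ i) ((pdy ^^ j) \<phi>)))"
    using assms nn by (intro member_le_sum[of i _ "\<lambda>i. \<Sum>j\<le>N. weighted_sup m ((pdx ^^ i) ((pdy ^^ j) \<phi>))"]) (auto intro!: sum_nonneg)
  also have "\<dots> \<le> schwartz_seminorm N \<phi>" unfolding schwartz_seminorm_eq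
    using assms nn by (intro member_le_sum[of m _ "\<lambda>m. \<Sum>i\<le>N. \<Sum>j\<le>N. weighted_sup m ((pdx ^^ i) ((pdy ^^ j) \<phi>))"]) (auto intro!: sum_nonneg)
  finally show ?thesis .
qed

text \<open>Counting the (N + 1)^3 summands reduces a seminorm inequality to one for a single
  weighted supremum. The cubic factors in the estimates below originate here.\<close>

lemma schwartz_seminorm_le:
  assumes "\<And>m i j. m \<le> N \<Longrightarrow> i \<le> N \<Longrightarrow> j \<le> N \<Longrightarrow> weighted_sup m ((pdx ^^ i) ((pdy ^^ j) \<phi>)) \<le> K"
  shows "schwartz_seminorm N \<phi> \<le> real (Suc N) ^ 3 * K"
proof -
  have "schwartz_seminorm N \<phi> \<le> (\<Sum>m\<le>N. \<Sum>i\<le>N. \<Sum>j\<le>N. K)"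
    unfolding schwartz_seminorm_eq by (intro sum_mono assms) auto
  also have "\<dots> = real (Suc N) ^ 3 * K" by (simp add: power3_eq_cube)
  finally show ?thesis .
qed

text \<open>The seminorms list mixed derivatives with all x-derivatives outermost, so an inner
  \<open>pdx\<close> has to be moved out before it can be compared with them.\<close>

lemma funpow_pdy_pdx: "test_function \<phi> \<Longrightarrow> (pdy ^^ j) (pdx \<phi>) = pdx ((pdy ^^ j) \<phi>)"
  by (induction j) (auto simp: pdx_pdy_commute test_function_funpow)

lemma schwartz_seminorm_pdy:
  assumes "test_function \<phi>"
  shows "schwartz_seminorm N (pdy \<phi>) \<le> real (Suc N) ^ 3 * schwartz_seminorm (Suc N) \<phi>"
proof (rule schwartz_seminorm_le)
  fix m i j assume "m \<le> N" "i \<le> N" "j \<le> N"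
  then have "weighted_sup m ((pdx ^^ i) ((pdy ^^ Suc j) \<phi>)) \<le> schwartz_seminorm (Suc N) \<phi>"
    by (intro weighted_sup_le_seminorm assms) auto
  then show "weighted_sup m ((pdx ^^ i) ((pdy ^^ j) (pdy \<phi>))) \<le> schwartz_seminorm (Suc N) \<phi>"
    by (simp only: funpow_Suc_right o_apply)
qed

lemma schwartz_seminorm_pdx:
  assumes "test_function \<phi>"
  shows "schwartz_seminorm N (pdx \<phi>) \<le> real (Suc N) ^ 3 * schwartz_seminorm (Suc N) \<phi>"
proof (rule schwartz_seminorm_le)
  fix m i j assume "m \<le> N" "i \<le> N" "j \<le> N"
  then have "weighted_sup m ((pdx ^^ Suc i) ((pdy ^^ j) \<phi>)) \<le> schwartz_seminorm (Suc N) \<phi>"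
    by (intro weighted_sup_le_seminorm assms) auto
  then show "weighted_sup m ((pdx ^^ i) ((pdy ^^ j) (pdx \<phi>))) \<le> schwartz_seminorm (Suc N) \<phi>"
    by (simp only: funpow_Suc_right o_apply funpow_pdy_pdx[OF assms])
qed

lemma funpow_pdx_linear:
  assumes "test_function \<phi>" "test_function \<psi>"
  shows "(pdx ^^ i) (\<lambda>x y. a * \<phi> x y + b * \<psi> x y) = (\<lambda>x y. a * (pdx ^^ i) \<phi> x y + b * (pdx ^^ i) \<psi> x y)"
  using assms by (induction i) (auto simp: pd_linear test_function_funpow)

lemma sheared_pdy_linear:
  assumes "test_function \<phi>" "test_function \<psi>"
  shows "sheared_pdy t (\<lambda>x y. a * \<phi> x y + b * \<psi> x y) = (\<lambda>x y. a * sheared_pdy t \<phi> x y + b * sheared_pdy t \<psi> x y)"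
  unfolding sheared_pdy_def pd_linear[OF assms] by (simp add: algebra_simps)

lemma funpow_sheared_pdy_linear:
  assumes "test_function \<phi>" "test_function \<psi>"
  shows "(sheared_pdy t ^^ i) (\<lambda>x y. a * \<phi> x y + b * \<psi> x y) =
    (\<lambda>x y. a * (sheared_pdy t ^^ i) \<phi> x y + b * (sheared_pdy t ^^ i) \<psi> x y)"
  using assms by (induction i) (auto simp: sheared_pdy_linear test_function_funpow)

lemma weighted_sup_linear:
  assumes "test_function \<phi>" "test_function \<psi>"
  shows "weighted_sup m (\<lambda>x y. a * \<phi> x y + b * \<psi> x y) \<le> cmod a * weighted_sup m \<phi> + cmod b * weighted_sup m \<psi>"
proof (rule weighted_sup_least)
  fix x y
  have "cmod (a * \<phi> x y + b * \<psi> x y) \<le> cmod a * cmod (\<phi> x y) + cmod b * cmod (\<psi> x y)"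
    by (metis norm_triangle_ineq norm_mult)
  then have "\<bar>y\<bar> ^ m * cmod (a * \<phi> x y + b * \<psi> x y) \<le> \<bar>y\<bar> ^ m * (cmod a * cmod (\<phi> x y) + cmod b * cmod (\<psi> x y))"
    by (intro mult_left_mono) auto
  also have "\<dots> = cmod a * (\<bar>y\<bar> ^ m * cmod (\<phi> x y)) + cmod b * (\<bar>y\<bar> ^ m * cmod (\<psi> x y))"
    by (simp add: algebra_simps)
  also have "\<dots> \<le> cmod a * weighted_sup m \<phi> + cmod b * weighted_sup m \<psi>"
    by (intro add_mono mult_left_mono weighted_sup_upper assms) auto
  finally show "\<bar>y\<bar> ^ m * cmod (a * \<phi> x y + b * \<psi> x y) \<le> cmod a * weighted_sup m \<phi> + cmod b * weighted_sup m \<psi>" .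
qed

text \<open>Each factor d_y - t d_x is a combination of first derivatives and costs one seminorm
  order and a factor depending on t. The claim quantifies over the test function because the
  induction peels off the innermost factor.\<close>

lemma weighted_sup_sheared:
  "\<exists>M C. 0 \<le> C \<and> (\<forall>\<phi>. test_function \<phi> \<longrightarrow>
     weighted_sup m ((pdx ^^ i) ((sheared_pdy t ^^ j) \<phi>)) \<le> C * schwartz_seminorm M \<phi>)"
proof (induction j)
  case 0
  have "weighted_sup m ((pdx ^^ i) \<phi>) \<le> 1 * schwartz_seminorm (max m i) \<phi>" if "test_function \<phi>" for \<phi>
    using weighted_sup_le_seminorm[OF that, of m "max m i" i 0] by simp
  then show ?case by (intro exI[of _ "max m i"] exI[of _ 1]) simp
next
  case (Suc j)
  then obtain M C where C: "0 \<le> C" and le: "\<And>\<phi>. test_function \<phi> \<Longrightarrow>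
     weighted_sup m ((pdx ^^ i) ((sheared_pdy t ^^ j) \<phi>)) \<le> C * schwartz_seminorm M \<phi>" by blast
  define D where "D = C * real (Suc M) ^ 3"
  have "weighted_sup m ((pdx ^^ i) ((sheared_pdy t ^^ Suc j) \<phi>)) \<le> (D + \<bar>t\<bar> * D) * schwartz_seminorm (Suc M) \<phi>"
    if \<phi>: "test_function \<phi>" for \<phi>
  proof -
    note t = test_function_pdy[OF \<phi>] test_function_pdx[OF \<phi>]
    note f = test_function_funpow(3)[OF t(1), where t=t and i=j] test_function_funpow(3)[OF t(2), where t=t and i=j]
    have *: "C * schwartz_seminorm M (pdy \<phi>) \<le> D * schwartz_seminorm (Suc M) \<phi>"
      "C * schwartz_seminorm M (pdx \<phi>) \<le> D * schwartz_seminorm (Suc M) \<phi>"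
      using mult_left_mono[OF schwartz_seminorm_pdy[OF \<phi>, of M] C] mult_left_mono[OF schwartz_seminorm_pdx[OF \<phi>, of M] C]
      by (simp_all add: D_def mult.assoc del: of_nat_Suc)
    have eq: "(pdx ^^ i) ((sheared_pdy t ^^ Suc j) \<phi>) = (\<lambda>x y. 1 * (pdx ^^ i) ((sheared_pdy t ^^ j) (pdy \<phi>)) x y
       + (- of_real t) * (pdx ^^ i) ((sheared_pdy t ^^ j) (pdx \<phi>)) x y)"
      unfolding funpow_Suc_right o_apply sheared_pdy_def[of t \<phi>]
      unfolding funpow_sheared_pdy_linear[OF t] funpow_pdx_linear[OF f] ..
    have "weighted_sup m ((pdx ^^ i) ((sheared_pdy t ^^ Suc j) \<phi>)) \<le>
       cmod 1 * weighted_sup m ((pdx ^^ i) ((sheared_pdy t ^^ j) (pdy \<phi>)))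
       + cmod (- of_real t) * weighted_sup m ((pdx ^^ i) ((sheared_pdy t ^^ j) (pdx \<phi>)))"
      unfolding eq by (rule weighted_sup_linear[OF test_function_funpow(1)[OF f(1)] test_function_funpow(1)[OF f(2)]])
    also have "\<dots> \<le> cmod 1 * (D * schwartz_seminorm (Suc M) \<phi>) + cmod (- of_real t) * (D * schwartz_seminorm (Suc M) \<phi>)"
      by (intro add_mono mult_left_mono order_trans[OF le[OF t(1)] *(1)] order_trans[OF le[OF t(2)] *(2)]) auto
    finally show ?thesis by (simp add: distrib_right mult.assoc)
  qed
  moreover have "0 \<le> D + \<bar>t\<bar> * D" using C by (auto simp: D_def)
  ultimately show ?case by blast
qed

lemma funpow_pd_shear:
  assumes "test_function \<phi>"
  shows "(pdx ^^ i) ((pdy ^^ j) (shear t \<phi>)) = shear t ((pdx ^^ i) ((sheared_pdy t ^^ j) \<phi>))"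
proof -
  have "(pdy ^^ j) (shear t \<phi>) = shear t ((sheared_pdy t ^^ j) \<phi>)"
    by (induction j) (auto simp: pd_shear test_function_funpow assms)
  moreover have "(pdx ^^ i) (shear t \<psi>) = shear t ((pdx ^^ i) \<psi>)" if "test_function \<psi>" for \<psi>
    by (induction i) (auto simp: pd_shear test_function_funpow that)
  ultimately show ?thesis using test_function_funpow(3)[OF assms] by simp
qed

lemma weighted_sup_shear: "weighted_sup m (shear t \<phi>) = weighted_sup m \<phi>"
proof -
  have "range (\<lambda>(x, y). \<bar>y\<bar> ^ m * cmod (shear t \<phi> x y)) = range (\<lambda>(x, y). \<bar>y\<bar> ^ m * cmod (\<phi> x y))"
  proof (intro equalityI subsetI)
    fix v assume "v \<in> range (\<lambda>(x, y). \<bar>y\<bar> ^ m * cmod (shear t \<phi> x y))"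
    then show "v \<in> range (\<lambda>(x, y). \<bar>y\<bar> ^ m * cmod (\<phi> x y))" by (auto simp: shear_def)
  next
    fix v assume "v \<in> range (\<lambda>(x, y). \<bar>y\<bar> ^ m * cmod (\<phi> x y))"
    then obtain x y where "v = \<bar>y\<bar> ^ m * cmod (shear t \<phi> (x + t * y) y)" by (auto simp: shear_def)
    then show "v \<in> range (\<lambda>(x, y). \<bar>y\<bar> ^ m * cmod (shear t \<phi> x y))" by (intro image_eqI[of _ _ "(x + t * y, y)"]) auto
  qed
  then show ?thesis by (simp add: weighted_sup_def)
qed

lemma schwartz_seminorm_mono:
  assumes "test_function \<phi>" "M \<le> N" shows "schwartz_seminorm M \<phi> \<le> real (Suc M) ^ 3 * schwartz_seminorm N \<phi>"
  using assms by (intro schwartz_seminorm_le weighted_sup_le_seminorm) auto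

lemma schwartz_seminorm_nonneg: "test_function \<phi> \<Longrightarrow> 0 \<le> schwartz_seminorm N \<phi>"
  using weighted_sup_le_seminorm[of \<phi> 0 N 0 0] weighted_sup_nonneg[of \<phi> 0] by simp

lemma schwartz_seminorm_shear:
  "\<exists>M C. \<forall>\<phi>. test_function \<phi> \<longrightarrow> schwartz_seminorm N (shear t \<phi>) \<le> C * schwartz_seminorm M \<phi>"
proof -
  have "\<forall>m i j. \<exists>M C. 0 \<le> C \<and> (\<forall>\<phi>. test_function \<phi> \<longrightarrow>
     weighted_sup m ((pdx ^^ i) ((sheared_pdy t ^^ j) \<phi>)) \<le> C * schwartz_seminorm M \<phi>)"
    using weighted_sup_sheared by blast
  then obtain M C where C: "\<And>m i j. 0 \<le> C m i j" and le: "\<And>m i j \<phi>. test_function \<phi> \<Longrightarrow>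
     weighted_sup m ((pdx ^^ i) ((sheared_pdy t ^^ j) \<phi>)) \<le> C m i j * schwartz_seminorm (M m i j) \<phi>" by metis
  define I where "I = {..N} \<times> {..N} \<times> {..N}"
  \<comment> \<open>Sums over the finite index set serve as common upper bounds of all orders and
    constants.\<close>
  define M' where "M' = (\<Sum>(m, i, j)\<in>I. M m i j)"
  define C' where "C' = (\<Sum>(m, i, j)\<in>I. C m i j * real (Suc (M m i j)) ^ 3)"
  have I: "finite I" by (simp add: I_def)
  have "schwartz_seminorm N (shear t \<phi>) \<le> real (Suc N) ^ 3 * (C' * schwartz_seminorm M' \<phi>)" if \<phi>: "test_function \<phi>" for \<phi>
  proof (rule schwartz_seminorm_le)
    fix m i j assume "m \<le> N" "i \<le> N" "j \<le> N"
    then have mem: "(m, i, j) \<in> I" by (simp add: I_def)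
    have M: "M m i j \<le> M'" unfolding M'_def using member_le_sum[OF mem, of "\<lambda>(m, i, j). M m i j"] I by auto
    have C': "C m i j * real (Suc (M m i j)) ^ 3 \<le> C'"
      unfolding C'_def using member_le_sum[OF mem, of "\<lambda>(m, i, j). C m i j * real (Suc (M m i j)) ^ 3"] I C
      by (auto simp del: of_nat_Suc)
    have "weighted_sup m ((pdx ^^ i) ((pdy ^^ j) (shear t \<phi>))) \<le> C m i j * schwartz_seminorm (M m i j) \<phi>"
      unfolding funpow_pd_shear[OF \<phi>] weighted_sup_shear by (rule le[OF \<phi>])
    also have "\<dots> \<le> C m i j * (real (Suc (M m i j)) ^ 3 * schwartz_seminorm M' \<phi>)"
      by (intro mult_left_mono schwartz_seminorm_mono \<phi> M C)
    also have "\<dots> = (C m i j * real (Suc (M m i j)) ^ 3) * schwartz_seminorm M' \<phi>" by (simp only: mult.assoc)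
    also have "\<dots> \<le> C' * schwartz_seminorm M' \<phi>"
      by (rule mult_right_mono[OF C' schwartz_seminorm_nonneg[OF \<phi>]])
    finally show "weighted_sup m ((pdx ^^ i) ((pdy ^^ j) (shear t \<phi>))) \<le> C' * schwartz_seminorm M' \<phi>" .
  qed
  then show ?thesis by (intro exI[of _ M'] exI[of _ "real (Suc N) ^ 3 * C'"]) (simp add: mult.assoc)
qed

section \<open>Fourier modes\<close>

text \<open>This number is pi. It converts quadratic decay of a function into a bound of its
  integral.\<close>

definition cauchy_mass :: real where
  "cauchy_mass = (LINT x|lborel. 1 / (1 + x\<^sup>2))"

lemma integrable_inverse_quadratic: "integrable lborel (\<lambda>x::real. 1 / (1 + x\<^sup>2))"
proof -
  have "einterval (- \<infinity>) \<infinity> = (UNIV :: real set)" by (auto simp: einterval_def)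
  then show ?thesis using integrable_inverse_1_plus_square
    by (simp add: set_integrable_def divide_inverse)
qed

lemma smooth_measurable: "smooth f \<Longrightarrow> f \<in> borel_measurable borel"
  by (intro borel_measurable_continuous_onI continuous_at_imp_continuous_on ballI
      differentiable_imp_continuous_within smooth_differentiable)

lemma cis_measurable [measurable]: "(\<lambda>x. cis (c * x)) \<in> borel_measurable borel"
  unfolding cis_conv_exp by measurable

lemma quadratic_decay_integrable:
  fixes f :: "real \<Rightarrow> complex"
  assumes "f \<in> borel_measurable borel" "\<And>x. (1 + x\<^sup>2) * cmod (f x) \<le> K"
  shows "integrable lborel f" "cmod (LINT x|lborel. f x) \<le> cauchy_mass * K"
proof -
  have le: "cmod (f x) \<le> K * (1 / (1 + x\<^sup>2))" for x
    using assms(2)[of x] by (simp add: pos_le_divide_eq add_pos_nonneg mult.commute)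
  have int: "integrable lborel (\<lambda>x. K * (1 / (1 + x\<^sup>2)))"
    by (intro integrable_mult_right integrable_inverse_quadratic)
  show f: "integrable lborel f"
  proof (rule Bochner_Integration.integrable_bound[OF int])
    show "AE x in lborel. norm (f x) \<le> norm (K * (1 / (1 + x\<^sup>2)))"
      by (intro AE_I2) (metis le abs_ge_self order_trans real_norm_def)
  qed (use assms in simp)
  have "cmod (LINT x|lborel. f x) \<le> (LINT x|lborel. K * (1 / (1 + x\<^sup>2)))"
    by (intro Bochner_Integration.integral_norm_bound_integral f int le)
  also have "\<dots> = cauchy_mass * K"
    unfolding cauchy_mass_def by (simp only: integral_mult_right_zero mult.commute)
  finally show "cmod (LINT x|lborel. f x) \<le> cauchy_mass * K" .
qed

lemma fourier_line_bound:
  assumes "smooth f" "line_bound 1 f K"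
  shows "integrable lborel (\<lambda>x. f x * cis (- x * y))" "cmod (fourier_line f y) \<le> cauchy_mass * K"
proof -
  note [measurable] = smooth_measurable[OF assms(1)]
  have "(\<lambda>x. f x * cis (- y * x)) \<in> borel_measurable borel" by measurable
  moreover have "(1 + x\<^sup>2) * cmod (f x * cis (- y * x)) \<le> K" for x
    using assms(2) unfolding line_bound_def by (auto simp: norm_mult dest: spec[of _ 0])
  ultimately have "integrable lborel (\<lambda>x. f x * cis (- y * x))" "cmod (LINT x|lborel. f x * cis (- y * x)) \<le> cauchy_mass * K"
    by (rule quadratic_decay_integrable)+
  then show "integrable lborel (\<lambda>x. f x * cis (- x * y))" "cmod (fourier_line f y) \<le> cauchy_mass * K"
    by (simp_all add: fourier_line_def mult.commute)
qed

lemma fourier_line_integrable: "schwartz_line f \<Longrightarrow> integrable lborel (\<lambda>x. f x * cis (- x * y))"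
  using fourier_line_bound(1) schwartz_line_bound schwartz_line_smooth by blast

lemma fourier_line_add: "schwartz_line f \<Longrightarrow> schwartz_line g \<Longrightarrow>
    fourier_line (\<lambda>x. f x + g x) y = fourier_line f y + fourier_line g y"
  unfolding fourier_line_def distrib_right
  by (intro Bochner_Integration.integral_add fourier_line_integrable)

lemma fourier_line_cmult: "fourier_line (\<lambda>x. c * f x) y = c * fourier_line f y"
  unfolding fourier_line_def mult.assoc by (rule integral_mult_right_zero)

lemma fourier_line_diff: "schwartz_line f \<Longrightarrow> schwartz_line g \<Longrightarrow>
    fourier_line (\<lambda>x. f x - g x) y = fourier_line f y - fourier_line g y"
  unfolding fourier_line_def left_diff_distrib
  by (intro Bochner_Integration.integral_diff fourier_line_integrable)

lemma fourier_line_translate: "fourier_line (translate h f) y = cis (h * y) * fourier_line f y"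
proof -
  have "fourier_line f y = (LINT x|lborel. f (h + x) * cis (- (h + x) * y))"
    unfolding fourier_line_def
    using lborel_integral_real_affine[of 1 "\<lambda>x. f x * cis (- x * y)" h] by simp
  also have "\<dots> = (LINT x|lborel. cis (- h * y) * (f (x + h) * cis (- x * y)))"
  proof (rule Bochner_Integration.integral_cong[OF refl])
    fix x
    have "cis (- (h + x) * y) = cis (- h * y) * cis (- x * y)"
      by (simp only: cis_mult) (simp add: algebra_simps)
    then show "f (h + x) * cis (- (h + x) * y) = cis (- h * y) * (f (x + h) * cis (- x * y))"
      by (simp only: mult.left_commute add.commute)
  qed
  also have "\<dots> = cis (- h * y) * fourier_line (translate h f) y"
    by (simp only: integral_mult_right_zero fourier_line_def translate_def)
  finally have "cis (h * y) * fourier_line f y = (cis (h * y) * cis (- h * y)) * fourier_line (translate h f) y"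
    by (simp only: mult.assoc)
  then show ?thesis by (simp add: cis_mult)
qed

lemma has_vector_derivative_cis: "((\<lambda>x. cis (c * x)) has_vector_derivative (\<i> * of_real c * cis (c * x))) (at x)"
proof -
  have "((\<lambda>x. exp (x *\<^sub>R (\<i> * of_real c))) has_vector_derivative exp (x *\<^sub>R (\<i> * of_real c)) * (\<i> * of_real c)) (at x)"
    by (rule exp_scaleR_has_vector_derivative_right)
  then show ?thesis
    by (simp add: cis_conv_exp scaleR_conv_of_real mult_ac)
qed

text \<open>No integration by parts: cis(hy) times the transform of \<open>f\<close> is the
  transform of the translate of \<open>f\<close>, and its derivative at h = 0 is computed once from
  the Taylor remainder of the translate and once from the exponential.\<close>

lemma fourier_line_vd:
  assumes "schwartz_line f" shows "fourier_line (vd f) y = \<i> * of_real y * fourier_line f y"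
proof -
  obtain K where K: "line_bound (1 + 2) f K" using schwartz_line_bound[OF assms] by blast
  note s = schwartz_line_smooth[OF assms]
  have "((\<lambda>h. cis (y * h) * fourier_line f y) has_vector_derivative fourier_line (vd f) y) (at 0)"
  proof (rule quadratic_remainder_imp_has_vector_derivative[of 1])
    fix h :: real assume h: "\<bar>h\<bar> \<le> 1"
    have b: "line_bound 1 (\<lambda>x. translate h f x - f x - of_real h * vd f x) ((2 * (1 + 1\<^sup>2)) ^ (1 + 2) * K * h\<^sup>2)"
      by (rule line_bound_translate_remainder[OF s K h])
    have sm: "smooth (\<lambda>x. translate h f x - f x - of_real h * vd f x)"
      by (intro smooth_diff smooth_cmult smooth_translate smooth_vd s)
    have eq: "fourier_line (\<lambda>x. translate h f x - f x - of_real h * vd f x) y =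
        cis (y * (0 + h)) * fourier_line f y - cis (y * 0) * fourier_line f y - h *\<^sub>R fourier_line (vd f) y"
      using assms
      by (simp add: fourier_line_diff fourier_line_cmult fourier_line_translate schwartz_line_translate
          schwartz_line_diff schwartz_line_cmult schwartz_line_vd scaleR_conv_of_real mult.commute)
    show "norm (cis (y * (0 + h)) * fourier_line f y - cis (y * 0) * fourier_line f y - h *\<^sub>R fourier_line (vd f) y)
        \<le> (cauchy_mass * ((2 * (1 + 1\<^sup>2)) ^ (1 + 2) * K)) * h\<^sup>2"
      unfolding eq[symmetric] using fourier_line_bound(2)[OF sm b, of y] by (simp only: mult.assoc)
  qed simp
  moreover have "((\<lambda>h. cis (y * h) * fourier_line f y) has_vector_derivative (\<i> * of_real y * cis (y * 0)) * fourier_line f y) (at 0)"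
    by (intro has_vector_derivative_mult_left has_vector_derivative_cis)
  ultimately show ?thesis by (simp add: vector_derivative_unique_at)
qed

lemma tame_const: "tame (\<lambda>x. c)"
proof -
  have "(vd ^^ i) (\<lambda>x. c) = (\<lambda>x. if i = 0 then c else 0)" for i by (induction i) (auto simp: vd_const)
  then have "cmod ((vd ^^ i) (\<lambda>x. c) x) \<le> cmod c * (1 + x\<^sup>2) ^ 0" for i and x :: real by simp
  then show ?thesis unfolding tame_def using smooth_const by blast
qed

lemma vd_of_real: "vd of_real = (\<lambda>x. 1)"
  by (rule vd_eqI) (auto intro!: derivative_eq_intros)

lemma smooth_of_real: "smooth of_real"
proof (rule smoothI)
  show "(of_real :: real \<Rightarrow> complex) differentiable at x" for x
    by (rule differentiableI_vector[of _ 1]) (auto intro!: derivative_eq_intros)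
qed (simp add: vd_of_real smooth_const)

lemma tame_of_real: "tame of_real"
proof -
  have *: "(vd ^^ i) of_real = (\<lambda>x. if i = 0 then of_real x else if i = 1 then 1 else 0)" for i
    by (induction i) (auto simp: vd_of_real[unfolded of_real_def] vd_of_real vd_const)
  have "\<bar>x\<bar> \<le> 1 + x\<^sup>2" for x :: real
    using zero_le_power2[of "\<bar>x\<bar> - 1/2"] unfolding power2_diff by (simp add: power_divide)
  then have "cmod ((vd ^^ i) of_real x) \<le> 1 * (1 + x\<^sup>2) ^ 1" for i x by (simp add: *)
  then show ?thesis unfolding tame_def using smooth_of_real by blast
qed

lemma tame_mult:
  assumes "tame f" "tame g" shows "tame (\<lambda>x. f x * g x)"
proof -
  obtain m n where m: "\<And>N. \<exists>K. \<forall>i\<le>N. \<forall>x. cmod ((vd ^^ i) f x) \<le> K * (1 + x\<^sup>2) ^ m"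
    and n: "\<And>N. \<exists>K. \<forall>i\<le>N. \<forall>x. cmod ((vd ^^ i) g x) \<le> K * (1 + x\<^sup>2) ^ n"
    using assms unfolding tame_def by blast
  have s: "smooth f" "smooth g" using assms by (auto simp: tame_def)
  have "\<exists>K. \<forall>i\<le>N. \<forall>x. cmod ((vd ^^ i) (\<lambda>x. f x * g x) x) \<le> K * (1 + x\<^sup>2) ^ (m + n)" for N
  proof -
    obtain K L where K: "\<And>i x. i \<le> N \<Longrightarrow> cmod ((vd ^^ i) f x) \<le> K * (1 + x\<^sup>2) ^ m"
      and L: "\<And>i x. i \<le> N \<Longrightarrow> cmod ((vd ^^ i) g x) \<le> L * (1 + x\<^sup>2) ^ n" using m n by metis
    have "cmod ((vd ^^ i) (\<lambda>x. f x * g x) x) \<le> (2 ^ N * (K * L)) * (1 + x\<^sup>2) ^ (m + n)" if i: "i \<le> N" for i x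
    proof -
      have "cmod ((vd ^^ i) (\<lambda>x. f x * g x) x) \<le> 2 ^ i * ((K * (1 + x\<^sup>2) ^ m) * (L * (1 + x\<^sup>2) ^ n))"
        using i by (intro funpow_vd_mult_bound s K L) auto
      also have "\<dots> \<le> 2 ^ N * ((K * (1 + x\<^sup>2) ^ m) * (L * (1 + x\<^sup>2) ^ n))"
        using order_trans[OF norm_ge_zero K[of 0 x]] order_trans[OF norm_ge_zero L[of 0 x]]
        by (intro mult_right_mono power_increasing i) (simp_all add: mult_nonneg_nonneg)
      also have "\<dots> = (2 ^ N * (K * L)) * (1 + x\<^sup>2) ^ (m + n)" by (simp add: power_add mult_ac)
      finally show ?thesis .
    qed
    then show ?thesis by blast
  qed
  then show ?thesis unfolding tame_def using smooth_mult[OF s] by blast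
qed

lemma tame_power: "tame f \<Longrightarrow> tame (\<lambda>x. f x ^ n)"
  by (induction n) (auto intro: tame_const tame_mult)

lemma schwartz_line_of_real_mult: "schwartz_line f \<Longrightarrow> schwartz_line (\<lambda>x. of_real x * f x)"
  by (rule schwartz_line_tame_mult[OF tame_of_real])

lemma cis_quadratic_remainder: "cmod (cis \<theta> - 1 - \<i> * of_real \<theta>) \<le> \<theta>\<^sup>2"
proof -
  have "cmod (iexp \<theta> - (\<Sum>k \<le> 1. (\<i> * \<theta>)^k / fact k)) \<le> \<bar>\<theta>\<bar>^(Suc 1) / fact (Suc 1)"
    by (rule iexp_approx1)
  then have "cmod (cis \<theta> - 1 - \<i> * of_real \<theta>) \<le> \<theta>\<^sup>2 / 2"
    by (simp add: cis_conv_exp diff_diff_eq numeral_2_eq_2)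
  then show ?thesis using zero_le_power2[of \<theta>] by argo
qed

lemma fourier_line_has_derivative:
  assumes "schwartz_line f"
  shows "(fourier_line f has_vector_derivative fourier_line (\<lambda>x. (- \<i>) * (of_real x * f x)) y) (at y)"
proof -
  define g where "g = (\<lambda>x. (- \<i>) * (of_real x * f x))"
  have g: "schwartz_line g" unfolding g_def by (intro schwartz_line_cmult schwartz_line_of_real_mult assms)
  \<comment> \<open>Weight of order 2: one power of 1 + x^2 absorbs the x^2 from the remainder of
    the exponential, the other makes it integrable.\<close>
  obtain K where K: "line_bound 2 f K" using schwartz_line_bound[OF assms] by blast
  show ?thesis unfolding g_def[symmetric]
  proof (rule quadratic_remainder_imp_has_vector_derivative[of 1])
    fix h :: real
    define r where "r x = f x * cis (- x * y) * (cis (- x * h) - 1 - \<i> * of_real (- x * h))" for x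
    define F1 F2 F3 where F: "F1 x = f x * cis (- x * (y + h))" "F2 x = f x * cis (- x * y)"
      "F3 x = g x * cis (- x * y)" for x
    have I: "integrable lborel F1" "integrable lborel F2" "integrable lborel F3"
      unfolding F by (intro fourier_line_integrable assms g)+
    have "fourier_line f (y + h) - fourier_line f y - h *\<^sub>R fourier_line g y =
       (LINT x|lborel. F1 x) - (LINT x|lborel. F2 x) - h *\<^sub>R (LINT x|lborel. F3 x)"
      by (simp only: fourier_line_def F)
    also have "\<dots> = (LINT x|lborel. F1 x - F2 x - h *\<^sub>R F3 x)" by (simp add: I)
    also have "\<dots> = (LINT x|lborel. r x)"
    proof (rule Bochner_Integration.integral_cong[OF refl])
      fix x
      have "cis (- x * (y + h)) = cis (- x * y) * cis (- x * h)"
        by (simp only: cis_mult) (simp add: algebra_simps)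
      then show "F1 x - F2 x - h *\<^sub>R F3 x = r x"
        unfolding F r_def g_def scaleR_conv_of_real by (simp add: algebra_simps)
    qed
    finally have eq: "fourier_line f (y + h) - fourier_line f y - h *\<^sub>R fourier_line g y = (LINT x|lborel. r x)" .
    have "(1 + x\<^sup>2) * cmod (r x) \<le> K * h\<^sup>2" for x
    proof -
      have "cmod (r x) \<le> cmod (f x) * (- x * h)\<^sup>2"
        unfolding r_def using cis_quadratic_remainder[of "- x * h"] by (simp add: norm_mult mult_left_mono)
      then have "(1 + x\<^sup>2) * cmod (r x) \<le> (1 + x\<^sup>2) * (cmod (f x) * (- x * h)\<^sup>2)"
        by (intro mult_left_mono) auto
      also have "\<dots> = (1 + x\<^sup>2) * x\<^sup>2 * cmod (f x) * h\<^sup>2" by (simp add: power_mult_distrib)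
      also have "\<dots> \<le> (1 + x\<^sup>2) * (1 + x\<^sup>2) * cmod (f x) * h\<^sup>2"
        by (intro mult_right_mono mult_left_mono) auto
      also have "\<dots> = (1 + x\<^sup>2) ^ 2 * cmod (f x) * h\<^sup>2" by (simp add: power2_eq_square)
      also have "\<dots> \<le> K * h\<^sup>2"
        using K unfolding line_bound_def by (intro mult_right_mono) (auto dest: spec[of _ 0])
      finally show ?thesis .
    qed
    moreover have "r \<in> borel_measurable borel"
    proof -
      note [measurable] = smooth_measurable[OF schwartz_line_smooth[OF assms]]
      have eq: "r = (\<lambda>x. f x * cis (- y * x) * (cis (- h * x) - 1 - \<i> * of_real (- x * h)))"
        by (simp add: fun_eq_iff r_def mult.commute)
      show ?thesis unfolding eq by measurable
    qed
    ultimately show "norm (fourier_line f (y + h) - fourier_line f y - h *\<^sub>R fourier_line g y) \<le> (cauchy_mass * K) * h\<^sup>2"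
      unfolding eq using quadratic_decay_integrable(2)[of r "K * h\<^sup>2"] by (simp add: mult.assoc)
  qed simp
qed

section \<open>Fourier modes as test functions\<close>

text \<open>These are the functions against which \<open>is_fourier_transform\<close> tests. On them
  d_x, d_y and multiplication by y act on the profile as -ik, as multiplication by -i\<xi> and as -i
  d/d\<xi>, so that each equation becomes one for functionals on the frequency line.\<close>

definition mode :: "int \<Rightarrow> (real \<Rightarrow> complex) \<Rightarrow> real \<Rightarrow> real \<Rightarrow> complex" where
  "mode k \<eta> = (\<lambda>x y. cis (- of_int k * x) * fourier_line \<eta> y)"

lemma mode_cmult: "mode k (\<lambda>x. c * f x) = (\<lambda>x y. c * mode k f x y)"
  by (simp add: mode_def fourier_line_cmult fun_eq_iff)

lemma mode_add: "schwartz_line f \<Longrightarrow> schwartz_line g \<Longrightarrow> mode k (\<lambda>x. f x + g x) = (\<lambda>x y. mode k f x y + mode k g x y)"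
  by (simp add: mode_def fourier_line_add fun_eq_iff distrib_left)

lemma mode_vd: "schwartz_line f \<Longrightarrow> mode k (vd f) = (\<lambda>x y. \<i> * (of_real y * mode k f x y))"
  by (simp add: mode_def fourier_line_vd fun_eq_iff mult_ac)

lemma pdx_mode: "pdx (mode k f) = mode k (\<lambda>x. (- \<i> * of_int k) * f x)"
proof (rule pdx_eqI)
  fix x y
  have "((\<lambda>x'. mode k f x' y) has_vector_derivative (\<i> * of_real (- of_int k) * cis (- of_int k * x)) * fourier_line f y) (at x)"
    unfolding mode_def by (intro has_vector_derivative_mult_left has_vector_derivative_cis)
  then show "((\<lambda>x'. mode k f x' y) has_vector_derivative mode k (\<lambda>x. (- \<i> * of_int k) * f x) x y) (at x)"
    unfolding mode_cmult by (rule has_vector_derivative_eq_rhs) (simp add: mode_def mult_ac)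
qed

lemma pdy_mode: "schwartz_line f \<Longrightarrow> pdy (mode k f) = mode k (\<lambda>x. (- \<i>) * (of_real x * f x))"
  unfolding mode_def by (intro pdy_eqI has_vector_derivative_mult_right fourier_line_has_derivative)

lemma cmod_mode: "cmod (mode k f x y) = cmod (fourier_line f y)"
  by (simp add: mode_def norm_mult)

text \<open>m derivatives of \<open>f\<close> pay for the power of y; the one remaining order gives
  integrability.\<close>

lemma fourier_line_decay:
  assumes "schwartz_line f" "line_bound (Suc m) f K"
  shows "\<bar>y\<bar> ^ m * cmod (fourier_line f y) \<le> cauchy_mass * K"
proof -
  have "cmod (fourier_line ((vd ^^ m) f) y) = \<bar>y\<bar> ^ m * cmod (fourier_line f y)"
    by (induction m) (simp_all add: fourier_line_vd schwartz_line_funpow assms norm_mult)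
  moreover have "line_bound 1 ((vd ^^ m) f) K"
    using assms(2)
  proof (induction m arbitrary: f)
    case (Suc m)
    then show ?case using line_bound_vd[OF Suc.prems] by (simp only: funpow_Suc_right o_apply)
  qed simp
  ultimately show ?thesis
    using fourier_line_bound(2)[of "(vd ^^ m) f" K y] schwartz_line_smooth[OF assms(1)] smooth_funpow_vd by metis
qed

lemma test_function_mode:
  assumes "schwartz_line f" shows "test_function (mode k f)"
proof (rule test_function_coinduct_set[of "\<lambda>\<phi>. \<exists>f. schwartz_line f \<and> \<phi> = mode k f"])
  fix \<phi> assume "\<exists>f. schwartz_line f \<and> \<phi> = mode k f"
  then obtain f where f: "schwartz_line f" and \<phi>: "\<phi> = mode k f" by blast
  have "cis (- (of_int k * (2 * pi))) = 1" using cis_multiple_2pi[of "- of_int k"] by (simp add: mult_ac)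
  then have "cis (- of_int k * (x + 2 * pi)) = cis (- of_int k * x)" for x
    using cis_mult[of "- of_int k * x" "- (of_int k * (2 * pi))"] by (simp add: algebra_simps)
  then show "\<phi> (x + 2 * pi) y = \<phi> x y" for x y by (simp only: \<phi> mode_def)
  show "(\<lambda>(x, y). \<phi> x y) differentiable at z" for z
  proof -
    have "(\<lambda>x. cis (- of_int k * x)) differentiable at (fst z)" "fourier_line f differentiable at (snd z)"
      using has_vector_derivative_cis fourier_line_has_derivative[OF f] by (blast intro: differentiableI_vector)+
    then have "(\<lambda>z. cis (- of_int k * fst z) * fourier_line f (snd z)) differentiable at z"
      using differentiable_chain_at[of fst z "\<lambda>x. cis (- of_int k * x)"] differentiable_chain_at[of snd z "fourier_line f"]
      by (intro differentiable_mult) (auto simp: o_def bounded_linear_imp_differentiable bounded_linear_fst bounded_linear_snd)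
    then show ?thesis by (simp add: \<phi> mode_def case_prod_unfold)
  qed
  show "\<exists>C. \<forall>x y. \<bar>y\<bar> ^ m * cmod (\<phi> x y) \<le> C" for m
  proof -
    obtain K where "line_bound (Suc m) f K" using schwartz_line_bound[OF f] by blast
    then show ?thesis using fourier_line_decay[OF f] by (auto simp: \<phi> cmod_mode)
  qed
  show "\<exists>f. schwartz_line f \<and> pdx \<phi> = mode k f" "\<exists>f. schwartz_line f \<and> pdy \<phi> = mode k f"
    using f unfolding \<phi> pdx_mode pdy_mode[OF f]
    by (blast intro: schwartz_line_cmult schwartz_line_of_real_mult)+
qed (use assms in blast)

lemma funpow_pd_mode:
  assumes "schwartz_line f"
  shows "(pdx ^^ i) ((pdy ^^ j) (mode k f)) = mode k (\<lambda>x. ((- \<i> * of_int k) ^ i * ((- \<i>) ^ j * of_real x ^ j)) * f x)"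
proof -
  have t: "tame (\<lambda>x. (- \<i>) ^ j * of_real x ^ j)" for j
    by (intro tame_mult tame_const tame_power tame_of_real)
  have 1: "(pdy ^^ j) (mode k f) = mode k (\<lambda>x. ((- \<i>) ^ j * of_real x ^ j) * f x)"
  proof (induction j)
    case (Suc j)
    have "pdy (mode k (\<lambda>x. ((- \<i>) ^ j * of_real x ^ j) * f x)) =
        mode k (\<lambda>x. (- \<i>) * (of_real x * (((- \<i>) ^ j * of_real x ^ j) * f x)))"
      by (rule pdy_mode[OF schwartz_line_tame_mult[OF t assms]])
    then show ?case
      by (simp only: funpow.simps o_apply Suc.IH) (simp add: mult_ac)
  qed simp
  have "(pdx ^^ i) (mode k g) = mode k (\<lambda>x. (- \<i> * of_int k) ^ i * g x)" for g
    by (induction i) (simp_all add: pdx_mode mult_ac)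
  then show ?thesis by (simp add: 1 mult.assoc)
qed

text \<open>Continuity of the map from profiles to modes. Through it a tempered distribution
  restricts to a functional of finite order on the Schwartz space of the line.\<close>

lemma schwartz_seminorm_mode:
  "\<exists>M C. 0 \<le> C \<and> (\<forall>f K. schwartz_line f \<longrightarrow> line_bound M f K \<longrightarrow> schwartz_seminorm N (mode k f) \<le> C * K)"
proof -
  have t: "tame (\<lambda>x. (- \<i> * of_int k) ^ i * ((- \<i>) ^ j * of_real x ^ j))" for i j
    by (intro tame_mult tame_const tame_power tame_of_real)
  have "\<forall>i j. \<exists>m C. \<forall>g L. smooth g \<longrightarrow> line_bound (Suc N + m) g L \<longrightarrow>
     line_bound (Suc N) (\<lambda>x. ((- \<i> * of_int k) ^ i * ((- \<i>) ^ j * of_real x ^ j)) * g x) (C * L)"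
    using tame_mult_bound[OF t] by blast
  then obtain m C where mC: "\<And>i j g L. smooth g \<Longrightarrow> line_bound (Suc N + m i j) g L \<Longrightarrow>
     line_bound (Suc N) (\<lambda>x. ((- \<i> * of_int k) ^ i * ((- \<i>) ^ j * of_real x ^ j)) * g x) (C i j * L)" by metis
  \<comment> \<open>\<open>Suc N\<close> instead of N because \<open>fourier_line_decay\<close>
    spends one order; the sum dominates every loss \<open>m i j\<close>.\<close>
  define M where "M = Suc N + (\<Sum>p\<in>{..N} \<times> {..N}. m (fst p) (snd p))"
  define D where "D = (\<Sum>p\<in>{..N} \<times> {..N}. \<bar>C (fst p) (snd p)\<bar>)"
  have D0: "0 \<le> D" unfolding D_def by (intro sum_nonneg) auto
  have mass: "0 \<le> cauchy_mass" unfolding cauchy_mass_def by (rule integral_nonneg_AE) simp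
  have "schwartz_seminorm N (mode k f) \<le> real (Suc N) ^ 3 * (cauchy_mass * (D * K))"
    if f: "schwartz_line f" and K: "line_bound M f K" for f K
  proof (rule schwartz_seminorm_le)
    fix n i j assume n: "n \<le> N" "i \<le> N" "j \<le> N"
    have K0: "0 \<le> K" by (rule line_bound_nonneg[OF K])
    have mem: "(i, j) \<in> {..N} \<times> {..N}" using n by simp
    have "m i j \<le> (\<Sum>p\<in>{..N} \<times> {..N}. m (fst p) (snd p))"
      using member_le_sum[OF mem, of "\<lambda>p. m (fst p) (snd p)"] by simp
    then have "line_bound (Suc N + m i j) f K"
      by (intro line_bound_mono[OF K]) (auto simp: M_def)
    from mC[OF schwartz_line_smooth[OF f] this]
    have b: "line_bound (Suc N) (\<lambda>x. ((- \<i> * of_int k) ^ i * ((- \<i>) ^ j * of_real x ^ j)) * f x) (C i j * K)" .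
    have "\<bar>C i j\<bar> \<le> D" unfolding D_def
      using member_le_sum[OF mem, of "\<lambda>p. \<bar>C (fst p) (snd p)\<bar>"] by simp
    then have "C i j * K \<le> D * K" using K0 by (intro mult_right_mono) auto
    then have b': "line_bound (Suc n) (\<lambda>x. ((- \<i> * of_int k) ^ i * ((- \<i>) ^ j * of_real x ^ j)) * f x) (D * K)"
      using n by (intro line_bound_mono[OF b]) auto
    show "weighted_sup n ((pdx ^^ i) ((pdy ^^ j) (mode k f))) \<le> cauchy_mass * (D * K)"
      unfolding funpow_pd_mode[OF f]
      by (rule weighted_sup_least) (unfold cmod_mode, rule fourier_line_decay[OF schwartz_line_tame_mult[OF t f] b'])
  qed
  moreover have "0 \<le> real (Suc N) ^ 3 * (cauchy_mass * D)" using mass D0 by simp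
  ultimately show ?thesis
    by (intro exI[of _ M] exI[of _ "real (Suc N) ^ 3 * (cauchy_mass * D)"]) (simp add: mult.assoc)
qed

section \<open>Holomorphic multipliers on a strip\<close>

text \<open>The half-width 1/2 keeps away from the zeros kt + ik and kt - ik of the symbol for every
  nonzero integer k, and leaves room for discs of radius 1/4 about real points.\<close>

definition strip :: "complex set" where "strip = {z. \<bar>Im z\<bar> < 1/2}"

lemma open_strip: "open strip"
  unfolding strip_def by (intro open_Collect_less continuous_intros)

lemma convex_strip: "convex strip"
proof -
  have *: "strip = {z. Im z < 1/2} \<inter> {z. Im z > -1/2}" by (auto simp: strip_def)
  show ?thesis unfolding * by (intro convex_Int convex_halfspace_Im_lt convex_halfspace_Im_gt)
qed

lemma of_real_strip [simp]: "of_real x \<in> strip"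
  by (simp add: strip_def)

lemma vd_of_holomorphic:
  assumes "f holomorphic_on strip"
  shows "((\<lambda>x. f (of_real x)) has_vector_derivative deriv f (of_real x)) (at x)"
    "vd (\<lambda>x. f (of_real x)) = (\<lambda>x. deriv f (of_real x))"
proof -
  show *: "((\<lambda>x. f (of_real x)) has_vector_derivative deriv f (of_real x)) (at x)" for x
    using assms open_strip by (intro has_vector_derivative_real_field holomorphic_derivI[of f strip]) auto
  then show "vd (\<lambda>x. f (of_real x)) = (\<lambda>x. deriv f (of_real x))" by (rule vd_eqI)
qed

lemma funpow_vd_of_holomorphic:
  assumes "f holomorphic_on strip"
  shows "(vd ^^ n) (\<lambda>x. f (of_real x)) = (\<lambda>x. (deriv ^^ n) f (of_real x))"
  by (induction n) (auto simp: vd_of_holomorphic holomorphic_higher_deriv[OF assms open_strip])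

lemma smooth_of_holomorphic:
  assumes "f holomorphic_on strip" shows "smooth (\<lambda>x. f (of_real x))"
proof (rule smooth_coinduct_set[where P="\<lambda>g. \<exists>f. f holomorphic_on strip \<and> g = (\<lambda>x. f (of_real x))"])
  fix g :: "real \<Rightarrow> complex" and x
  assume "\<exists>f. f holomorphic_on strip \<and> g = (\<lambda>x. f (of_real x))"
  then obtain f where f: "f holomorphic_on strip" "g = (\<lambda>x. f (of_real x))" by blast
  show "g differentiable at x" using vd_of_holomorphic(1)[OF f(1)] f(2) by (auto intro: differentiableI_vector)
  show "\<exists>f. f holomorphic_on strip \<and> vd g = (\<lambda>x. f (of_real x))"
    using f vd_of_holomorphic(2)[OF f(1)] holomorphic_deriv[OF f(1) open_strip] by blast
qed (use assms in auto)

text \<open>Cauchy's inequality on the circle of radius 1/4, whence the factor 4^n.\<close>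

lemma cauchy_real_derivative_bound:
  assumes f: "f holomorphic_on strip" and K: "\<And>z. cmod (z - of_real x) = 1/4 \<Longrightarrow> cmod (f z) \<le> K"
  shows "cmod ((vd ^^ n) (\<lambda>x. f (of_real x)) x) \<le> fact n * 4 ^ n * K"
proof -
  have sub: "cball (of_real x) (1/4) \<subseteq> strip"
  proof
    fix z assume "z \<in> cball (complex_of_real x) (1/4)"
    then have "cmod (z - of_real x) \<le> 1/4" by (simp add: dist_norm norm_minus_commute)
    then have "\<bar>Im (z - of_real x)\<bar> \<le> 1/4" using abs_Im_le_cmod order_trans by blast
    then show "z \<in> strip" by (simp add: strip_def)
  qed
  have "norm ((deriv ^^ n) f (of_real x)) \<le> fact n * K / (1/4) ^ n"
  proof (rule Cauchy_inequality)
    show "f holomorphic_on ball (of_real x) (1/4)"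
      using f sub by (meson ball_subset_cball holomorphic_on_subset order_trans)
    show "continuous_on (cball (of_real x) (1/4)) f"
      using f sub by (meson holomorphic_on_imp_continuous_on holomorphic_on_subset)
  qed (use K in \<open>auto simp: norm_minus_commute\<close>)
  then show ?thesis by (simp add: funpow_vd_of_holomorphic[OF f] power_divide mult.commute mult.left_commute)
qed

lemma strip_bound_nonneg:
  assumes "\<And>z. z \<in> strip \<Longrightarrow> cmod (f z) \<le> K * (1 + (cmod z)\<^sup>2) ^ m"
  shows "0 \<le> K"
  using order_trans[OF norm_ge_zero assms, of 0] by (simp add: strip_def)

text \<open>On the circle of radius 1/4 about x one has 1 + |z|^2 \<le> 4 (1 + x^2), so the growth
  exponent is the same for every derivative, as \<open>tame\<close> demands.\<close>

lemma strip_derivative_bound: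
  assumes f: "f holomorphic_on strip" and K: "\<And>z. z \<in> strip \<Longrightarrow> cmod (f z) \<le> K * (1 + (cmod z)\<^sup>2) ^ m"
  shows "cmod ((vd ^^ n) (\<lambda>x. f (of_real x)) x) \<le> (fact n * 4 ^ n * 4 ^ m) * K * (1 + x\<^sup>2) ^ m"
proof -
  have K0: "0 \<le> K" by (rule strip_bound_nonneg[OF K])
  have "cmod ((vd ^^ n) (\<lambda>x. f (of_real x)) x) \<le> fact n * 4 ^ n * (K * (4 * (1 + x\<^sup>2)) ^ m)"
  proof (rule cauchy_real_derivative_bound[OF f])
    fix z assume z: "cmod (z - of_real x) = 1/4"
    have "\<bar>Im (z - of_real x)\<bar> \<le> 1/4" using abs_Im_le_cmod[of "z - of_real x"] z by linarith
    then have zs: "z \<in> strip" by (simp add: strip_def)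
    have "cmod z \<le> \<bar>x\<bar> + 1/4" using norm_triangle_ineq2[of z "of_real x"] z by simp
    then have "(cmod z)\<^sup>2 \<le> (\<bar>x\<bar> + 1/4)\<^sup>2" by (intro power_mono) auto
    also have "\<dots> \<le> 2 * x\<^sup>2 + 2" using zero_le_power2[of "\<bar>x\<bar> - 1/4"]
      by (simp add: power2_eq_square algebra_simps)
    finally have "1 + (cmod z)\<^sup>2 \<le> 4 * (1 + x\<^sup>2)" by (smt (verit) zero_le_power2)
    then have "K * (1 + (cmod z)\<^sup>2) ^ m \<le> K * (4 * (1 + x\<^sup>2)) ^ m"
      using K0 by (intro mult_left_mono power_mono) auto
    then show "cmod (f z) \<le> K * (4 * (1 + x\<^sup>2)) ^ m" using K[OF zs] by linarith
  qed
  then show ?thesis by (simp only: power_mult_distrib mult_ac)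
qed

lemma strip_derivative_bound_uniform:
  assumes f: "f holomorphic_on strip" and K: "\<And>z. z \<in> strip \<Longrightarrow> cmod (f z) \<le> K * (1 + (cmod z)\<^sup>2) ^ m" and i: "i \<le> N"
  shows "cmod ((vd ^^ i) (\<lambda>x. f (of_real x)) x) \<le> (fact N * 4 ^ N * 4 ^ m * K) * (1 + x\<^sup>2) ^ m"
proof -
  have K0: "0 \<le> K" by (rule strip_bound_nonneg[OF K])
  have "fact i * 4 ^ i \<le> fact N * (4 ^ N :: real)"
    using i by (intro mult_mono fact_mono power_increasing) auto
  then have "fact i * 4 ^ i * 4 ^ m * K \<le> fact N * 4 ^ N * 4 ^ m * K"
    using mult_right_mono[of "fact i * 4 ^ i" "fact N * 4 ^ N" "4 ^ m * K"] K0 by (simp add: mult.assoc)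
  then have "fact i * 4 ^ i * 4 ^ m * K * (1 + x\<^sup>2) ^ m \<le> fact N * 4 ^ N * 4 ^ m * K * (1 + x\<^sup>2) ^ m"
    by (rule mult_right_mono) auto
  then show ?thesis using strip_derivative_bound[OF f K, of i x] by linarith
qed

lemma strip_tame:
  assumes f: "f holomorphic_on strip" and K: "\<And>z. z \<in> strip \<Longrightarrow> cmod (f z) \<le> K * (1 + (cmod z)\<^sup>2) ^ m"
  shows "tame (\<lambda>x. f (of_real x))"
  unfolding tame_def using smooth_of_holomorphic[OF f] strip_derivative_bound_uniform[OF f K] by blast

section \<open>Uniqueness of Fourier transforms\<close>

text \<open>A Schwartz function without zeros, the weight in
  \<open>schwartz_test_AE_unique\<close>.\<close>

definition gaussian :: "real \<Rightarrow> complex" where "gaussian x = exp (- (of_real x)\<^sup>2)"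

lemma power_div_fact_le_exp:
  assumes "x \<ge> 0" shows "x ^ n / fact n \<le> exp (x :: real)"
proof -
  have "(\<Sum>k\<in>{n}. x ^ k /\<^sub>R fact k) \<le> (\<Sum>k. x ^ k /\<^sub>R fact k)"
    using assms by (intro sum_le_suminf summable_exp_generic) auto
  then show ?thesis by (simp add: exp_def divide_inverse mult.commute)
qed

lemma schwartz_line_gaussian: "schwartz_line gaussian"
proof (rule schwartz_lineI)
  define f where "f z = exp (- z\<^sup>2)" for z :: complex
  have g: "gaussian = (\<lambda>x. f (of_real x))" by (simp add: fun_eq_iff f_def gaussian_def)
  have hol: "f holomorphic_on strip" unfolding f_def by (intro holomorphic_intros)
  show "smooth gaussian" unfolding g by (rule smooth_of_holomorphic[OF hol])
  fix N
  define C :: real where "C = fact N * 2 ^ N * exp (1/2) * (fact N * 4 ^ N * exp (1/8))"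
  have "(1 + x\<^sup>2) ^ N * cmod ((vd ^^ i) gaussian x) \<le> C" if i: "i \<le> N" for i x
  proof -
    have "cmod ((vd ^^ i) gaussian x) \<le> fact i * 4 ^ i * exp (1/8 - x\<^sup>2 / 2)"
      unfolding g
    proof (rule cauchy_real_derivative_bound[OF hol])
      fix z assume z: "cmod (z - of_real x) = 1/4"
      define u v where "u = Re z - x" and "v = Im z"
      have "(cmod (z - of_real x))\<^sup>2 = u\<^sup>2 + v\<^sup>2" by (simp add: cmod_power2 u_def v_def)
      then have uv: "u\<^sup>2 + v\<^sup>2 = 1/16" using z by (simp add: power2_eq_square)
      have "cmod (f z) = exp (- (Re z)\<^sup>2 + v\<^sup>2)" by (simp add: f_def v_def power2_eq_square)
      also have "- (Re z)\<^sup>2 + v\<^sup>2 = - (x + u)\<^sup>2 + (1/16 - u\<^sup>2)" using uv by (simp add: u_def)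
      \<comment> \<open>The gap between the two sides is 1/16 + (x + 2u)^2 / 2.\<close>
      also have "\<dots> \<le> 1/8 - x\<^sup>2 / 2"
        using zero_le_power2[of "x + 2 * u"] by (simp add: power2_eq_square algebra_simps)
      finally show "cmod (f z) \<le> exp (1/8 - x\<^sup>2 / 2)" by simp
    qed
    also have "\<dots> \<le> fact N * 4 ^ N * exp (1/8 - x\<^sup>2 / 2)"
      using i by (intro mult_right_mono mult_mono fact_mono power_increasing) auto
    finally have 1: "cmod ((vd ^^ i) gaussian x) \<le> fact N * 4 ^ N * exp (1/8 - x\<^sup>2 / 2)" .
    \<comment> \<open>One term of the exponential series bounds the polynomial weight by a multiple
      of exp(x^2 / 2), which is exactly the decay left by the estimate on the circle.\<close>
    have "((1 + x\<^sup>2) / 2) ^ N / fact N \<le> exp ((1 + x\<^sup>2) / 2)"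
      by (rule power_div_fact_le_exp) simp
    then have "(1 + x\<^sup>2) ^ N \<le> exp ((1 + x\<^sup>2) / 2) * (2 ^ N * fact N)"
      by (simp add: power_divide pos_divide_le_eq)
    moreover have "(1 + x\<^sup>2) / 2 = 1/2 + x\<^sup>2 / 2" by simp
    ultimately have 2: "(1 + x\<^sup>2) ^ N \<le> fact N * 2 ^ N * exp (1/2 + x\<^sup>2 / 2)"
      by (simp only: mult_ac)
    have "(1 + x\<^sup>2) ^ N * cmod ((vd ^^ i) gaussian x) \<le>
       (fact N * 2 ^ N * exp (1/2 + x\<^sup>2 / 2)) * (fact N * 4 ^ N * exp (1/8 - x\<^sup>2 / 2))"
      by (intro mult_mono 1 2) auto
    also have "\<dots> = C" by (simp add: C_def exp_add exp_diff)
    finally show ?thesis .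
  qed
  then show "\<exists>K. line_bound N gaussian K" unfolding line_bound_def by blast
qed

lemma tame_cis: "tame (\<lambda>x. cis (y * x))"
proof -
  have "tame (\<lambda>x. exp (\<i> * of_real y * complex_of_real x))"
  proof (rule strip_tame)
    show "(\<lambda>z. exp (\<i> * of_real y * z)) holomorphic_on strip" by (intro holomorphic_intros)
    fix z assume "z \<in> strip"
    then have "- (y * Im z) \<le> \<bar>y\<bar>"
      using mult_mono[of "\<bar>y\<bar>" "\<bar>y\<bar>" "\<bar>Im z\<bar>" 1] by (auto simp: strip_def abs_mult[symmetric])
    then show "cmod (exp (\<i> * of_real y * z)) \<le> exp \<bar>y\<bar> * (1 + (cmod z)\<^sup>2) ^ 0"
      by simp
  qed
  then show ?thesis by (simp add: cis_conv_exp mult.assoc)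
qed

text \<open>Positive and negative part have the same mass \<open>m\<close>, by the hypothesis at y =
  0. Divided by \<open>m\<close> they are densities of probability measures with equal
  characteristic functions, hence equal by Levy's uniqueness theorem. Since at each point one of the
  two parts is 0, both vanish.\<close>

lemma real_L1_fourier_injective:
  fixes r :: "real \<Rightarrow> real"
  assumes r: "integrable lborel r" and zero: "\<And>y. (LINT x|lborel. of_real (r x) * cis (y * x)) = 0"
  shows "AE x in lborel. r x = 0"
proof -
  define m where "m = (LINT x|lborel. max 0 (r x))"
  have int: "integrable lborel (\<lambda>x. max 0 (r x))" "integrable lborel (\<lambda>x. max 0 (- r x))"
    using r by auto
  have "(LINT x|lborel. r x) = 0" using zero[of 0] by (simp add: integral_complex_of_real)
  moreover have "(LINT x|lborel. r x) = (LINT x|lborel. max 0 (r x) - max 0 (- r x))"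
    by (rule Bochner_Integration.integral_cong) auto
  ultimately have m: "(LINT x|lborel. max 0 (- r x)) = m" using int by (simp add: m_def)
  have m0: "m \<ge> 0" unfolding m_def by simp
  show ?thesis
  proof (cases "m = 0")
    case True
    have "AE x in lborel. max 0 (r x) = 0" "AE x in lborel. max 0 (- r x) = 0"
      using int True m integral_nonneg_eq_0_iff_AE[OF int(1)] integral_nonneg_eq_0_iff_AE[OF int(2)]
      by (auto simp: m_def)
    then show ?thesis by eventually_elim (auto simp: max_def split: if_splits)
  next
    case False
    then have mp: "m > 0" using m0 by simp
    define M where "M g = density lborel (\<lambda>x. ennreal (max 0 (g x) / m))" for g :: "real \<Rightarrow> real"
    have meas [measurable]: "r \<in> borel_measurable borel" using r by auto
    have dist: "real_distribution (M g)"
      if "integrable lborel (\<lambda>x. max 0 (g x))" "(LINT x|lborel. max 0 (g x)) = m" "g \<in> borel_measurable borel" for g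
    proof -
      note that(3)[measurable]
      have "emeasure (M g) UNIV = (\<integral>\<^sup>+x. ennreal (max 0 (g x) / m) \<partial>lborel)"
        unfolding M_def by (subst emeasure_density) auto
      also have "\<dots> = ennreal (LINT x|lborel. max 0 (g x) / m)"
        using that mp by (intro nn_integral_eq_integral) auto
      also have "\<dots> = 1" using that mp by simp
      finally have "prob_space (M g)" by (intro prob_spaceI) (simp add: M_def)
      then show ?thesis unfolding real_distribution_def real_distribution_axioms_def by (simp add: M_def)
    qed
    have char: "char (M g) y = (LINT x|lborel. of_real (max 0 (g x)) * cis (y * x)) / m"
      if "g \<in> borel_measurable borel" for g y
    proof -
      note that[measurable]
      have "char (M g) y = (LINT x|lborel. (max 0 (g x) / m) *\<^sub>R cis (y * x))"
        unfolding char_def M_def using mp by (subst integral_density) (auto simp: cis_conv_exp)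
      also have "\<dots> = (LINT x|lborel. (of_real (max 0 (g x)) * cis (y * x)) / m)"
        by (simp add: scaleR_conv_of_real)
      finally show ?thesis by simp
    qed
    have "char (M r) = char (M (\<lambda>x. - r x))"
    proof
      fix y
      have i: "integrable lborel (\<lambda>x. of_real (max 0 (g x)) * cis (y * x))"
        if "integrable lborel (\<lambda>x. max 0 (g x))" "g \<in> borel_measurable borel" for g
      proof (rule Bochner_Integration.integrable_bound[OF that(1)])
        note that(2)[measurable]
        show "(\<lambda>x. of_real (max 0 (g x)) * cis (y * x)) \<in> borel_measurable lborel"
          unfolding cis_conv_exp by measurable
      qed (auto simp: norm_mult)
      have "(LINT x|lborel. of_real (r x) * cis (y * x)) =
         (LINT x|lborel. of_real (max 0 (r x)) * cis (y * x) - of_real (max 0 (- r x)) * cis (y * x))"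
        by (rule Bochner_Integration.integral_cong) (auto simp: max_def algebra_simps)
      also have "\<dots> = (LINT x|lborel. of_real (max 0 (r x)) * cis (y * x)) - (LINT x|lborel. of_real (max 0 (- r x)) * cis (y * x))"
        using i[of r] i[of "\<lambda>x. - r x"] int by (subst Bochner_Integration.integral_diff) auto
      finally show "char (M r) y = char (M (\<lambda>x. - r x)) y" using zero[of y] by (simp add: char)
    qed
    then have "M r = M (\<lambda>x. - r x)"
      using Levy_uniqueness[OF dist[of r] dist[of "\<lambda>x. - r x"]] int m by (auto simp: m_def)
    then have "AE x in lborel. ennreal (max 0 (r x) / m) = ennreal (max 0 (- r x) / m)"
      unfolding M_def by (intro sigma_finite_measure.density_unique[OF sigma_finite_lborel]) auto
    then show ?thesis
    proof eventually_elim
      case (elim x)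
      then have "max 0 (r x) / m = max 0 (- r x) / m" using mp by (subst (asm) ennreal_inj) auto
      then have "max 0 (r x) = max 0 (- r x)" using mp by simp
      then show ?case by linarith
    qed
  qed
qed

text \<open>The transform of the conjugate of \<open>h\<close> at y is the conjugate of the
  transform of \<open>h\<close> at -y, so the real and imaginary parts of \<open>h\<close> have
  vanishing transforms too.\<close>

lemma L1_fourier_injective:
  fixes h :: "real \<Rightarrow> complex"
  assumes h: "integrable lborel h" and zero: "\<And>y. (LINT x|lborel. h x * cis (y * x)) = 0"
  shows "AE x in lborel. h x = 0"
proof -
  have i: "integrable lborel (\<lambda>x. g x * cis (y * x))" if "integrable lborel g" for g :: "real \<Rightarrow> complex" and y
  proof (rule Bochner_Integration.integrable_bound[OF that])
    show "(\<lambda>x. g x * cis (y * x)) \<in> borel_measurable lborel"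
      unfolding cis_conv_exp using that by measurable
  qed (auto simp: norm_mult)
  have hc: "integrable lborel (\<lambda>x. cnj (h x))" using h by simp
  have zero': "(LINT x|lborel. cnj (h x) * cis (y * x)) = 0" for y
  proof -
    have "(LINT x|lborel. cnj (h x) * cis (y * x)) = (LINT x|lborel. cnj (h x * cis (- y * x)))"
      by (simp add: cis_cnj)
    also have "\<dots> = cnj (LINT x|lborel. h x * cis (- y * x))" by (rule Bochner_Integration.integral_cnj)
    finally show ?thesis using zero[of "- y"] by simp
  qed
  have "AE x in lborel. Re (h x) = 0"
  proof (rule real_L1_fourier_injective)
    fix y
    have "(LINT x|lborel. of_real (Re (h x)) * cis (y * x)) =
        (LINT x|lborel. (h x * cis (y * x) + cnj (h x) * cis (y * x)) / 2)"
      by (rule Bochner_Integration.integral_cong) (auto simp: complex_add_cnj simp flip: distrib_right)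
    also have "\<dots> = 0" using zero zero' i[OF h] i[OF hc] by simp
    finally show "(LINT x|lborel. of_real (Re (h x)) * cis (y * x)) = 0" .
  qed (use h in auto)
  moreover have "AE x in lborel. Im (h x) = 0"
  proof (rule real_L1_fourier_injective)
    fix y
    have "(LINT x|lborel. of_real (Im (h x)) * cis (y * x)) =
        (LINT x|lborel. (h x * cis (y * x) - cnj (h x) * cis (y * x)) / (2 * \<i>))"
      by (rule Bochner_Integration.integral_cong) (auto simp: complex_diff_cnj mult.commute simp flip: left_diff_distrib)
    also have "\<dots> = 0" using zero zero' i[OF h] i[OF hc] by simp
    finally show "(LINT x|lborel. of_real (Im (h x)) * cis (y * x)) = 0" .
  qed (use h in auto)
  ultimately show ?thesis by eventually_elim (simp add: complex_eq_iff)
qed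

text \<open>\<open>f\<close> and \<open>g\<close> may fail to be integrable, but their products with
  the Gaussian are integrable, and cis(yx) times the Gaussian is an admissible test function. So L^1
  injectivity applies, and the Gaussian can be divided out.\<close>

lemma schwartz_test_AE_unique:
  fixes f g :: "real \<Rightarrow> complex"
  assumes f: "\<And>\<eta>. schwartz_line \<eta> \<Longrightarrow> integrable lborel (\<lambda>x. f x * \<eta> x)"
    and g: "\<And>\<eta>. schwartz_line \<eta> \<Longrightarrow> integrable lborel (\<lambda>x. g x * \<eta> x)"
    and eq: "\<And>\<eta>. schwartz_line \<eta> \<Longrightarrow> (LINT x|lborel. f x * \<eta> x) = (LINT x|lborel. g x * \<eta> x)"
  shows "AE x in lborel. f x = g x"
proof -
  have "AE x in lborel. f x * gaussian x - g x * gaussian x = 0"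
  proof (rule L1_fourier_injective)
    show "integrable lborel (\<lambda>x. f x * gaussian x - g x * gaussian x)"
      by (intro Bochner_Integration.integrable_diff f g schwartz_line_gaussian)
    fix y
    have s: "schwartz_line (\<lambda>x. cis (y * x) * gaussian x)"
      by (intro schwartz_line_tame_mult tame_cis schwartz_line_gaussian)
    have "(LINT x|lborel. (f x * gaussian x - g x * gaussian x) * cis (y * x)) =
       (LINT x|lborel. f x * (cis (y * x) * gaussian x) - g x * (cis (y * x) * gaussian x))"
      by (rule Bochner_Integration.integral_cong) (auto simp: algebra_simps)
    also have "\<dots> = 0" using f[OF s] g[OF s] eq[OF s] by simp
    finally show "(LINT x|lborel. (f x * gaussian x - g x * gaussian x) * cis (y * x)) = 0" .
  qed
  then show ?thesis by eventually_elim (simp add: gaussian_def)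
qed

section \<open>Linear systems on the strip\<close>

definition strip_primitive :: "(complex \<Rightarrow> complex) \<Rightarrow> complex \<Rightarrow> complex" where
  "strip_primitive f = (SOME g. (\<forall>z\<in>strip. (g has_field_derivative f z) (at z)) \<and> g 0 = 0)"

lemma strip_primitive:
  assumes "f holomorphic_on strip"
  shows "z \<in> strip \<Longrightarrow> (strip_primitive f has_field_derivative f z) (at z)" "strip_primitive f 0 = 0"
proof -
  obtain g where g: "\<And>z. z \<in> strip \<Longrightarrow> (g has_field_derivative f z) (at z within strip)"
    using holomorphic_convex_primitive'[OF convex_strip open_strip assms] by blast
  have "((\<lambda>z. g z - g 0) has_field_derivative f z) (at z)" if "z \<in> strip" for z
  proof -
    have "(g has_field_derivative f z) (at z)" using g[OF that] at_within_open[OF that open_strip] by simp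
    then show ?thesis using DERIV_diff[OF _ DERIV_const] by fastforce
  qed
  then have "(\<forall>z\<in>strip. ((\<lambda>z. g z - g 0) has_field_derivative f z) (at z)) \<and> g 0 - g 0 = 0" by simp
  then have "(\<forall>z\<in>strip. (strip_primitive f has_field_derivative f z) (at z)) \<and> strip_primitive f 0 = 0"
    unfolding strip_primitive_def
    by (rule someI[where P="\<lambda>g. (\<forall>z\<in>strip. (g has_field_derivative f z) (at z)) \<and> g 0 = 0"])
  then show "z \<in> strip \<Longrightarrow> (strip_primitive f has_field_derivative f z) (at z)" "strip_primitive f 0 = 0"
    by auto
qed

lemma holomorphic_strip_primitive: "f holomorphic_on strip \<Longrightarrow> strip_primitive f holomorphic_on strip"
  using strip_primitive(1) open_strip by (auto simp: holomorphic_on_open)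

lemma scaled_in_strip: "z \<in> strip \<Longrightarrow> 0 \<le> \<sigma> \<Longrightarrow> \<sigma> \<le> 1 \<Longrightarrow> of_real \<sigma> * z \<in> strip"
proof -
  assume z: "z \<in> strip" and \<sigma>: "0 \<le> \<sigma>" "\<sigma> \<le> 1"
  have "\<sigma> * \<bar>Im z\<bar> \<le> 1 * \<bar>Im z\<bar>" using \<sigma> by (intro mult_right_mono) auto
  then show ?thesis using z \<sigma> by (simp add: strip_def abs_mult)
qed

text \<open>Integration along the ray from 0 to z: a factor \<sigma>^n in the integrand yields 1/(n
  + 1), the source of the factorial in the Picard series.\<close>

lemma strip_primitive_bound:
  assumes f: "f holomorphic_on strip" and z: "z \<in> strip"
    and L: "\<And>\<sigma>. 0 \<le> \<sigma> \<Longrightarrow> \<sigma> \<le> 1 \<Longrightarrow> cmod (f (of_real \<sigma> * z)) \<le> L * \<sigma> ^ n"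
  shows "cmod (strip_primitive f z) \<le> L * cmod z / (n + 1)"
proof -
  define g where "g \<sigma> = strip_primitive f (of_real \<sigma> * z)" for \<sigma> :: real
  have g: "(g has_vector_derivative z * f (of_real \<sigma> * z)) (at \<sigma>)" if "0 \<le> \<sigma>" "\<sigma> \<le> 1" for \<sigma>
  proof -
    have "(strip_primitive f \<circ> (\<lambda>\<sigma>. of_real \<sigma> * z) has_vector_derivative z * f (of_real \<sigma> * z)) (at \<sigma>)"
      using scaled_in_strip[OF z that]
      by (intro field_vector_diff_chain_at strip_primitive(1) f) (auto intro!: derivative_eq_intros)
    then show ?thesis by (simp add: g_def[abs_def] o_def)
  qed
  define \<phi> where "\<phi> \<sigma> = L * cmod z * \<sigma> ^ Suc n / Suc n" for \<sigma> :: real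
  have \<phi>: "(\<phi> has_vector_derivative (cmod z * (L * \<sigma> ^ n))) (at \<sigma>)" for \<sigma>
  proof -
    have "(\<phi> has_real_derivative (L * cmod z * (Suc n * \<sigma> ^ (Suc n - Suc 0))) / Suc n) (at \<sigma>)"
      unfolding \<phi>_def by (intro DERIV_cdivide DERIV_cmult DERIV_pow)
    moreover have "(L * cmod z * (Suc n * \<sigma> ^ (Suc n - Suc 0))) / Suc n = cmod z * (L * \<sigma> ^ n)" by simp
    ultimately have "(\<phi> has_real_derivative (cmod z * (L * \<sigma> ^ n))) (at \<sigma>)" by (simp only:)
    then show ?thesis by (simp add: has_real_derivative_iff_has_vector_derivative)
  qed
  have "norm (g 1 - g 0) \<le> \<phi> 1 - \<phi> 0"
  proof (rule differentiable_bound_general)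
    show "continuous_on {0..1} g"
      using g by (intro continuous_at_imp_continuous_on ballI) (meson atLeastAtMost_iff has_vector_derivative_continuous)
    show "continuous_on {0..1} \<phi>"
      using \<phi> by (intro continuous_at_imp_continuous_on ballI) (meson has_vector_derivative_continuous)
    show "norm (z * f (of_real \<sigma> * z)) \<le> cmod z * (L * \<sigma> ^ n)" if "0 < \<sigma>" "\<sigma> < 1" for \<sigma>
      using L[of \<sigma>] that by (auto simp: norm_mult intro!: mult_left_mono)
  qed (use g \<phi> in auto)
  then show ?thesis by (simp add: g_def \<phi>_def strip_primitive(2)[OF f])
qed

text \<open>Picard iteration in the complex variable, written as a series. As \<open>r\<close> may
  be unbounded on the strip, convergence is only locally uniform. Bounds of \<open>r\<close> along
  rays from 0 suffice because the strip is star-shaped about 0.\<close>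

lemma linear_ode_on_strip:
  assumes r: "r holomorphic_on strip"
  obtains a b where
    "\<And>z. z \<in> strip \<Longrightarrow> (a has_field_derivative p * b z) (at z)"
    "\<And>z. z \<in> strip \<Longrightarrow> (b has_field_derivative r z * b z + p * a z) (at z)"
    "a 0 = x" "b 0 = y"
proof -
  \<comment> \<open>Only the integral part of Picard's map: \<open>a n\<close> and
    \<open>b n\<close> are the successive increments, which vanish at 0 for n > 0, and the solution
    is their sum.\<close>
  define step where "step = (\<lambda>(u, v). (strip_primitive (\<lambda>z. p * v z), strip_primitive (\<lambda>z. r z * v z + p * u z)))"
  define X where "X n = (step ^^ n) ((\<lambda>_. x), (\<lambda>_. y))" for n
  define a where "a n = fst (X n)" for n
  define b where "b n = snd (X n)" for n
  have a0: "a 0 = (\<lambda>_. x)" and b0: "b 0 = (\<lambda>_. y)" by (simp_all add: a_def b_def X_def)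
  have aS: "a (Suc n) = strip_primitive (\<lambda>z. p * b n z)"
    and bS: "b (Suc n) = strip_primitive (\<lambda>z. r z * b n z + p * a n z)" for n
    by (simp_all add: a_def b_def X_def step_def split_beta)
  have hol: "a n holomorphic_on strip \<and> b n holomorphic_on strip" for n
    by (induction n) (auto simp: a0 b0 aS bS intro!: holomorphic_strip_primitive holomorphic_intros r)
  define a' where "a' n z = (case n of 0 \<Rightarrow> 0 | Suc n \<Rightarrow> p * b n z)" for n z
  define b' where "b' n z = (case n of 0 \<Rightarrow> 0 | Suc n \<Rightarrow> r z * b n z + p * a n z)" for n z
  have da: "(a n has_field_derivative a' n z) (at z)" if "z \<in> strip" for n z
    using that hol r by (cases n) (auto simp: a0 aS a'_def intro!: strip_primitive(1) holomorphic_intros)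
  have db: "(b n has_field_derivative b' n z) (at z)" if "z \<in> strip" for n z
    using that hol r by (cases n) (auto simp: b0 bS b'_def intro!: strip_primitive(1) holomorphic_intros)
  \<comment> \<open>The bound \<open>K\<close> is required on the whole ray because the induction
    hypothesis is applied at the points \<sigma> z.\<close>
  have bound: "cmod (a n z) \<le> (cmod x + cmod y) * (K * cmod z) ^ n / fact n \<and>
               cmod (b n z) \<le> (cmod x + cmod y) * (K * cmod z) ^ n / fact n"
    if "z \<in> strip" "\<And>\<sigma>. 0 \<le> \<sigma> \<Longrightarrow> \<sigma> \<le> 1 \<Longrightarrow> cmod (r (of_real \<sigma> * z)) + cmod p \<le> K" for K n z
    using that
  proof (induction n arbitrary: z)
    case 0
    then show ?case by (simp add: a0 b0)
  next
    case (Suc n)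
    have K: "cmod p \<le> K" using Suc.prems(2)[of 0] norm_ge_zero[of "r (of_real 0 * z)"] by linarith
    then have K0: "K \<ge> 0" using norm_ge_zero[of p] by linarith
    define B where "B = (cmod x + cmod y) * (K * cmod z) ^ n / fact n"
    have ab: "cmod (a n (of_real \<sigma> * z)) \<le> B * \<sigma> ^ n" "cmod (b n (of_real \<sigma> * z)) \<le> B * \<sigma> ^ n"
      if \<sigma>: "0 \<le> \<sigma>" "\<sigma> \<le> 1" for \<sigma>
    proof -
      have "cmod (r (of_real \<sigma>' * (of_real \<sigma> * z))) + cmod p \<le> K" if "0 \<le> \<sigma>'" "\<sigma>' \<le> 1" for \<sigma>'
        using Suc.prems(2)[of "\<sigma>' * \<sigma>"] that \<sigma> by (simp add: mult_le_one mult.assoc)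
      then have "cmod (a n (of_real \<sigma> * z)) \<le> (cmod x + cmod y) * (K * cmod (of_real \<sigma> * z)) ^ n / fact n \<and>
               cmod (b n (of_real \<sigma> * z)) \<le> (cmod x + cmod y) * (K * cmod (of_real \<sigma> * z)) ^ n / fact n"
        by (intro Suc.IH scaled_in_strip Suc.prems \<sigma>) auto
      moreover have "(cmod x + cmod y) * (K * cmod (of_real \<sigma> * z)) ^ n / fact n = B * \<sigma> ^ n"
        using \<sigma> by (simp add: B_def norm_mult power_mult_distrib mult_ac)
      ultimately show "cmod (a n (of_real \<sigma> * z)) \<le> B * \<sigma> ^ n" "cmod (b n (of_real \<sigma> * z)) \<le> B * \<sigma> ^ n"
        by auto
    qed
    have B0: "B \<ge> 0" using order_trans[OF norm_ge_zero ab(1)[of 1]] by simp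
    have eq: "K * B * cmod z / (n + 1) = (cmod x + cmod y) * (K * cmod z) ^ Suc n / fact (Suc n)"
      by (simp add: B_def mult_ac)
    have "cmod (a (Suc n) z) \<le> K * B * cmod z / (n + 1)" unfolding aS
    proof (rule strip_primitive_bound)
      show "(\<lambda>z. p * b n z) holomorphic_on strip" using hol by (intro holomorphic_intros) auto
      fix \<sigma> :: real assume \<sigma>: "0 \<le> \<sigma>" "\<sigma> \<le> 1"
      have "cmod (p * b n (of_real \<sigma> * z)) \<le> K * (B * \<sigma> ^ n)"
        unfolding norm_mult using K K0 ab(2)[OF \<sigma>] by (intro mult_mono) auto
      then show "cmod (p * b n (of_real \<sigma> * z)) \<le> K * B * \<sigma> ^ n" by (simp add: mult.assoc)
    qed (fact Suc.prems)
    moreover have "cmod (b (Suc n) z) \<le> K * B * cmod z / (n + 1)" unfolding bS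
    proof (rule strip_primitive_bound)
      show "(\<lambda>z. r z * b n z + p * a n z) holomorphic_on strip" using hol r by (intro holomorphic_intros) auto
      fix \<sigma> :: real assume \<sigma>: "0 \<le> \<sigma>" "\<sigma> \<le> 1"
      let ?z = "of_real \<sigma> * z"
      have "cmod (r ?z * b n ?z + p * a n ?z) \<le> cmod (r ?z) * cmod (b n ?z) + cmod p * cmod (a n ?z)"
        by (metis norm_triangle_ineq norm_mult)
      also have "\<dots> \<le> cmod (r ?z) * (B * \<sigma> ^ n) + cmod p * (B * \<sigma> ^ n)"
        by (intro add_mono mult_left_mono ab \<sigma>) auto
      also have "\<dots> = (cmod (r ?z) + cmod p) * (B * \<sigma> ^ n)" by (simp add: distrib_right)
      also have "\<dots> \<le> K * (B * \<sigma> ^ n)"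
        using Suc.prems(2)[OF \<sigma>] B0 \<sigma> by (intro mult_right_mono) auto
      finally show "cmod (r ?z * b n ?z + p * a n ?z) \<le> K * B * \<sigma> ^ n" by (simp add: mult.assoc)
    qed (fact Suc.prems)
    ultimately show ?case unfolding eq by blast
  qed
  have local: "\<exists>d h. 0 < d \<and> summable h \<and> range h \<subseteq> \<real>\<^sub>\<ge>\<^sub>0 \<and>
      (\<forall>\<^sub>F n in sequentially. \<forall>y\<in>ball z d \<inter> strip. cmod (f n y) \<le> cmod (h n))"
    if z: "z \<in> strip" and f: "f = a \<or> f = b" for z f
  proof -
    \<comment> \<open>Half the distance to the boundary, so that the enlarged region
      \<open>C\<close> still lies in the strip.\<close>
    define d where "d = (1/2 - \<bar>Im z\<bar>) / 2"
    have d: "d > 0" using z by (simp add: d_def strip_def)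
    \<comment> \<open>Compact, star-shaped about 0 and containing the ball about z, so one bound of
      \<open>r\<close> on it serves the rays to all points of the ball.\<close>
    define C where "C = {w. \<bar>Im w\<bar> \<le> \<bar>Im z\<bar> + d} \<inter> cball 0 (cmod z + d)"
    have "C \<subseteq> strip" using d by (auto simp: C_def strip_def d_def field_simps)
    have "closed {w. \<bar>Im w\<bar> \<le> \<bar>Im z\<bar> + d}" by (intro closed_Collect_le continuous_intros)
    then have "compact C" unfolding C_def by (intro closed_Int_compact) auto
    moreover have "continuous_on C r" using r \<open>C \<subseteq> strip\<close> holomorphic_on_imp_continuous_on continuous_on_subset by blast
    ultimately have "bounded (r ` C)" using compact_continuous_image compact_imp_bounded by blast
    then obtain R where R: "\<And>w. w \<in> C \<Longrightarrow> cmod (r w) \<le> R" unfolding bounded_iff by auto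
    have "0 \<in> C" using d by (simp add: C_def)
    then have "R \<ge> 0" using R[of 0] norm_ge_zero order_trans by blast
    define K where "K = R + cmod p"
    have K0: "K \<ge> 0" using \<open>R \<ge> 0\<close> by (simp add: K_def)
    define T where "T n = (cmod x + cmod y) * (K * (cmod z + d)) ^ n / fact n" for n
    have T0: "T n \<ge> 0" for n using K0 d by (auto simp: T_def)
    have "summable (\<lambda>n. (cmod x + cmod y) * ((K * (cmod z + d)) ^ n /\<^sub>R fact n))"
      by (intro summable_mult summable_exp_generic)
    then have sT: "summable (\<lambda>n. of_real (T n) :: complex)"
      unfolding T_def summable_of_real_iff by (simp add: divide_inverse mult_ac)
    have "cmod (f n w) \<le> cmod (of_real (T n))" if w: "w \<in> ball z d \<inter> strip" for n w
    proof -
      have wd: "cmod (w - z) \<le> d" using w by (simp add: dist_norm norm_minus_commute)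
      have "\<bar>Im (w - z)\<bar> \<le> d" using wd abs_Im_le_cmod order_trans by blast
      then have "\<bar>Im w\<bar> \<le> \<bar>Im z\<bar> + d" by simp
      moreover have wz: "cmod w \<le> cmod z + d" using wd norm_triangle_sub[of w z] by simp
      ultimately have "w \<in> C" by (simp add: C_def)
      have "of_real \<sigma> * w \<in> C" if \<sigma>: "0 \<le> \<sigma>" "\<sigma> \<le> 1" for \<sigma>
      proof -
        have "\<sigma> * \<bar>Im w\<bar> \<le> 1 * \<bar>Im w\<bar>" "\<sigma> * cmod w \<le> 1 * cmod w"
          using \<sigma> by (intro mult_right_mono; simp)+
        then show ?thesis using \<open>w \<in> C\<close> \<sigma> by (auto simp: C_def abs_mult norm_mult)
      qed
      then have "cmod (f n w) \<le> (cmod x + cmod y) * (K * cmod w) ^ n / fact n"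
        using bound[of w K n] R w f by (auto simp: K_def)
      also have "\<dots> \<le> T n" unfolding T_def
        using wz K0 by (intro divide_right_mono mult_left_mono power_mono) auto
      finally show ?thesis using T0[of n] by simp
    qed
    then show ?thesis using d sT T0
      by (intro exI[of _ d] exI[of _ "\<lambda>n. of_real (T n)"]) (auto simp: nonneg_Reals_of_real_iff)
  qed
  obtain A A' where A: "\<And>z. z \<in> strip \<Longrightarrow> (\<lambda>n. a n z) sums A z" "\<And>z. z \<in> strip \<Longrightarrow> (\<lambda>n. a' n z) sums A' z"
     "\<And>z. z \<in> strip \<Longrightarrow> (A has_field_derivative A' z) (at z)"
    using series_and_derivative_comparison_complex[OF open_strip da local[of _ a]] by blast
  obtain B B' where B: "\<And>z. z \<in> strip \<Longrightarrow> (\<lambda>n. b n z) sums B z" "\<And>z. z \<in> strip \<Longrightarrow> (\<lambda>n. b' n z) sums B' z"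
     "\<And>z. z \<in> strip \<Longrightarrow> (B has_field_derivative B' z) (at z)"
    using series_and_derivative_comparison_complex[OF open_strip db local[of _ b]] by blast
  have A': "A' z = p * B z" if "z \<in> strip" for z
  proof -
    have "(\<lambda>n. a' (Suc n) z) sums (p * B z)"
      using sums_mult[OF B(1)[OF that], of p] by (simp add: a'_def)
    then have "(\<lambda>n. a' n z) sums (p * B z)" using sums_Suc_iff[of "\<lambda>n. a' n z"] by (simp add: a'_def)
    then show ?thesis using A(2)[OF that] sums_unique2 by blast
  qed
  have B': "B' z = r z * B z + p * A z" if "z \<in> strip" for z
  proof -
    have "(\<lambda>n. b' (Suc n) z) sums (r z * B z + p * A z)"
      using sums_add[OF sums_mult[OF B(1)[OF that], of "r z"] sums_mult[OF A(1)[OF that], of p]] by (simp add: b'_def)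
    then have "(\<lambda>n. b' n z) sums (r z * B z + p * A z)" using sums_Suc_iff[of "\<lambda>n. b' n z"] by (simp add: b'_def)
    then show ?thesis using B(2)[OF that] sums_unique2 by blast
  qed
  have z0: "0 \<in> strip" by (simp add: strip_def)
  have "a n 0 = (if n = 0 then x else 0)" "b n 0 = (if n = 0 then y else 0)" for n
    using hol r by (cases n; auto simp: a0 b0 aS bS intro!: strip_primitive(2) holomorphic_intros)+
  then have "A 0 = x" "B 0 = y"
    using sums_unique2[OF A(1)[OF z0], of x] sums_unique2[OF B(1)[OF z0], of y]
      sums_single[of 0 "\<lambda>_. x"] sums_single[of 0 "\<lambda>_. y"] by (simp_all add: eq_commute)
  then show ?thesis using that[of A B] A(3) B(3) A' B' by metis
qed

section \<open>The adjoint system of a single mode\<close>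

text \<open>The coefficient c with \<xi> continued to complex z; it depends on z and t only through
  z - kt. For k = 0 the fraction has numerator 0 and drops out, even where its denominator
  vanishes.\<close>

definition damping :: "real \<Rightarrow> int \<Rightarrow> real \<Rightarrow> complex \<Rightarrow> complex" where
  "damping \<kappa> k t z = of_real \<kappa> * ((of_int k)\<^sup>2 + (z - of_int k * of_real t)\<^sup>2)
     + 2 * of_int k * (z - of_int k * of_real t) / ((of_int k)\<^sup>2 + (z - of_int k * of_real t)\<^sup>2)"

lemma symbol_Re_lower:
  assumes "z \<in> strip"
  shows "Re ((of_int k)\<^sup>2 + (z - of_int k * of_real t)\<^sup>2) \<ge> (of_int k)\<^sup>2 + (Re z - of_int k * t)\<^sup>2 - 1/4"
proof -
  have "\<bar>Im z\<bar>\<^sup>2 \<le> (1/2)\<^sup>2" using assms unfolding strip_def by (intro power_mono) auto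
  then have "(Im z)\<^sup>2 \<le> 1/4" by (simp add: power_divide)
  moreover have "Re ((of_int k)\<^sup>2 + (z - of_int k * of_real t)\<^sup>2) = (of_int k)\<^sup>2 + ((Re z - of_int k * t)\<^sup>2 - (Im z)\<^sup>2)"
    by (simp add: Re_power2)
  ultimately show ?thesis by linarith
qed

text \<open>Integrality of k enters here: k^2 \<ge> 1 outweighs the loss (Im z)^2 \<le> 1/4.\<close>

lemma symbol_norm_lower:
  assumes "z \<in> strip" "k \<noteq> 0"
  shows "cmod ((of_int k)\<^sup>2 + (z - of_int k * of_real t)\<^sup>2) \<ge> 3/4 + (Re z - of_int k * t)\<^sup>2"
proof -
  have "1 \<le> k\<^sup>2" using assms(2) by (simp add: int_one_le_iff_zero_less)
  then have "1 \<le> (of_int k :: real)\<^sup>2" by (metis of_int_1_le_iff of_int_power)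
  then show ?thesis using symbol_Re_lower[OF assms(1), of k t]
      complex_Re_le_cmod[of "(of_int k)\<^sup>2 + (z - of_int k * of_real t)\<^sup>2"] by linarith
qed

lemma symbol_nonzero:
  assumes "z \<in> strip" "k \<noteq> 0"
  shows "(of_int k)\<^sup>2 + (z - of_int k * of_real t)\<^sup>2 \<noteq> 0"
proof -
  have "cmod ((of_int k)\<^sup>2 + (z - of_int k * of_real t)\<^sup>2) > 0"
    by (rule less_le_trans[OF _ symbol_norm_lower[OF assms, of t]]) (simp add: add_pos_nonneg)
  then show ?thesis by auto
qed

lemma holomorphic_damping: "damping \<kappa> k t holomorphic_on strip"
proof (cases "k = 0")
  case True
  then show ?thesis unfolding damping_def by (auto intro!: holomorphic_intros)
next
  case False
  then show ?thesis unfolding damping_def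
    by (intro holomorphic_intros) (auto dest: symbol_nonzero)
qed

text \<open>A linear numerator against a quadratic denominator: with u = Re z - kt, |u| + 1/2 \<le>
  u^2 + 3/4, and the right side is below the modulus of the symbol. The bound is therefore uniform
  in time.\<close>

lemma damping_fraction_bound:
  assumes "z \<in> strip"
  shows "cmod (2 * of_int k * (z - of_int k * of_real t) / ((of_int k)\<^sup>2 + (z - of_int k * of_real t)\<^sup>2)) \<le> 4 * \<bar>of_int k\<bar>"
proof (cases "k = 0")
  case False
  define q where "q = (of_int k)\<^sup>2 + (z - of_int k * of_real t)\<^sup>2"
  define u where "u = Re z - of_int k * t"
  have q: "cmod q \<ge> 3/4 + u\<^sup>2" unfolding q_def u_def by (rule symbol_norm_lower[OF assms False])
  have "cmod (z - of_int k * of_real t) \<le> \<bar>u\<bar> + \<bar>Im z\<bar>"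
    using cmod_le[of "z - of_int k * of_real t"] by (simp add: u_def)
  also have "\<dots> \<le> \<bar>u\<bar> + 1/2" using assms by (simp add: strip_def)
  finally have *: "cmod (z - of_int k * of_real t) \<le> \<bar>u\<bar> + 1/2" .
  have "\<bar>u\<bar> \<le> u\<^sup>2 + 1/4"
    using zero_le_power2[of "\<bar>u\<bar> - 1/2"] unfolding power2_diff by (simp add: power_divide)
  then have "\<bar>u\<bar> + 1/2 \<le> cmod q" using q by linarith
  then have "cmod (z - of_int k * of_real t) \<le> 2 * cmod q" using * norm_ge_zero[of q] by linarith
  then have "2 * \<bar>of_int k\<bar> * cmod (z - of_int k * of_real t) \<le> 2 * \<bar>of_int k\<bar> * (2 * cmod q)"
    by (intro mult_left_mono) auto
  moreover have "cmod q > 0" by (rule less_le_trans[OF _ q]) (simp add: add_pos_nonneg)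
  ultimately show ?thesis
    by (simp add: norm_mult norm_divide pos_divide_le_eq flip: q_def)
qed simp

text \<open>The quadratic part of \<open>damping\<close> is unbounded, but its real part is bounded
  below, since the negative contribution of (Im z)^2 is at most 1/4. That sign is what keeps
  backward solutions bounded on the strip.\<close>

lemma damping_Re_lower:
  assumes "\<kappa> > 0" "z \<in> strip" shows "Re (damping \<kappa> k t z) \<ge> - (\<kappa> + 4 * \<bar>of_int k\<bar>)"
proof -
  let ?q = "(of_int k)\<^sup>2 + (z - of_int k * of_real t)\<^sup>2"
  define b where "b = (of_int k)\<^sup>2 + (Re z - of_int k * t)\<^sup>2"
  have "b \<ge> 0" by (simp add: b_def)
  then have "Re ?q \<ge> - 1" using symbol_Re_lower[OF assms(2), of k t] unfolding b_def[symmetric] by linarith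
  then have "\<kappa> * Re ?q \<ge> \<kappa> * (- 1)" using assms(1) by (intro mult_left_mono) auto
  moreover have "Re (2 * of_int k * (z - of_int k * of_real t) / ?q) \<ge> - (4 * \<bar>of_int k\<bar>)"
    using damping_fraction_bound[OF assms(2), of k t] abs_Re_le_cmod[of "2 * of_int k * (z - of_int k * of_real t) / ?q"]
    by linarith
  moreover have "Re (damping \<kappa> k t z) = \<kappa> * Re ?q + Re (2 * of_int k * (z - of_int k * of_real t) / ?q)"
    unfolding damping_def plus_complex.sel(1)[of "_ * _"]
    by (simp only: times_complex.sel Re_complex_of_real Im_complex_of_real mult_zero_left diff_0_right)
  ultimately show ?thesis by linarith
qed

text \<open>For the adjoint solutions these bounds give the size of the time derivatives and their
  Lipschitz constants in time, with the polynomial growth in z that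
  \<open>holomorphic_test_curve\<close> admits.\<close>

lemma damping_bounds:
  assumes "\<kappa> > 0" "T > 0"
  obtains K where "K \<ge> 0"
    "\<And>t z. t \<in> {0..T} \<Longrightarrow> z \<in> strip \<Longrightarrow> cmod (damping \<kappa> k t z) \<le> K * (1 + (cmod z)\<^sup>2)"
    "\<And>s t z. s \<in> {0..T} \<Longrightarrow> t \<in> {0..T} \<Longrightarrow> z \<in> strip \<Longrightarrow>
       cmod (damping \<kappa> k t z - damping \<kappa> k s z) \<le> K * \<bar>t - s\<bar> * (1 + (cmod z)\<^sup>2)"
proof -
  define m where "m = \<bar>of_int k\<bar> * (1 + T)"
  have m: "m \<ge> 0" "\<bar>of_int k\<bar> \<le> m"
    using assms(2) mult_left_mono[of 1 "1 + T" "\<bar>of_int k\<bar>"] by (simp_all add: m_def)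
  define Z where "Z t z = z - of_int k * of_real t" for t :: real and z :: complex
  define q where "q t z = (of_int k)\<^sup>2 + (Z t z)\<^sup>2" for t z
  define f where "f t z = 2 * of_int k * Z t z / q t z" for t z
  have d: "damping \<kappa> k t z = of_real \<kappa> * q t z + f t z" for t z
    by (simp add: damping_def q_def Z_def f_def)
  have Zb: "cmod (Z t z) \<le> cmod z + m" if "t \<in> {0..T}" for t z
  proof -
    have "cmod (Z t z) \<le> cmod z + cmod (of_int k * of_real t)" unfolding Z_def by (rule norm_triangle_ineq4)
    also have "cmod (of_int k * of_real t) = \<bar>of_int k\<bar> * \<bar>t\<bar>" by (simp add: norm_mult)
    also have "\<dots> \<le> m" unfolding m_def using that by (intro mult_left_mono) auto
    finally show ?thesis by simp
  qed
  have lin: "cmod z \<le> 1 + (cmod z)\<^sup>2" for z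
    using zero_le_power2[of "cmod z - 1/2"] unfolding power2_diff by (simp add: power_divide)
  have quad: "(cmod z + m)\<^sup>2 \<le> 2 * (1 + m\<^sup>2) * (1 + (cmod z)\<^sup>2)" for z
  proof -
    have "(cmod z + m)\<^sup>2 \<le> 2 * (cmod z)\<^sup>2 + 2 * m\<^sup>2"
      using zero_le_power2[of "cmod z - m"] by (simp add: power2_eq_square algebra_simps)
    also have "\<dots> \<le> 2 * (1 + m\<^sup>2) * (1 + (cmod z)\<^sup>2)" by (simp add: distrib_left distrib_right)
    finally show ?thesis .
  qed
  have qb: "cmod (q t z) \<le> (m\<^sup>2 + 2 * (1 + m\<^sup>2)) * (1 + (cmod z)\<^sup>2)" if "t \<in> {0..T}" for t z
  proof -
    have "cmod (q t z) \<le> \<bar>of_int k\<bar>\<^sup>2 + (cmod (Z t z))\<^sup>2"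
      unfolding q_def using norm_triangle_ineq[of "(of_int k)\<^sup>2" "(Z t z)\<^sup>2"] by (simp add: norm_power)
    also have "\<dots> \<le> m\<^sup>2 + (cmod z + m)\<^sup>2" using m Zb[OF that, of z] by (intro add_mono power_mono) auto
    also have "\<dots> \<le> m\<^sup>2 * (1 + (cmod z)\<^sup>2) + 2 * (1 + m\<^sup>2) * (1 + (cmod z)\<^sup>2)"
      using quad[of z] by (intro add_mono) (auto simp: distrib_left)
    finally show ?thesis by (simp add: distrib_right)
  qed
  have fb: "cmod (f t z) \<le> 4 * m" if "z \<in> strip" for t z
    using damping_fraction_bound[OF that, of k t] m by (simp add: f_def q_def Z_def)
  have qd: "cmod (q t z - q s z) \<le> 2 * m * (1 + m) * \<bar>t - s\<bar> * (1 + (cmod z)\<^sup>2)"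
    if "s \<in> {0..T}" "t \<in> {0..T}" for s t z
  proof -
    have "q t z - q s z = (of_int k * of_real (s - t)) * (Z t z + Z s z)"
      by (simp add: q_def Z_def power2_eq_square algebra_simps)
    then have "cmod (q t z - q s z) = \<bar>of_int k\<bar> * \<bar>t - s\<bar> * cmod (Z t z + Z s z)"
      by (simp add: norm_mult abs_minus_commute del: of_real_diff)
    also have "\<dots> \<le> m * \<bar>t - s\<bar> * (2 * (1 + m) * (1 + (cmod z)\<^sup>2))"
    proof (intro mult_mono)
      have "cmod (Z t z + Z s z) \<le> (cmod z + m) + (cmod z + m)"
        using norm_triangle_ineq[of "Z t z" "Z s z"] Zb[OF that(1), of z] Zb[OF that(2), of z] by linarith
      also have "\<dots> \<le> 2 * (1 + (cmod z)\<^sup>2) + 2 * m" using lin[of z] by (simp add: distrib_left)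
      also have "\<dots> \<le> 2 * (1 + m) * (1 + (cmod z)\<^sup>2)" using m by (simp add: algebra_simps)
      finally show "cmod (Z t z + Z s z) \<le> 2 * (1 + m) * (1 + (cmod z)\<^sup>2)" .
    qed (use m in auto)
    finally show ?thesis by (simp add: mult_ac)
  qed
  have fd: "cmod (f t z - f s z) \<le> (4 * m\<^sup>2 + 16 * m * (m * (1 + m))) * \<bar>t - s\<bar> * (1 + (cmod z)\<^sup>2)"
    if "s \<in> {0..T}" "t \<in> {0..T}" "z \<in> strip" for s t z
  proof (cases "k = 0")
    case True
    then show ?thesis using m by (simp add: f_def)
  next
    case False
    have nz: "q t z \<noteq> 0" "q s z \<noteq> 0"
      using symbol_nonzero[OF that(3) False] by (auto simp: q_def Z_def)
    have lower: "1/2 \<le> cmod (q t z)" unfolding q_def Z_def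
      by (rule order_trans[OF _ symbol_norm_lower[OF that(3) False, of t]]) (simp add: add_increasing2)
    \<comment> \<open>Multiplying by \<open>q t z\<close> reduces the difference of quotients to
      differences of numerators and of denominators; the lower bound 1/2 then allows dividing
      back.\<close>
    have "(f t z - f s z) * q t z = 2 * of_int k * (Z t z - Z s z) - f s z * (q t z - q s z)"
      using nz by (simp add: f_def field_simps)
    also have "cmod \<dots> \<le> cmod (2 * of_int k * (Z t z - Z s z)) + cmod (f s z) * cmod (q t z - q s z)"
      by (metis norm_triangle_ineq4 norm_mult)
    also have "Z t z - Z s z = of_int k * of_real (s - t)" by (simp add: Z_def algebra_simps)
    also have "cmod (2 * of_int k * (of_int k * of_real (s - t))) = 2 * (\<bar>of_int k\<bar> * \<bar>of_int k\<bar>) * \<bar>t - s\<bar>"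
      by (simp add: norm_mult abs_minus_commute del: of_real_diff)
    also have "2 * (\<bar>of_int k\<bar> * \<bar>of_int k\<bar>) * \<bar>t - s\<bar> + cmod (f s z) * cmod (q t z - q s z) \<le>
       2 * (m * m) * \<bar>t - s\<bar> + 4 * m * (2 * m * (1 + m) * \<bar>t - s\<bar> * (1 + (cmod z)\<^sup>2))"
      using m that by (intro add_mono mult_right_mono mult_left_mono mult_mono fb qd) auto
    also have "2 * (m * m) * \<bar>t - s\<bar> \<le> 2 * m\<^sup>2 * \<bar>t - s\<bar> * (1 + (cmod z)\<^sup>2)"
      using m by (simp add: power2_eq_square algebra_simps)
    finally have *: "cmod (f t z - f s z) * cmod (q t z) \<le> (2 * m\<^sup>2 + 8 * m * (m * (1 + m))) * \<bar>t - s\<bar> * (1 + (cmod z)\<^sup>2)"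
      unfolding norm_mult by (simp add: algebra_simps)
    have "cmod (f t z - f s z) * (1/2) \<le> cmod (f t z - f s z) * cmod (q t z)"
      using lower by (intro mult_left_mono) auto
    then show ?thesis using * by (simp add: distrib_right)
  qed
  define K1 where "K1 = m\<^sup>2 + 2 * (1 + m\<^sup>2)"
  define K2 where "K2 = 2 * m * (1 + m)"
  define K3 where "K3 = 4 * m\<^sup>2 + 16 * m * (m * (1 + m))"
  define K where "K = \<kappa> * K1 + 4 * m + (\<kappa> * K2 + K3)"
  have pos: "K1 \<ge> 0" "K2 \<ge> 0" "K3 \<ge> 0" using m by (auto simp: K1_def K2_def K3_def)
  show ?thesis
  proof
    show "K \<ge> 0" using pos m assms by (auto simp: K_def)
  next
    fix t z assume t: "t \<in> {0..T}" "z \<in> strip"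
    have "cmod (damping \<kappa> k t z) \<le> \<kappa> * cmod (q t z) + cmod (f t z)"
      unfolding d using norm_triangle_ineq[of "of_real \<kappa> * q t z" "f t z"] assms(1) by (simp add: norm_mult)
    also have "\<dots> \<le> \<kappa> * (K1 * (1 + (cmod z)\<^sup>2)) + 4 * m * (1 + (cmod z)\<^sup>2)"
    proof (intro add_mono mult_left_mono)
      show "cmod (f t z) \<le> 4 * m * (1 + (cmod z)\<^sup>2)"
        using order_trans[OF fb[OF t(2), of t], of "4 * m * (1 + (cmod z)\<^sup>2)"] m by (simp add: distrib_left)
    qed (use qb[OF t(1), of z] assms in \<open>auto simp: K1_def\<close>)
    also have "\<dots> = (\<kappa> * K1 + 4 * m) * (1 + (cmod z)\<^sup>2)" by (simp add: distrib_right)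
    also have "\<dots> \<le> K * (1 + (cmod z)\<^sup>2)"
      using pos assms by (intro mult_right_mono) (auto simp: K_def)
    finally show "cmod (damping \<kappa> k t z) \<le> K * (1 + (cmod z)\<^sup>2)" .
  next
    fix s t z assume t: "s \<in> {0..T}" "t \<in> {0..T}" "z \<in> strip"
    have "damping \<kappa> k t z - damping \<kappa> k s z = of_real \<kappa> * (q t z - q s z) + (f t z - f s z)"
      by (simp add: d algebra_simps)
    then have "cmod (damping \<kappa> k t z - damping \<kappa> k s z) \<le> \<kappa> * cmod (q t z - q s z) + cmod (f t z - f s z)"
      using norm_triangle_ineq[of "of_real \<kappa> * (q t z - q s z)" "f t z - f s z"] assms(1) by (simp add: norm_mult)
    also have "\<dots> \<le> \<kappa> * (K2 * \<bar>t - s\<bar> * (1 + (cmod z)\<^sup>2)) + K3 * \<bar>t - s\<bar> * (1 + (cmod z)\<^sup>2)"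
      using qd[OF t(1,2), of z] fd[OF t] assms(1) by (intro add_mono mult_left_mono) (auto simp: K2_def K3_def)
    also have "\<dots> = (\<kappa> * K2 + K3) * \<bar>t - s\<bar> * (1 + (cmod z)\<^sup>2)" by (simp add: distrib_right)
    also have "\<dots> \<le> K * \<bar>t - s\<bar> * (1 + (cmod z)\<^sup>2)"
      using pos assms m by (intro mult_right_mono) (auto simp: K_def)
    finally show "cmod (damping \<kappa> k t z - damping \<kappa> k s z) \<le> K * \<bar>t - s\<bar> * (1 + (cmod z)\<^sup>2)" .
  qed
qed

text \<open>As the coefficient depends on z - kt alone, d/dt at fixed z is -k times the derivative
  in the variable z - kt, and the system becomes a holomorphic one in that variable. Its solutions
  are holomorphic by construction, so no theorem on parameter dependence enters. Dividing by k
  forces the separate case k = 0, in which the two equations decouple.\<close>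

lemma backward_system_exists:
  fixes k :: int and \<alpha> \<kappa> T :: real and x y :: complex
  obtains A B :: "real \<Rightarrow> complex \<Rightarrow> complex" where
    "\<And>t. A t holomorphic_on strip" "\<And>t. B t holomorphic_on strip"
    "\<And>z. z \<in> strip \<Longrightarrow> A T z = x" "\<And>z. z \<in> strip \<Longrightarrow> B T z = y"
    "\<And>t z. z \<in> strip \<Longrightarrow> ((\<lambda>t. A t z) has_vector_derivative - (\<i> * of_real (\<alpha> * k) * B t z)) (at t)"
    "\<And>t z. z \<in> strip \<Longrightarrow> ((\<lambda>t. B t z) has_vector_derivative
        damping \<kappa> k t z * B t z - \<i> * of_real (\<alpha> * k) * A t z) (at t)"
proof (cases "k = 0")
  case True
  define B where "B t z = exp (of_real (t - T) * (of_real \<kappa> * z\<^sup>2)) * y" for t :: real and z :: complex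
  show ?thesis
  proof (rule that[of "\<lambda>t z. x" B])
    show "B t holomorphic_on strip" for t unfolding B_def by (intro holomorphic_intros)
    show "((\<lambda>t. B t z) has_vector_derivative damping \<kappa> k t z * B t z - \<i> * of_real (\<alpha> * k) * x) (at t)" for t z
    proof -
      let ?e = "\<lambda>w. exp ((w - of_real T) * (of_real \<kappa> * z\<^sup>2)) * y"
      have "(?e has_field_derivative (of_real \<kappa> * z\<^sup>2) * ?e (of_real t)) (at (of_real t))"
        by (auto intro!: derivative_eq_intros)
      then have "((\<lambda>t. ?e (of_real t)) has_vector_derivative (of_real \<kappa> * z\<^sup>2) * ?e (of_real t)) (at t)"
        by (rule has_vector_derivative_real_field)
      then show ?thesis using True by (simp add: B_def damping_def)
    qed
  qed (use True in \<open>auto simp: B_def\<close>)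
next
  case False
  define r where "r = (\<lambda>z. - damping \<kappa> k 0 z / of_int k)"
  define p where "p = \<i> * of_real \<alpha>"
  have r: "r holomorphic_on strip" unfolding r_def using False by (intro holomorphic_intros holomorphic_damping) auto
  obtain a1 b1 where ab1:
    "\<And>z. z \<in> strip \<Longrightarrow> (a1 has_field_derivative p * b1 z) (at z)"
    "\<And>z. z \<in> strip \<Longrightarrow> (b1 has_field_derivative r z * b1 z + p * a1 z) (at z)"
    "a1 0 = 1" "b1 0 = 0" using linear_ode_on_strip[OF r] by metis
  obtain a2 b2 where ab2:
    "\<And>z. z \<in> strip \<Longrightarrow> (a2 has_field_derivative p * b2 z) (at z)"
    "\<And>z. z \<in> strip \<Longrightarrow> (b2 has_field_derivative r z * b2 z + p * a2 z) (at z)"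
    "a2 0 = 0" "b2 0 = 1" using linear_ode_on_strip[OF r] by metis
  have z0: "0 \<in> strip" by (simp add: strip_def)
  \<comment> \<open>The Wronskian of the two solutions. By Abel's identity D' = r D, so D is an
    exponential and the solutions are independent everywhere on the strip.\<close>
  define D where "D z = a1 z * b2 z - a2 z * b1 z" for z
  have dD: "(D has_field_derivative r z * D z) (at z)" if "z \<in> strip" for z
    unfolding D_def by (rule derivative_eq_intros ab1(1,2) ab2(1,2) that refl)+ (simp add: algebra_simps)
  define E where "E z = D z * exp (- strip_primitive r z)" for z
  have dE: "(E has_field_derivative 0) (at z)" if "z \<in> strip" for z
    unfolding E_def by (rule derivative_eq_intros dD strip_primitive(1)[OF r] that refl)+ (simp add: algebra_simps)
  have "\<exists>c. \<forall>z\<in>strip. E z = c"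
    using dE by (intro has_field_derivative_zero_constant convex_strip) (auto intro: has_field_derivative_at_within)
  then have "E z = E 0" if "z \<in> strip" for z using that z0 by metis
  moreover have "E 0 = 1" by (simp add: E_def D_def ab1 ab2 strip_primitive(2)[OF r])
  ultimately have "D z * exp (- strip_primitive r z) = 1" if "z \<in> strip" for z
    using that by (metis E_def)
  then have D: "D z \<noteq> 0" if "z \<in> strip" for z using that by (metis mult_zero_left zero_neq_one)
  have hol: "a1 holomorphic_on strip" "b1 holomorphic_on strip" "a2 holomorphic_on strip" "b2 holomorphic_on strip"
    unfolding holomorphic_on_open[OF open_strip] using ab1(1,2) ab2(1,2) by blast+
  have holt: "(\<lambda>z. g (z - of_int k * of_real t)) holomorphic_on strip" if g: "g holomorphic_on strip" for g t
  proof -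
    have "(g \<circ> (\<lambda>z. z - of_int k * of_real t)) holomorphic_on strip"
      by (rule holomorphic_on_compose_gen[OF _ g]) (auto intro!: holomorphic_intros simp: strip_def)
    then show ?thesis by (simp add: o_def)
  qed
  have st: "z - of_int k * of_real t \<in> strip" if "z \<in> strip" for z t using that by (simp add: strip_def)
  \<comment> \<open>Cramer's rule: with these coefficients, evaluated at z - kT, the combination
    takes the constant values x and y at time T.\<close>
  define u where "u z = (x * b2 z - y * a2 z) / D z" for z
  define v where "v z = (a1 z * y - b1 z * x) / D z" for z
  have holuv: "u holomorphic_on strip" "v holomorphic_on strip"
    unfolding u_def v_def using D unfolding D_def by (auto intro!: holomorphic_intros hol)
  have uv: "u z * a1 z + v z * a2 z = x" "u z * b1 z + v z * b2 z = y" if "z \<in> strip" for z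
  proof -
    have "u z * a1 z + v z * a2 z = x * D z / D z" "u z * b1 z + v z * b2 z = y * D z / D z"
      unfolding u_def v_def times_divide_eq_left add_divide_distrib[symmetric] by (simp_all add: D_def algebra_simps)
    then show "u z * a1 z + v z * a2 z = x" "u z * b1 z + v z * b2 z = y" using D[OF that] by auto
  qed
  define tr where "tr t z = z - of_int k * of_real t" for t :: real and z :: complex
  define A where "A t z = u (tr T z) * a1 (tr t z) + v (tr T z) * a2 (tr t z)" for t z
  define B where "B t z = u (tr T z) * b1 (tr t z) + v (tr T z) * b2 (tr t z)" for t z
  have chain: "((\<lambda>t. g (tr t z)) has_vector_derivative - of_int k * g') (at t)"
    if "(g has_field_derivative g') (at (tr t z))" for g g' t z
  proof -
    have "((\<lambda>t. tr t z) has_vector_derivative - of_int k) (at t)"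
      unfolding tr_def by (auto intro!: derivative_eq_intros)
    from field_vector_diff_chain_at[OF this that] show ?thesis by (simp add: o_def)
  qed
  have damp: "damping \<kappa> k t z = - of_int k * r (tr t z)" for t z
    using False by (simp add: damping_def r_def tr_def)
  show ?thesis
  proof (rule that[of A B])
    show "A t holomorphic_on strip" "B t holomorphic_on strip" for t
      unfolding A_def B_def tr_def by (intro holomorphic_intros holt hol holuv)+
    show "A T z = x" "B T z = y" if "z \<in> strip" for z
      using uv[OF st[OF that]] by (simp_all add: A_def B_def tr_def)
    fix t z assume z: "z \<in> strip"
    then have z': "tr t z \<in> strip" using st by (simp add: tr_def)
    have "((\<lambda>t. A t z) has_vector_derivative
       u (tr T z) * (- of_int k * (p * b1 (tr t z))) + v (tr T z) * (- of_int k * (p * b2 (tr t z)))) (at t)"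
      unfolding A_def by (intro has_vector_derivative_add has_vector_derivative_mult_right chain ab1 ab2 z')
    then show "((\<lambda>t. A t z) has_vector_derivative - (\<i> * of_real (\<alpha> * k) * B t z)) (at t)"
      by (rule has_vector_derivative_eq_rhs) (simp add: B_def p_def algebra_simps)
    have "((\<lambda>t. B t z) has_vector_derivative
       u (tr T z) * (- of_int k * (r (tr t z) * b1 (tr t z) + p * a1 (tr t z)))
       + v (tr T z) * (- of_int k * (r (tr t z) * b2 (tr t z) + p * a2 (tr t z)))) (at t)"
      unfolding B_def by (intro has_vector_derivative_add has_vector_derivative_mult_right chain ab1 ab2 z')
    then show "((\<lambda>t. B t z) has_vector_derivative damping \<kappa> k t z * B t z - \<i> * of_real (\<alpha> * k) * A t z) (at t)"
      by (rule has_vector_derivative_eq_rhs) (simp add: damp A_def B_def p_def algebra_simps)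
  qed
qed

section \<open>Energy of the adjoint system\<close>

lemma energy_derivative:
  fixes A B :: "real \<Rightarrow> complex" and \<beta> :: real
  assumes "(A has_vector_derivative - (\<i> * of_real \<beta> * B t)) (at t)"
    "(B has_vector_derivative c * B t - \<i> * of_real \<beta> * A t) (at t)"
  shows "((\<lambda>t. (cmod (A t))\<^sup>2 + (cmod (B t))\<^sup>2) has_real_derivative 2 * Re c * (cmod (B t))\<^sup>2) (at t)"
proof -
  have A: "((\<lambda>t. Re (A t)) has_real_derivative \<beta> * Im (B t)) (at t)"
          "((\<lambda>t. Im (A t)) has_real_derivative - \<beta> * Re (B t)) (at t)"
    using assms(1) by (simp_all add: has_vector_derivative_complex_iff)
  have B: "((\<lambda>t. Re (B t)) has_real_derivative Re c * Re (B t) - Im c * Im (B t) + \<beta> * Im (A t)) (at t)"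
          "((\<lambda>t. Im (B t)) has_real_derivative Re c * Im (B t) + Im c * Re (B t) - \<beta> * Re (A t)) (at t)"
    using assms(2) by (simp_all add: has_vector_derivative_complex_iff)
  show ?thesis unfolding cmod_power2
    by (rule derivative_eq_intros A B refl)+ (simp add: algebra_simps power2_eq_square)
qed

text \<open>Gronwall with the crude lower bound of the real part. It covers the whole strip, where
  only boundedness matters; the sharp constant at real frequencies comes from
  \<open>bounded_growth\<close>.\<close>

lemma backward_energy_bound:
  fixes A B :: "real \<Rightarrow> complex" and \<beta> :: real
  assumes "\<And>t. (A has_vector_derivative - (\<i> * of_real \<beta> * B t)) (at t)"
    "\<And>t. (B has_vector_derivative c t * B t - \<i> * of_real \<beta> * A t) (at t)"
    and c: "\<And>t. Re (c t) \<ge> - K" and "K \<ge> 0" "t \<in> {0..T}"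
  shows "(cmod (A t))\<^sup>2 + (cmod (B t))\<^sup>2 \<le> exp (2 * K * T) * ((cmod (A T))\<^sup>2 + (cmod (B T))\<^sup>2)"
proof -
  define N where "N t = (cmod (A t))\<^sup>2 + (cmod (B t))\<^sup>2" for t
  have N: "(N has_real_derivative 2 * Re (c t) * (cmod (B t))\<^sup>2) (at t)" for t
    unfolding N_def by (rule energy_derivative[OF assms(1,2)])
  have "N t * exp (2 * K * t) \<le> N T * exp (2 * K * T)"
  proof (rule DERIV_nonneg_imp_nondecreasing[where f="\<lambda>t. N t * exp (2 * K * t)"])
    fix s
    have "((\<lambda>t. N t * exp (2 * K * t)) has_real_derivative
       exp (2 * K * s) * (2 * Re (c s) * (cmod (B s))\<^sup>2 + 2 * K * N s)) (at s)"
      by (rule derivative_eq_intros N refl)+ (simp add: algebra_simps)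
    moreover have "0 \<le> 2 * Re (c s) * (cmod (B s))\<^sup>2 + 2 * K * N s"
    proof -
      have "- K * (cmod (B s))\<^sup>2 \<le> Re (c s) * (cmod (B s))\<^sup>2" using c by (intro mult_right_mono) auto
      moreover have "K * (cmod (B s))\<^sup>2 \<le> K * N s" using assms(4) by (intro mult_left_mono) (auto simp: N_def)
      ultimately show ?thesis by linarith
    qed
    ultimately show "\<exists>y. ((\<lambda>t. N t * exp (2 * K * t)) has_real_derivative y) (at s) \<and> 0 \<le> y"
      by (meson exp_ge_zero mult_nonneg_nonneg)
  qed (use assms in auto)
  moreover have "N t \<le> N t * exp (2 * K * t)"
    using mult_left_mono[of 1 "exp (2 * K * t)" "N t"] assms(4,5) by (simp add: N_def)
  ultimately show ?thesis by (simp add: N_def mult.commute)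
qed

section \<open>Growth of the adjoint system\<close>

text \<open>The tangent of ln at 2, together with ln 2 < 1.\<close>

lemma two_ln_le: assumes "(x::real) > 0" shows "2 * ln x \<le> x"
proof -
  have "ln (x / 2) \<le> x / 2 - 1" using assms by (intro ln_le_minus_one) auto
  moreover have "ln (x / 2) = ln x - ln 2" using assms by (simp add: ln_div)
  moreover have "ln (2::real) < 1" using ln_2_less_1 by simp
  ultimately show ?thesis by linarith
qed

lemma ln_one_plus_lower: assumes "(x::real) \<ge> 0" shows "x / (1 + x) \<le> ln (1 + x)"
proof -
  have "ln (inverse (1 + x)) \<le> inverse (1 + x) - 1" using assms by (intro ln_le_minus_one) auto
  moreover have "ln (inverse (1 + x)) = - ln (1 + x)" using assms by (simp add: ln_inverse)
  moreover have "1 - inverse (1 + x) = x / (1 + x)" using assms by (simp add: field_simps)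
  ultimately show ?thesis by linarith
qed

text \<open>For nonzero k and \<xi> - kt = -k\<tau>, minus \<open>damping\<close> is this expression
  with \<kappa> k^2 in place of \<kappa>, so k^2 = 1 is the worst case.\<close>

definition growth_rate :: "real \<Rightarrow> real \<Rightarrow> real" where
  "growth_rate \<kappa> \<tau> = 2 * \<tau> / (1 + \<tau>\<^sup>2) - \<kappa> * (1 + \<tau>\<^sup>2)"

definition growth_primitive :: "real \<Rightarrow> real \<Rightarrow> real" where
  "growth_primitive \<kappa> \<tau> = ln (1 + \<tau>\<^sup>2) - \<kappa> * (\<tau> + \<tau> ^ 3 / 3)"

lemma growth_primitive_deriv:
  "(growth_primitive \<kappa> has_real_derivative growth_rate \<kappa> \<tau>) (at \<tau>)"
proof -
  have pos: "1 + \<tau>\<^sup>2 > 0" by (simp add: add_pos_nonneg)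
  show ?thesis unfolding growth_primitive_def growth_rate_def
    by (rule derivative_eq_intros refl pos | simp)+
qed

lemma growth_rate_nonneg_iff:
  "0 \<le> growth_rate \<kappa> \<tau> \<longleftrightarrow> \<kappa> * (1 + \<tau>\<^sup>2)\<^sup>2 \<le> 2 * \<tau>"
proof -
  have pos: "1 + \<tau>\<^sup>2 > 0" by (simp add: add_pos_nonneg)
  then have "0 \<le> growth_rate \<kappa> \<tau> \<longleftrightarrow> \<kappa> * (1 + \<tau>\<^sup>2) \<le> 2 * \<tau> / (1 + \<tau>\<^sup>2)"
    by (simp add: growth_rate_def)
  also have "\<dots> \<longleftrightarrow> \<kappa> * (1 + \<tau>\<^sup>2)\<^sup>2 \<le> 2 * \<tau>"
    using pos by (simp add: pos_le_divide_eq power2_eq_square mult.assoc)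
  finally show ?thesis .
qed

text \<open>After multiplication by 1 + \<tau>^2 the condition describes a sublevel set of the
  convex quartic \<kappa> (1 + \<tau>^2)^2 - 2\<tau>. Convexity is what confines growth to a single
  interval.\<close>

lemma convex_growth_region:
  assumes "\<kappa> > 0" shows "convex {\<tau>. 0 \<le> growth_rate \<kappa> \<tau>}"
proof -
  define f where "f \<tau> = \<kappa> * (1 + \<tau>\<^sup>2)\<^sup>2 - 2 * \<tau>" for \<tau> :: real
  have "convex_on UNIV f"
  proof (rule f''_ge0_imp_convex)
    show "convex (UNIV :: real set)" by simp
    fix x :: real
    show "(f has_real_derivative (\<kappa> * (4 * x * (1 + x\<^sup>2)) - 2)) (at x)"
      unfolding f_def by (auto intro!: derivative_eq_intros)
    show "((\<lambda>x. \<kappa> * (4 * x * (1 + x\<^sup>2)) - 2) has_real_derivative (\<kappa> * (4 + 12 * x\<^sup>2))) (at x)"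
      by (auto intro!: derivative_eq_intros simp: algebra_simps power2_eq_square)
    show "\<kappa> * (4 + 12 * x\<^sup>2) \<ge> 0" using assms by simp
  qed
  then have "convex {x \<in> UNIV. f x \<le> 0}"
  proof (intro convexI)
    fix x y u v :: real
    assume x: "x \<in> {x \<in> UNIV. f x \<le> 0}" "y \<in> {x \<in> UNIV. f x \<le> 0}" and uv: "0 \<le> u" "0 \<le> v" "u + v = 1"
    have "f (u *\<^sub>R x + v *\<^sub>R y) \<le> u * f x + v * f y"
      using \<open>convex_on UNIV f\<close> uv unfolding convex_on_def by blast
    also have "\<dots> \<le> 0" using x uv by (intro add_nonpos_nonpos mult_nonneg_nonpos) auto
    finally show "u *\<^sub>R x + v *\<^sub>R y \<in> {x \<in> UNIV. f x \<le> 0}" by simp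
  qed
  moreover have "{x \<in> UNIV. f x \<le> 0} = {\<tau>. 0 \<le> growth_rate \<kappa> \<tau>}"
    by (auto simp: growth_rate_nonneg_iff f_def)
  ultimately show ?thesis by simp
qed

text \<open>The natural scale is m = \<kappa>^(-1/3), where \<kappa> m^3 = 1. The logarithmic and
  cubic terms at \<open>b\<close> amount to at most ln(1 + m^2). Those at \<open>a\<close>
  contribute nothing positive, because a nonnegative rate at \<open>a\<close> bounds \<kappa> a^3 /
  3 by ln(1 + a^2). The linear terms have the right sign since a \<le> b.\<close>

lemma growth_primitive_increment:
  assumes "\<kappa> > 0" "a \<le> b" "0 \<le> growth_rate \<kappa> a"
  shows "growth_primitive \<kappa> b - growth_primitive \<kappa> a \<le> ln (1 + \<kappa> powr (-2/3))"
proof -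
  define m where "m = \<kappa> powr (-1/3)"
  have m: "m > 0" using assms by (simp add: m_def)
  have m2: "m\<^sup>2 = \<kappa> powr (-2/3)" using assms by (simp add: m_def powr_power)
  have "m ^ 3 = \<kappa> powr - 1" using assms unfolding m_def by (subst powr_power) auto
  then have m3: "\<kappa> * m ^ 3 = 1" using assms by (simp add: powr_minus)
  have ka: "\<kappa> * (1 + a\<^sup>2)\<^sup>2 \<le> 2 * a" using assms(3) growth_rate_nonneg_iff by blast
  have "0 \<le> \<kappa> * (1 + a\<^sup>2)\<^sup>2" using assms(1) by simp
  then have a: "a \<ge> 0" using ka by linarith
  have b: "b \<ge> 0" using a assms by linarith
  have split: "growth_primitive \<kappa> b - growth_primitive \<kappa> a =
      (ln (1 + b\<^sup>2) - \<kappa> * b ^ 3 / 3) - \<kappa> * (b - a) + (\<kappa> * a ^ 3 / 3 - ln (1 + a\<^sup>2))"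
    by (simp add: growth_primitive_def algebra_simps)
  have 1: "\<kappa> * (b - a) \<ge> 0" using assms by simp
  have 2: "\<kappa> * a ^ 3 / 3 \<le> ln (1 + a\<^sup>2)"
  proof -
    define q where "q = 1 + a\<^sup>2"
    have q: "q \<ge> 1" "q > 0" by (auto simp: q_def add_pos_nonneg)
    have "a\<^sup>2 \<le> q" by (simp add: q_def)
    \<comment> \<open>The rate condition at \<open>a\<close> is multiplied by a^3; then one factor
      a^2 is bounded by q and a power of q cancels.\<close>
    have "\<kappa> * a ^ 3 * q * q \<le> 2 * a * a ^ 3"
      using mult_right_mono[OF ka, of "a ^ 3"] a by (simp add: q_def power2_eq_square algebra_simps)
    also have "\<dots> = 2 * a\<^sup>2 * a\<^sup>2" by (simp add: power2_eq_square power3_eq_cube)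
    also have "\<dots> \<le> 2 * a\<^sup>2 * q" using \<open>a\<^sup>2 \<le> q\<close> by (intro mult_left_mono) auto
    finally have "\<kappa> * a ^ 3 * q \<le> 2 * a\<^sup>2" using q by simp
    moreover have "\<kappa> * a ^ 3 / 3 * q = \<kappa> * a ^ 3 * q / 3" by simp
    ultimately have "\<kappa> * a ^ 3 / 3 * q \<le> a\<^sup>2" using zero_le_power2[of a] by linarith
    then have "\<kappa> * a ^ 3 / 3 \<le> a\<^sup>2 / q" using q by (simp add: pos_le_divide_eq)
    also have "a\<^sup>2 / q \<le> ln (1 + a\<^sup>2)" using ln_one_plus_lower[of "a\<^sup>2"] by (simp add: q_def)
    finally show ?thesis .
  qed
  have 3: "ln (1 + b\<^sup>2) - \<kappa> * b ^ 3 / 3 \<le> ln (1 + m\<^sup>2)"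
  proof (cases "b \<le> m")
    case True
    then have "ln (1 + b\<^sup>2) \<le> ln (1 + m\<^sup>2)" using b by (simp add: add_pos_nonneg power_mono)
    moreover have "0 \<le> \<kappa> * b ^ 3 / 3" using assms b by simp
    ultimately show ?thesis by linarith
  next
    case False
    \<comment> \<open>Beyond m the logarithm gains at most 2 ln \<beta>, and the cubic term
      \<beta>^3 / 3 absorbs this, by \<open>two_ln_le\<close> at \<beta>^3.\<close>
    define \<beta> where "\<beta> = b / m"
    have \<beta>: "\<beta> > 1" and bm: "b = m * \<beta>" using False m by (auto simp: \<beta>_def)
    have "1 + b\<^sup>2 \<le> (1 + m\<^sup>2) * \<beta>\<^sup>2"
      using \<beta> by (simp add: bm power_mult_distrib distrib_right)
    then have "ln (1 + b\<^sup>2) \<le> ln ((1 + m\<^sup>2) * \<beta>\<^sup>2)"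
      by (intro ln_mono) (auto simp: add_pos_nonneg)
    also have "\<dots> = ln (1 + m\<^sup>2) + 2 * ln \<beta>"
      using \<beta> by (subst ln_mult) (auto simp: add_pos_nonneg ln_realpow zero_less_mult_iff add_nonneg_eq_0_iff)
    finally have "ln (1 + b\<^sup>2) \<le> ln (1 + m\<^sup>2) + 2 * ln \<beta>" .
    moreover have "2 * ln (\<beta> ^ 3) \<le> \<beta> ^ 3" using \<beta> by (intro two_ln_le) auto
    then have "2 * (3 * ln \<beta>) \<le> \<beta> ^ 3" using \<beta> by (simp add: ln_realpow)
    moreover have "\<kappa> * b ^ 3 = \<beta> ^ 3"
      using m3 by (simp add: bm power_mult_distrib flip: mult.assoc)
    ultimately show ?thesis by linarith
  qed
  show ?thesis unfolding split m2[symmetric] using 1 2 3 by linarith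
qed

text \<open>Outside the interval where the rate is nonnegative, \<open>n\<close> is nondecreasing.
  On it, with F the primitive of the rate, n exp(2F) is nondecreasing. Hence \<open>n\<close> can
  drop at most by the factor exp(2 (F q - F p)), the square of the bound from
  \<open>growth_primitive_increment\<close>.\<close>

lemma bounded_growth:
  fixes n r h :: "real \<Rightarrow> real"
  assumes \<kappa>: "\<kappa> > 0" and le: "\<tau>0 \<le> \<tau>1"
    and deriv: "\<And>\<tau>. \<tau> \<in> {\<tau>0..\<tau>1} \<Longrightarrow> (n has_real_derivative (- 2 * h \<tau> * r \<tau>)) (at \<tau>)"
    and r: "\<And>\<tau>. \<tau> \<in> {\<tau>0..\<tau>1} \<Longrightarrow> 0 \<le> r \<tau> \<and> r \<tau> \<le> n \<tau>"
    and h: "\<And>\<tau>. \<tau> \<in> {\<tau>0..\<tau>1} \<Longrightarrow> h \<tau> \<le> growth_rate \<kappa> \<tau>"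
  shows "n \<tau>0 \<le> (1 + \<kappa> powr (-2/3))\<^sup>2 * n \<tau>1"
proof -
  define M where "M = 1 + \<kappa> powr (-2/3)"
  have M: "M \<ge> 1" by (simp add: M_def)
  have cont: "continuous_on {x..y} n" if "\<tau>0 \<le> x" "y \<le> \<tau>1" for x y
    using deriv that by (intro continuous_at_imp_continuous_on ballI) (meson DERIV_isCont atLeastAtMost_iff order_trans)
  have mono: "n x \<le> n y" if xy: "\<tau>0 \<le> x" "x \<le> y" "y \<le> \<tau>1"
      and neg: "\<And>\<tau>. x < \<tau> \<Longrightarrow> \<tau> < y \<Longrightarrow> growth_rate \<kappa> \<tau> \<le> 0" for x y
  proof (rule DERIV_nonneg_imp_increasing_open[OF \<open>x \<le> y\<close>])
    fix \<tau> assume \<tau>: "x < \<tau>" "\<tau> < y"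
    then have \<tau>': "\<tau> \<in> {\<tau>0..\<tau>1}" using xy by auto
    have "h \<tau> \<le> 0" using h[OF \<tau>'] neg[OF \<tau>] by linarith
    then have "- 2 * h \<tau> * r \<tau> \<ge> 0" using r[OF \<tau>'] by (simp add: mult_nonpos_nonneg)
    then show "\<exists>d. (n has_real_derivative d) (at \<tau>) \<and> 0 \<le> d" using deriv[OF \<tau>'] by blast
  qed (use cont xy in auto)
  define S where "S = {\<tau>0..\<tau>1} \<inter> {\<tau>. 0 \<le> growth_rate \<kappa> \<tau>}"
  show ?thesis
  proof (cases "S = {}")
    case True
    then have "growth_rate \<kappa> \<tau> \<le> 0" if "\<tau>0 < \<tau>" "\<tau> < \<tau>1" for \<tau>
      using that unfolding S_def by (metis (mono_tags, lifting) Int_iff atLeastAtMost_iff empty_iff less_imp_le linear mem_Collect_eq)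
    then have "n \<tau>0 \<le> n \<tau>1" using le by (intro mono) auto
    also have "n \<tau>1 \<le> M\<^sup>2 * n \<tau>1"
      using M r[of \<tau>1] le by (simp add: mult_le_cancel_right1)
    finally show ?thesis by (simp add: M_def)
  next
    case False
    have "continuous_on UNIV (growth_rate \<kappa>)" unfolding growth_rate_def
      by (intro continuous_intros) (auto simp: add_nonneg_eq_0_iff)
    then have "closed {\<tau>. 0 \<le> growth_rate \<kappa> \<tau>}"
      using closed_Collect_le[of "\<lambda>_. 0" "growth_rate \<kappa>"] by simp
    then have S: "compact S" unfolding S_def by (intro compact_Int_closed) auto
    obtain p where p: "p \<in> S" "\<And>x. x \<in> S \<Longrightarrow> p \<le> x" using compact_attains_inf[OF S False] by blast
    obtain q where q: "q \<in> S" "\<And>x. x \<in> S \<Longrightarrow> x \<le> q" using compact_attains_sup[OF S False] by blast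
    have pq: "p \<le> q" using p q by blast
    have "convex S" unfolding S_def using convex_growth_region[OF \<kappa>] by (intro convex_Int) auto
    then have "is_interval S" by (simp add: is_interval_convex_1)
    then have inS: "\<tau> \<in> S" if "p \<le> \<tau>" "\<tau> \<le> q" for \<tau>
      using p(1) q(1) that unfolding is_interval_1 by blast
    have A: "n \<tau>0 \<le> n p"
    proof (rule mono)
      fix \<tau> assume "\<tau>0 < \<tau>" "\<tau> < p"
      then have "\<tau> \<notin> S" "\<tau> \<in> {\<tau>0..\<tau>1}" using p(1) p(2)[of \<tau>] by (auto simp: S_def)
      then show "growth_rate \<kappa> \<tau> \<le> 0" by (simp add: S_def)
    qed (use p S_def in auto)
    have C: "n q \<le> n \<tau>1"
    proof (rule mono)
      fix \<tau> assume "q < \<tau>" "\<tau> < \<tau>1"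
      then have "\<tau> \<notin> S" "\<tau> \<in> {\<tau>0..\<tau>1}" using q(1) q(2)[of \<tau>] by (auto simp: S_def)
      then show "growth_rate \<kappa> \<tau> \<le> 0" by (simp add: S_def)
    qed (use q S_def in auto)
    define F where "F = growth_primitive \<kappa>"
    have B: "n p * exp (2 * F p) \<le> n q * exp (2 * F q)"
    proof (rule DERIV_nonneg_imp_nondecreasing[OF pq])
      fix \<tau> assume "p \<le> \<tau>" "\<tau> \<le> q"
      then have \<tau>: "\<tau> \<in> {\<tau>0..\<tau>1}" "0 \<le> growth_rate \<kappa> \<tau>" using inS by (auto simp: S_def)
      have "((\<lambda>\<tau>. n \<tau> * exp (2 * F \<tau>)) has_real_derivative
          exp (2 * F \<tau>) * (- 2 * h \<tau> * r \<tau> + 2 * growth_rate \<kappa> \<tau> * n \<tau>)) (at \<tau>)"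
        unfolding F_def by (auto intro!: derivative_eq_intros deriv[OF \<tau>(1)] growth_primitive_deriv simp: algebra_simps)
      \<comment> \<open>Nonnegativity of the rate is what makes this product estimate valid also
        where h is negative.\<close>
      moreover have "h \<tau> * r \<tau> \<le> growth_rate \<kappa> \<tau> * n \<tau>"
        using \<tau>(2) r[OF \<tau>(1)] h[OF \<tau>(1)] by (intro mult_mono) auto
      then have "0 \<le> exp (2 * F \<tau>) * (- 2 * h \<tau> * r \<tau> + 2 * growth_rate \<kappa> \<tau> * n \<tau>)"
        by (intro mult_nonneg_nonneg) auto
      ultimately show "\<exists>y. ((\<lambda>\<tau>. n \<tau> * exp (2 * F \<tau>)) has_real_derivative y) (at \<tau>) \<and> 0 \<le> y" by blast
    qed
    have "F q - F p \<le> ln M" unfolding F_def M_def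
      using p(1) by (intro growth_primitive_increment \<kappa> pq) (auto simp: S_def)
    then have "exp (2 * F q - 2 * F p) \<le> exp (2 * ln M)" by simp
    also have "\<dots> = M\<^sup>2" using M by (simp add: exp_double)
    finally have E: "exp (2 * F q - 2 * F p) \<le> M\<^sup>2" .
    have nq: "0 \<le> n q" using r[of q] q(1) by (auto simp: S_def)
    have "n p = n p * exp (2 * F p) * exp (- 2 * F p)" by (simp add: exp_minus)
    also have "\<dots> \<le> n q * exp (2 * F q) * exp (- 2 * F p)" using B by (intro mult_right_mono) auto
    also have "\<dots> = n q * exp (2 * F q - 2 * F p)" by (simp add: exp_diff exp_minus divide_inverse)
    also have "\<dots> \<le> n q * M\<^sup>2" using E nq by (intro mult_left_mono) auto
    also have "\<dots> \<le> n \<tau>1 * M\<^sup>2" using C by (intro mult_right_mono) auto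
    finally show ?thesis using A by (simp add: M_def mult.commute)
  qed
qed

section \<open>Duality for curves of distributions on the line\<close>

definition line_linear :: "((real \<Rightarrow> complex) \<Rightarrow> complex) \<Rightarrow> bool" where
  "line_linear U \<longleftrightarrow>
    (\<forall>f g. schwartz_line f \<longrightarrow> schwartz_line g \<longrightarrow> U (\<lambda>x. f x + g x) = U f + U g) \<and>
    (\<forall>c f. schwartz_line f \<longrightarrow> U (\<lambda>x. c * f x) = c * U f)"

lemma line_linear_add: "line_linear U \<Longrightarrow> schwartz_line f \<Longrightarrow> schwartz_line g \<Longrightarrow> U (\<lambda>x. f x + g x) = U f + U g"
  and line_linear_cmult: "line_linear U \<Longrightarrow> schwartz_line f \<Longrightarrow> U (\<lambda>x. c * f x) = c * U f"
  by (auto simp: line_linear_def)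

lemma line_linear_diff: "line_linear U \<Longrightarrow> schwartz_line f \<Longrightarrow> schwartz_line g \<Longrightarrow> U (\<lambda>x. f x - g x) = U f - U g"
  using line_linear_add[of U f "\<lambda>x. (-1) * g x"] line_linear_cmult[of U g "-1"] schwartz_line_cmult[of g "-1"] by simp

text \<open>What a continuous tempered curve becomes on a single mode: one order N and one constant
  serve all of [0, T].\<close>

definition line_curve :: "real \<Rightarrow> (real \<Rightarrow> (real \<Rightarrow> complex) \<Rightarrow> complex) \<Rightarrow> bool" where
  "line_curve T U \<longleftrightarrow> (\<forall>t\<in>{0..T}. line_linear (U t)) \<and>
    (\<exists>N C. 0 \<le> C \<and> (\<forall>t\<in>{0..T}. \<forall>f K. schwartz_line f \<longrightarrow> line_bound N f K \<longrightarrow> cmod (U t f) \<le> C * K)) \<and>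
    (\<forall>f. schwartz_line f \<longrightarrow> continuous_on {0..T} (\<lambda>t. U t f))"

text \<open>\<open>g'\<close> is the time derivative of \<open>g\<close> in the Schwartz topology,
  expressed by a quadratic remainder that is uniform on [0, T] in every seminorm.\<close>

definition test_curve :: "real \<Rightarrow> (real \<Rightarrow> real \<Rightarrow> complex) \<Rightarrow> (real \<Rightarrow> real \<Rightarrow> complex) \<Rightarrow> bool" where
  "test_curve T g g' \<longleftrightarrow> (\<forall>t\<in>{0..T}. schwartz_line (g t) \<and> schwartz_line (g' t)) \<and>
    (\<forall>N. \<exists>C. \<forall>s\<in>{0..T}. \<forall>t\<in>{0..T}.
       line_bound N (\<lambda>x. g t x - g s x - of_real (t - s) * g' s x) (C * (t - s)\<^sup>2))"

text \<open>The first factor vanishes at s, so continuity of \<open>G\<close> suffices. It is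
  applied to the pairing with \<open>g' s\<close>, of which only continuity in t is known.\<close>

lemma linear_factor_has_vector_derivative:
  fixes G :: "real \<Rightarrow> complex"
  assumes "isCont G s"
  shows "((\<lambda>t. of_real (t - s) * G t) has_vector_derivative G s) (at s)"
  unfolding has_vector_derivative_def has_derivative_at
proof
  show "bounded_linear (\<lambda>h. h *\<^sub>R G s)" by (rule bounded_linear_scaleR_left)
  have lim: "(\<lambda>h. norm (G (s + h) - G s)) \<midarrow>0\<rightarrow> 0"
    using assms unfolding isCont_iff by (rule LIM_zero[THEN tendsto_norm_zero])
  have "norm (of_real (s + h - s) * G (s + h) - of_real (s - s) * G s - h *\<^sub>R G s) / norm h = norm (G (s + h) - G s)"
    if "h \<noteq> 0" for h
  proof -
    have "of_real (s + h - s) * G (s + h) - of_real (s - s) * G s - h *\<^sub>R G s = of_real h * (G (s + h) - G s)"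
      by (simp add: scaleR_conv_of_real algebra_simps)
    then show ?thesis using that by (simp only: norm_mult norm_of_real) simp
  qed
  then show "(\<lambda>h. norm (of_real (s + h - s) * G (s + h) - of_real (s - s) * G s - h *\<^sub>R G s) / norm h) \<midarrow>0\<rightarrow> 0"
    using lim by (simp cong: LIM_cong)
qed

lemma curve_product_remainder:
  assumes U: "line_curve T U" and g: "test_curve T g g'"
  obtains C where "0 \<le> C" "\<And>s t. s \<in> {0..T} \<Longrightarrow> t \<in> {0..T} \<Longrightarrow>
    cmod (U t (g t) - U t (g s) - of_real (t - s) * U t (g' s)) \<le> C * (t - s)\<^sup>2"
proof -
  obtain N C where C: "0 \<le> C" and b: "\<And>t f K. t \<in> {0..T} \<Longrightarrow> schwartz_line f \<Longrightarrow> line_bound N f K \<Longrightarrow> cmod (U t f) \<le> C * K"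
    using U unfolding line_curve_def by blast
  obtain D where D: "\<And>s t. s \<in> {0..T} \<Longrightarrow> t \<in> {0..T} \<Longrightarrow>
       line_bound N (\<lambda>x. g t x - g s x - of_real (t - s) * g' s x) (D * (t - s)\<^sup>2)"
    using g unfolding test_curve_def by blast
  have "cmod (U t (g t) - U t (g s) - of_real (t - s) * U t (g' s)) \<le> (C * \<bar>D\<bar>) * (t - s)\<^sup>2"
    if st: "s \<in> {0..T}" "t \<in> {0..T}" for s t
  proof -
    have sch: "schwartz_line (g s)" "schwartz_line (g t)" "schwartz_line (g' s)"
      using g st unfolding test_curve_def by auto
    have lin: "line_linear (U t)" using U st unfolding line_curve_def by blast
    have "U t (g t) - U t (g s) - of_real (t - s) * U t (g' s) = U t (\<lambda>x. g t x - g s x - of_real (t - s) * g' s x)"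
      using sch by (simp only: line_linear_diff[OF lin] line_linear_cmult[OF lin] schwartz_line_diff schwartz_line_cmult)
    also have "cmod \<dots> \<le> C * (D * (t - s)\<^sup>2)"
      by (rule b[OF st(2) _ D[OF st]]) (intro schwartz_line_diff schwartz_line_cmult sch)
    also have "\<dots> \<le> C * (\<bar>D\<bar> * (t - s)\<^sup>2)"
      using C by (intro mult_left_mono mult_right_mono) auto
    finally show ?thesis by (simp add: mult.assoc)
  qed
  then show ?thesis using that[of "C * \<bar>D\<bar>"] C by simp
qed

lemma curve_product_continuous:
  assumes U: "line_curve T U" and g: "test_curve T g g'"
  shows "continuous_on {0..T} (\<lambda>t. U t (g t))"
  unfolding continuous_on
proof
  fix s assume s: "s \<in> {0..T}"
  obtain C where C: "0 \<le> C" "\<And>t. t \<in> {0..T} \<Longrightarrow>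
    cmod (U t (g t) - U t (g s) - of_real (t - s) * U t (g' s)) \<le> C * (t - s)\<^sup>2"
    using curve_product_remainder[OF U g] s by metis
  define R where "R t = U t (g t) - U t (g s) - of_real (t - s) * U t (g' s)" for t
  have sch: "schwartz_line (g s)" "schwartz_line (g' s)" using g s unfolding test_curve_def by auto
  have c: "((\<lambda>t. U t f) \<longlongrightarrow> U s f) (at s within {0..T})" if "schwartz_line f" for f
    using U that s unfolding line_curve_def continuous_on by blast
  have "(R \<longlongrightarrow> 0) (at s within {0..T})"
  proof (rule Lim_null_comparison)
    show "\<forall>\<^sub>F t in at s within {0..T}. norm (R t) \<le> C * (t - s)\<^sup>2"
      unfolding eventually_at_filter R_def using C(2) by (auto intro!: always_eventually)
    have "((\<lambda>t. C * (t - s)\<^sup>2) \<longlongrightarrow> C * (s - s)\<^sup>2) (at s within {0..T})" by (intro tendsto_intros)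
    then show "((\<lambda>t. C * (t - s)\<^sup>2) \<longlongrightarrow> 0) (at s within {0..T})" by simp
  qed
  moreover have "((\<lambda>t. U t (g s) + of_real (t - s) * U t (g' s)) \<longlongrightarrow> U s (g s) + of_real (s - s) * U s (g' s)) (at s within {0..T})"
    by (intro tendsto_intros c sch)
  ultimately have "((\<lambda>t. R t + (U t (g s) + of_real (t - s) * U t (g' s))) \<longlongrightarrow> 0 + (U s (g s) + of_real (s - s) * U s (g' s))) (at s within {0..T})"
    by (rule tendsto_add)
  then show "((\<lambda>t. U t (g t)) \<longlongrightarrow> U s (g s)) (at s within {0..T})" by (simp add: R_def)
qed

text \<open>Product rule from U_t(g_t) = U_t(g_s) + (t - s) U_t(g'_s) + O((t - s)^2); the remainder
  is controlled because U has finite order uniformly in t.\<close>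

lemma curve_product_derivative:
  assumes U: "line_curve T U" and g: "test_curve T g g'" and s: "0 < s" "s < T"
    and d: "((\<lambda>t. U t (g s)) has_vector_derivative d) (at s)"
  shows "((\<lambda>t. U t (g t)) has_vector_derivative d + U s (g' s)) (at s)"
proof -
  have sT: "s \<in> {0..T}" using s by simp
  obtain C where C: "0 \<le> C" "\<And>t. t \<in> {0..T} \<Longrightarrow>
    cmod (U t (g t) - U t (g s) - of_real (t - s) * U t (g' s)) \<le> C * (t - s)\<^sup>2"
    using curve_product_remainder[OF U g] sT by metis
  define R where "R t = U t (g t) - U t (g s) - of_real (t - s) * U t (g' s)" for t
  have sch: "schwartz_line (g' s)" using g sT unfolding test_curve_def by auto
  have "continuous_on {0..T} (\<lambda>t. U t (g' s))" using U sch unfolding line_curve_def by blast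
  then have "isCont (\<lambda>t. U t (g' s)) s" by (rule continuous_on_interior) (simp add: s)
  then have 1: "((\<lambda>t. of_real (t - s) * U t (g' s)) has_vector_derivative U s (g' s)) (at s)"
    by (rule linear_factor_has_vector_derivative)
  have 2: "(R has_vector_derivative 0) (at s)"
  proof (rule quadratic_remainder_imp_has_vector_derivative[of "min s (T - s)"])
    fix h assume "\<bar>h\<bar> \<le> min s (T - s)"
    then have "s + h \<in> {0..T}" by auto
    then show "norm (R (s + h) - R s - h *\<^sub>R 0) \<le> C * h\<^sup>2" using C(2)[of "s + h"] by (simp add: R_def)
  qed (use s in auto)
  have "((\<lambda>t. U t (g s) + of_real (t - s) * U t (g' s) + R t) has_vector_derivative d + U s (g' s) + 0) (at s)"
    by (intro has_vector_derivative_add d 1 2)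
  then show ?thesis by (simp add: R_def)
qed

lemma translate_test_curve:
  assumes f: "schwartz_line f"
  shows "test_curve T (\<lambda>t. translate (k * t) f) (\<lambda>t x. of_real k * translate (k * t) (vd f) x)"
  unfolding test_curve_def
proof (intro conjI ballI allI)
  fix N
  define H where "H = \<bar>k\<bar> * T"
  obtain K where K: "line_bound (N + 2) f K" using schwartz_line_bound[OF f] by blast
  note s = schwartz_line_smooth[OF f]
  define D where "D = (2 * (1 + H\<^sup>2)) ^ N * ((2 * (1 + H\<^sup>2)) ^ (N + 2) * K) * k\<^sup>2"
  have "line_bound N (\<lambda>x. translate (k * t) f x - translate (k * r) f x - of_real (t - r) * (of_real k * translate (k * r) (vd f) x)) (D * (t - r)\<^sup>2)"
    if rt: "r \<in> {0..T}" "t \<in> {0..T}" for r t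
  proof -
    \<comment> \<open>The Taylor remainder is taken with the increment h and then translated by kr,
      which moves its base point to kr.\<close>
    define h where "h = k * (t - r)"
    have "\<bar>h\<bar> \<le> H" "\<bar>k * r\<bar> \<le> H"
      unfolding h_def H_def abs_mult using rt by (auto intro!: mult_left_mono)
    have "line_bound N (translate (k * r) (\<lambda>x. translate h f x - f x - of_real h * vd f x))
      ((2 * (1 + H\<^sup>2)) ^ N * ((2 * (1 + H\<^sup>2)) ^ (N + 2) * K * h\<^sup>2))"
      by (intro line_bound_translate line_bound_translate_remainder s K \<open>\<bar>h\<bar> \<le> H\<close> \<open>\<bar>k * r\<bar> \<le> H\<close>
          smooth_diff smooth_cmult smooth_translate smooth_vd)
    moreover have "translate (k * r) (\<lambda>x. translate h f x - f x - of_real h * vd f x) =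
      (\<lambda>x. translate (k * t) f x - translate (k * r) f x - of_real (t - r) * (of_real k * translate (k * r) (vd f) x))"
      by (simp add: translate_def h_def algebra_simps fun_eq_iff)
    moreover have "(2 * (1 + H\<^sup>2)) ^ N * ((2 * (1 + H\<^sup>2)) ^ (N + 2) * K * h\<^sup>2) = D * (t - r)\<^sup>2"
      by (simp add: D_def h_def power_mult_distrib mult_ac)
    ultimately show ?thesis by simp
  qed
  then show "\<exists>C. \<forall>s\<in>{0..T}. \<forall>t\<in>{0..T}. line_bound N (\<lambda>x. translate (k * t) f x - translate (k * s) f x
     - of_real (t - s) * (of_real k * translate (k * s) (vd f) x)) (C * (t - s)\<^sup>2)" by blast
qed (auto intro!: schwartz_line_translate schwartz_line_cmult schwartz_line_vd f)

lemma line_curve_translate: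
  assumes U: "line_curve T U"
  shows "line_curve T (\<lambda>t f. U t (translate (k * t) f))"
  unfolding line_curve_def
proof (intro conjI ballI allI impI)
  fix t assume t: "t \<in> {0..T}"
  then have lin: "line_linear (U t)" using U unfolding line_curve_def by blast
  have "translate h (\<lambda>x. f x + g x) = (\<lambda>x. translate h f x + translate h g x)"
    "translate h (\<lambda>x. c * f x) = (\<lambda>x. c * translate h f x)" for h f g c
    by (simp_all add: translate_def)
  then show "line_linear (\<lambda>f. U t (translate (k * t) f))"
    unfolding line_linear_def[of "\<lambda>f. U t (translate (k * t) f)"]
    by (auto simp: line_linear_add[OF lin] line_linear_cmult[OF lin] schwartz_line_translate)
next
  obtain N C where C: "0 \<le> C" and b: "\<And>t f K. t \<in> {0..T} \<Longrightarrow> schwartz_line f \<Longrightarrow> line_bound N f K \<Longrightarrow> cmod (U t f) \<le> C * K"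
    using U unfolding line_curve_def by blast
  define H where "H = \<bar>k\<bar> * T"
  have "cmod (U t (translate (k * t) f)) \<le> (C * (2 * (1 + H\<^sup>2)) ^ N) * K"
    if "t \<in> {0..T}" "schwartz_line f" "line_bound N f K" for t f K
  proof -
    have "\<bar>k * t\<bar> \<le> H" unfolding H_def abs_mult using that by (auto intro!: mult_left_mono)
    then have "line_bound N (translate (k * t) f) ((2 * (1 + H\<^sup>2)) ^ N * K)"
      by (intro line_bound_translate that schwartz_line_smooth)
    from b[OF that(1) schwartz_line_translate[OF that(2)] this] show ?thesis by (simp only: mult.assoc)
  qed
  moreover have "0 \<le> C * (2 * (1 + H\<^sup>2)) ^ N" using C by simp
  ultimately show "\<exists>N C. 0 \<le> C \<and> (\<forall>t\<in>{0..T}. \<forall>f K. schwartz_line f \<longrightarrow> line_bound N f K \<longrightarrow> cmod (U t (translate (k * t) f)) \<le> C * K)"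
    by blast
next
  fix f assume "schwartz_line f"
  then show "continuous_on {0..T} (\<lambda>t. U t (translate (k * t) f))"
    by (rule curve_product_continuous[OF U translate_test_curve])
qed

section \<open>Adjoint solutions as curves of test functions\<close>

text \<open>The time remainder is itself holomorphic in z, so a sup bound on the strip controls all
  its \<xi>-derivatives by Cauchy. No \<xi>-derivative of \<open>G\<close> has to be followed in
  time.\<close>

lemma holomorphic_test_curve:
  assumes hol: "\<And>t. t \<in> {0..T} \<Longrightarrow> G t holomorphic_on strip" "\<And>t. t \<in> {0..T} \<Longrightarrow> G' t holomorphic_on strip"
    and bnd: "\<And>t z. t \<in> {0..T} \<Longrightarrow> z \<in> strip \<Longrightarrow> cmod (G t z) \<le> K * (1 + (cmod z)\<^sup>2) ^ m"
      "\<And>t z. t \<in> {0..T} \<Longrightarrow> z \<in> strip \<Longrightarrow> cmod (G' t z) \<le> K * (1 + (cmod z)\<^sup>2) ^ m"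
    and rem: "\<And>s t z. s \<in> {0..T} \<Longrightarrow> t \<in> {0..T} \<Longrightarrow> z \<in> strip \<Longrightarrow>
       cmod (G t z - G s z - of_real (t - s) * G' s z) \<le> K * (t - s)\<^sup>2 * (1 + (cmod z)\<^sup>2) ^ m"
    and \<eta>: "schwartz_line \<eta>"
  shows "test_curve T (\<lambda>t x. G t (of_real x) * \<eta> x) (\<lambda>t x. G' t (of_real x) * \<eta> x)"
  unfolding test_curve_def
proof (intro conjI ballI allI)
  fix N
  obtain L where L: "line_bound (N + m) \<eta> L" using schwartz_line_bound[OF \<eta>] by blast
  define D where "D = 2 ^ N * (fact N * 4 ^ N * 4 ^ m * K) * L"
  have "line_bound N (\<lambda>x. G t (of_real x) * \<eta> x - G s (of_real x) * \<eta> x - of_real (t - s) * (G' s (of_real x) * \<eta> x)) (D * (t - s)\<^sup>2)"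
    if st: "s \<in> {0..T}" "t \<in> {0..T}" for s t
  proof -
    define R where "R z = G t z - G s z - of_real (t - s) * G' s z" for z
    have R: "R holomorphic_on strip" unfolding R_def by (intro holomorphic_intros hol st)
    have "cmod ((vd ^^ i) (\<lambda>x. R (of_real x)) x) \<le> (fact N * 4 ^ N * 4 ^ m * (K * (t - s)\<^sup>2)) * (1 + x\<^sup>2) ^ m"
      if "i \<le> N" for i x
      by (rule strip_derivative_bound_uniform[OF R _ that]) (unfold R_def, rule rem[OF st])
    then have "line_bound N (\<lambda>x. R (of_real x) * \<eta> x) (2 ^ N * (fact N * 4 ^ N * 4 ^ m * (K * (t - s)\<^sup>2)) * L)"
      by (rule line_bound_mult[OF smooth_of_holomorphic[OF R] schwartz_line_smooth[OF \<eta>] L])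
    moreover have "2 ^ N * (fact N * 4 ^ N * 4 ^ m * (K * (t - s)\<^sup>2)) * L = D * (t - s)\<^sup>2"
      by (simp add: D_def mult_ac)
    moreover have "(\<lambda>x. R (of_real x) * \<eta> x) =
       (\<lambda>x. G t (of_real x) * \<eta> x - G s (of_real x) * \<eta> x - of_real (t - s) * (G' s (of_real x) * \<eta> x))"
      by (simp add: R_def fun_eq_iff algebra_simps)
    ultimately show ?thesis by simp
  qed
  then show "\<exists>C. \<forall>s\<in>{0..T}. \<forall>t\<in>{0..T}. line_bound N (\<lambda>x. G t (of_real x) * \<eta> x - G s (of_real x) * \<eta> x
     - of_real (t - s) * (G' s (of_real x) * \<eta> x)) (C * (t - s)\<^sup>2)" by blast
next
  fix t assume t: "t \<in> {0..T}"
  show "schwartz_line (\<lambda>x. G t (of_real x) * \<eta> x)" "schwartz_line (\<lambda>x. G' t (of_real x) * \<eta> x)"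
    by (intro schwartz_line_tame_mult \<eta> strip_tame[of _ K m] hol bnd t; assumption)+
qed

text \<open>The equations hold for t > 0 only; continuity at the endpoints carries the conservation
  law back to the initial data.\<close>

lemma constant_on_interval:
  fixes f :: "real \<Rightarrow> complex"
  assumes "0 < T" "continuous_on {0..T} f" "\<And>s. 0 < s \<Longrightarrow> s < T \<Longrightarrow> (f has_vector_derivative 0) (at s)"
  shows "f T = f 0"
proof -
  have "norm (f T - f 0) \<le> (0 :: real) - 0"
    by (rule differentiable_bound_general[where \<phi>="\<lambda>_. 0" and \<phi>'="\<lambda>_. 0" and f'="\<lambda>_. 0"])
      (use assms in auto)
  then show ?thesis by simp
qed

text \<open>With w = 1 + |z|^2: the solutions are bounded, their time derivatives are O(w) by the
  quadratic growth of \<open>damping\<close>, and the Lipschitz constants of these are O(w^2), as a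
  second factor \<open>damping\<close> appears. This is the origin of the exponent m = 2.\<close>

lemma backward_system_test_curves:
  fixes k :: int and \<alpha> \<kappa> T :: real
  assumes \<kappa>: "\<kappa> > 0" and T: "T > 0" and \<eta>: "schwartz_line \<eta>"
    and holA: "\<And>t. A t holomorphic_on strip" and holB: "\<And>t. B t holomorphic_on strip"
    and AT: "\<And>z. z \<in> strip \<Longrightarrow> A T z = x" and BT: "\<And>z. z \<in> strip \<Longrightarrow> B T z = y"
    and dA: "\<And>t z. z \<in> strip \<Longrightarrow> ((\<lambda>t. A t z) has_vector_derivative - (\<i> * of_real (\<alpha> * k) * B t z)) (at t)"
    and dB: "\<And>t z. z \<in> strip \<Longrightarrow> ((\<lambda>t. B t z) has_vector_derivative
        damping \<kappa> k t z * B t z - \<i> * of_real (\<alpha> * k) * A t z) (at t)"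
  shows "test_curve T (\<lambda>t x. A t (of_real x) * \<eta> x) (\<lambda>t x. - (\<i> * of_real (\<alpha> * k) * B t (of_real x)) * \<eta> x)"
    "test_curve T (\<lambda>t x. B t (of_real x) * \<eta> x)
       (\<lambda>t x. (damping \<kappa> k t (of_real x) * B t (of_real x) - \<i> * of_real (\<alpha> * k) * A t (of_real x)) * \<eta> x)"
proof -
  define \<beta> where "\<beta> = \<alpha> * k"
  define K0 where "K0 = \<kappa> + 4 * \<bar>of_int k\<bar>"
  define M where "M = sqrt (exp (2 * K0 * T) * ((cmod x)\<^sup>2 + (cmod y)\<^sup>2))"
  have M0: "M \<ge> 0" by (simp add: M_def)
  have AB: "cmod (A t z) \<le> M \<and> cmod (B t z) \<le> M" if "t \<in> {0..T}" "z \<in> strip" for t z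
  proof -
    have "(cmod (A t z))\<^sup>2 + (cmod (B t z))\<^sup>2 \<le> exp (2 * K0 * T) * ((cmod (A T z))\<^sup>2 + (cmod (B T z))\<^sup>2)"
      using \<kappa> that(1) unfolding K0_def
      by (intro backward_energy_bound[OF dA[OF that(2)] dB[OF that(2)]] damping_Re_lower that(2)) auto
    then have *: "(cmod (A t z))\<^sup>2 + (cmod (B t z))\<^sup>2 \<le> exp (2 * K0 * T) * ((cmod x)\<^sup>2 + (cmod y)\<^sup>2)"
      by (simp only: AT[OF that(2)] BT[OF that(2)])
    have "(cmod (A t z))\<^sup>2 \<le> (cmod (A t z))\<^sup>2 + (cmod (B t z))\<^sup>2" "(cmod (B t z))\<^sup>2 \<le> (cmod (A t z))\<^sup>2 + (cmod (B t z))\<^sup>2"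
      by auto
    then show ?thesis unfolding M_def using * by (intro conjI real_le_rsqrt) (rule order_trans, assumption, assumption)+
  qed
  obtain K where K: "K \<ge> 0"
    "\<And>t z. t \<in> {0..T} \<Longrightarrow> z \<in> strip \<Longrightarrow> cmod (damping \<kappa> k t z) \<le> K * (1 + (cmod z)\<^sup>2)"
    "\<And>s t z. s \<in> {0..T} \<Longrightarrow> t \<in> {0..T} \<Longrightarrow> z \<in> strip \<Longrightarrow>
       cmod (damping \<kappa> k t z - damping \<kappa> k s z) \<le> K * \<bar>t - s\<bar> * (1 + (cmod z)\<^sup>2)"
    using damping_bounds[OF \<kappa> T] by metis
  define A' where "A' t z = - (\<i> * of_real \<beta> * B t z)" for t z
  define B' where "B' t z = damping \<kappa> k t z * B t z - \<i> * of_real \<beta> * A t z" for t z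
  define L1 where "L1 = (K + \<bar>\<beta>\<bar>) * M"
  define L2 where "L2 = K * M + K * L1 + \<bar>\<beta>\<bar> * L1"
  have L: "L1 \<ge> 0" "L2 \<ge> 0" using K(1) M0 by (auto simp: L1_def L2_def)
  define w where "w z = 1 + (cmod z)\<^sup>2" for z
  have w: "1 \<le> w z" "0 \<le> w z" for z by (auto simp: w_def)
  have dA': "((\<lambda>t. A t z) has_vector_derivative A' t z) (at t)" if "z \<in> strip" for t z
    using dA[OF that] by (simp add: A'_def \<beta>_def)
  have dB': "((\<lambda>t. B t z) has_vector_derivative B' t z) (at t)" if "z \<in> strip" for t z
    using dB[OF that] by (simp add: B'_def \<beta>_def)
  have A'b: "cmod (A' t z) \<le> L1 * w z" if "t \<in> {0..T}" "z \<in> strip" for t z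
  proof -
    have "cmod (A' t z) = \<bar>\<beta>\<bar> * cmod (B t z)" by (simp add: A'_def norm_mult)
    also have "\<dots> \<le> (K + \<bar>\<beta>\<bar>) * M" using AB[OF that] K(1) by (intro mult_mono) auto
    also have "\<dots> \<le> L1 * w z" using w[of z] L mult_left_mono[of 1 "w z" L1] by (simp add: L1_def)
    finally show ?thesis .
  qed
  have B'b: "cmod (B' t z) \<le> L1 * w z" if "t \<in> {0..T}" "z \<in> strip" for t z
  proof -
    have "cmod (B' t z) \<le> cmod (damping \<kappa> k t z) * cmod (B t z) + \<bar>\<beta>\<bar> * cmod (A t z)"
      unfolding B'_def using norm_triangle_ineq4[of "damping \<kappa> k t z * B t z" "\<i> * of_real \<beta> * A t z"] by (simp add: norm_mult)
    also have "\<dots> \<le> (K * w z) * M + (\<bar>\<beta>\<bar> * w z) * M"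
      using AB[OF that] K(1) K(2)[OF that] w[of z] mult_left_mono[of 1 "w z" "\<bar>\<beta>\<bar>"]
      by (intro add_mono mult_mono) (auto simp: w_def)
    finally show ?thesis by (simp add: L1_def algebra_simps)
  qed
  have seg: "closed_segment s t \<subseteq> {0..T}" if "s \<in> {0..T}" "t \<in> {0..T}" for s t
    using that by (auto simp: closed_segment_eq_real_ivl split: if_splits)
  have lipA: "cmod (A t z - A s z) \<le> L1 * w z * \<bar>t - s\<bar>" if st: "s \<in> {0..T}" "t \<in> {0..T}" "z \<in> strip" for s t z
    by (rule lipschitz_of_derivative_bound[OF dA'[OF st(3)] A'b[OF _ st(3)]]) (use seg[OF st(1,2)] in blast)
  have lipB: "cmod (B t z - B s z) \<le> L1 * w z * \<bar>t - s\<bar>" if st: "s \<in> {0..T}" "t \<in> {0..T}" "z \<in> strip" for s t z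
    by (rule lipschitz_of_derivative_bound[OF dB'[OF st(3)] B'b[OF _ st(3)]]) (use seg[OF st(1,2)] in blast)
  have ww: "w z \<le> (w z)\<^sup>2" for z using mult_left_mono[OF w(1) w(2), of z z] by (simp add: power2_eq_square)
  have lipA': "cmod (A' t z - A' s z) \<le> (L2 * (w z)\<^sup>2) * \<bar>t - s\<bar>" if st: "s \<in> {0..T}" "t \<in> {0..T}" "z \<in> strip" for s t z
  proof -
    have "A' t z - A' s z = - (\<i> * of_real \<beta>) * (B t z - B s z)" by (simp add: A'_def algebra_simps)
    then have "cmod (A' t z - A' s z) = \<bar>\<beta>\<bar> * cmod (B t z - B s z)" by (simp add: norm_mult)
    also have "\<dots> \<le> \<bar>\<beta>\<bar> * (L1 * w z * \<bar>t - s\<bar>)" by (intro mult_left_mono lipB st) auto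
    also have "\<dots> = (\<bar>\<beta>\<bar> * L1) * w z * \<bar>t - s\<bar>" by simp
    also have "\<dots> \<le> L2 * (w z)\<^sup>2 * \<bar>t - s\<bar>"
      using K(1) M0 L ww[of z] w[of z] by (intro mult_right_mono mult_mono) (auto simp: L2_def)
    finally show ?thesis .
  qed
  have lipB': "cmod (B' t z - B' s z) \<le> (L2 * (w z)\<^sup>2) * \<bar>t - s\<bar>" if st: "s \<in> {0..T}" "t \<in> {0..T}" "z \<in> strip" for s t z
  proof -
    let ?c = "\<lambda>t. damping \<kappa> k t z"
    have "B' t z - B' s z = (?c t - ?c s) * B t z + ?c s * (B t z - B s z) + (- (\<i> * of_real \<beta>)) * (A t z - A s z)"
      by (simp add: B'_def algebra_simps)
    also have "cmod \<dots> \<le> cmod ((?c t - ?c s) * B t z) + cmod (?c s * (B t z - B s z)) + cmod ((- (\<i> * of_real \<beta>)) * (A t z - A s z))"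
      by (intro order_trans[OF norm_triangle_ineq] add_mono norm_triangle_ineq order_refl)
    also have "\<dots> = cmod (?c t - ?c s) * cmod (B t z) + cmod (?c s) * cmod (B t z - B s z) + \<bar>\<beta>\<bar> * cmod (A t z - A s z)"
      by (simp add: norm_mult)
    also have "\<dots> \<le> (K * \<bar>t - s\<bar> * w z) * M + (K * w z) * (L1 * w z * \<bar>t - s\<bar>) + \<bar>\<beta>\<bar> * (L1 * w z * \<bar>t - s\<bar>)"
      using K AB st w[of z] L lipA lipB by (intro add_mono mult_mono mult_left_mono) (auto simp: w_def)
    also have "\<dots> = (K * M + \<bar>\<beta>\<bar> * L1) * w z * \<bar>t - s\<bar> + K * L1 * (w z)\<^sup>2 * \<bar>t - s\<bar>"
      by (simp add: power2_eq_square algebra_simps)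
    also have "\<dots> \<le> (K * M + \<bar>\<beta>\<bar> * L1) * (w z)\<^sup>2 * \<bar>t - s\<bar> + K * L1 * (w z)\<^sup>2 * \<bar>t - s\<bar>"
      using K(1) M0 L ww[of z] by (intro add_mono mult_right_mono mult_left_mono) auto
    also have "\<dots> = (L2 * (w z)\<^sup>2) * \<bar>t - s\<bar>" by (simp add: L2_def algebra_simps)
    finally show ?thesis .
  qed
  define C where "C = M + L1 + L2"
  have one: "1 \<le> (w z)\<^sup>2" for z using w(1)[of z] by (simp add: one_le_power)
  have bM: "u \<le> C * (1 + (cmod z)\<^sup>2) ^ 2" if "u \<le> M" for u z
  proof -
    have "M * 1 \<le> C * (w z)\<^sup>2" using M0 L one[of z] by (intro mult_mono) (auto simp: C_def)
    then show ?thesis using that by (simp add: w_def)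
  qed
  have bL: "u \<le> C * (1 + (cmod z)\<^sup>2) ^ 2" if "u \<le> L1 * w z" for u z
  proof -
    have "L1 * w z \<le> C * (w z)\<^sup>2" using M0 L ww[of z] w[of z] by (intro mult_mono) (auto simp: C_def)
    then show ?thesis using that by (simp add: w_def)
  qed
  have bR: "u \<le> C * r * (1 + (cmod z)\<^sup>2) ^ 2" if "u \<le> L2 * (w z)\<^sup>2 * r" "0 \<le> r" for u z r
  proof -
    have "L2 * (w z)\<^sup>2 * r \<le> C * (w z)\<^sup>2 * r" using M0 L that by (intro mult_right_mono) (auto simp: C_def)
    then show ?thesis using that by (simp add: w_def mult_ac)
  qed
  have holA': "A' t holomorphic_on strip" for t unfolding A'_def by (intro holomorphic_intros holB)
  have holB': "B' t holomorphic_on strip" for t unfolding B'_def by (intro holomorphic_intros holA holB holomorphic_damping)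
  have "test_curve T (\<lambda>t x. A t (of_real x) * \<eta> x) (\<lambda>t x. A' t (of_real x) * \<eta> x)"
  proof (rule holomorphic_test_curve[where K=C and m=2, OF holA holA' _ _ _ \<eta>])
    fix s t z assume st: "s \<in> {0..T}" "t \<in> {0..T}" "z \<in> strip"
    have "norm (A t z - A s z - (t - s) *\<^sub>R A' s z) \<le> (L2 * (w z)\<^sup>2) * (t - s)\<^sup>2"
      by (rule quadratic_remainder_of_lipschitz_derivative[OF dA'[OF st(3)]])
        (use lipA'[OF st(1) _ st(3)] seg[OF st(1,2)] L in auto)
    then show "cmod (A t z - A s z - of_real (t - s) * A' s z) \<le> C * (t - s)\<^sup>2 * (1 + (cmod z)\<^sup>2) ^ 2"
      by (intro bR) (simp_all add: scaleR_conv_of_real)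
  qed (use AB A'b bM bL in blast)+
  then show "test_curve T (\<lambda>t x. A t (of_real x) * \<eta> x) (\<lambda>t x. - (\<i> * of_real (\<alpha> * k) * B t (of_real x)) * \<eta> x)"
    by (simp only: A'_def \<beta>_def)
  have "test_curve T (\<lambda>t x. B t (of_real x) * \<eta> x) (\<lambda>t x. B' t (of_real x) * \<eta> x)"
  proof (rule holomorphic_test_curve[where K=C and m=2, OF holB holB' _ _ _ \<eta>])
    fix s t z assume st: "s \<in> {0..T}" "t \<in> {0..T}" "z \<in> strip"
    have "norm (B t z - B s z - (t - s) *\<^sub>R B' s z) \<le> (L2 * (w z)\<^sup>2) * (t - s)\<^sup>2"
      by (rule quadratic_remainder_of_lipschitz_derivative[OF dB'[OF st(3)]])
        (use lipB'[OF st(1) _ st(3)] seg[OF st(1,2)] L in auto)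
    then show "cmod (B t z - B s z - of_real (t - s) * B' s z) \<le> C * (t - s)\<^sup>2 * (1 + (cmod z)\<^sup>2) ^ 2"
      by (intro bR) (simp_all add: scaleR_conv_of_real)
  qed (use AB B'b bM bL in blast)+
  then show "test_curve T (\<lambda>t x. B t (of_real x) * \<eta> x)
       (\<lambda>t x. (damping \<kappa> k t (of_real x) * B t (of_real x) - \<i> * of_real (\<alpha> * k) * A t (of_real x)) * \<eta> x)"
    by (simp only: B'_def \<beta>_def)
qed

section \<open>Conservation of the pairing\<close>

lemma damping_translate: "damping \<kappa> k 0 (of_real x) = damping \<kappa> k t (of_real (x + of_int k * t))"
  by (simp add: damping_def)

text \<open>Translation by kt reduces to time 0, where \<open>damping_bounds\<close> applies
  whatever the sign of t.\<close>

lemma schwartz_line_damping_mult: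
  assumes \<kappa>: "\<kappa> > 0" and f: "schwartz_line f" shows "schwartz_line (\<lambda>x. damping \<kappa> k t (of_real x) * f x)"
proof -
  obtain K where K: "\<And>z. z \<in> strip \<Longrightarrow> cmod (damping \<kappa> k 0 z) \<le> K * (1 + (cmod z)\<^sup>2)"
    using damping_bounds[OF \<kappa> zero_less_one, of k] by (metis atLeastAtMost_iff order_refl zero_le_one)
  have 0: "schwartz_line (\<lambda>x. damping \<kappa> k 0 (of_real x) * f x)" if "schwartz_line f" for f
    by (rule schwartz_line_tame_mult[OF strip_tame[where K=K and m=1, OF holomorphic_damping] that])
      (use K in simp)
  have "schwartz_line (translate (- of_int k * t) (\<lambda>x. damping \<kappa> k 0 (of_real x) * translate (of_int k * t) f x))"
    by (intro schwartz_line_translate 0 f)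
  also have "translate (- of_int k * t) (\<lambda>x. damping \<kappa> k 0 (of_real x) * translate (of_int k * t) f x) =
      (\<lambda>x. damping \<kappa> k t (of_real x) * f x)"
    unfolding damping_translate[of \<kappa> k _ t] by (simp add: translate_def)
  finally show ?thesis .
qed

text \<open>The pair of test functions is carried by the adjoint system, so the total pairing is conserved.\<close>

lemma line_duality:
  fixes k :: int and \<alpha> \<kappa> T :: real
  assumes \<kappa>: "\<kappa> > 0" and T: "T > 0" and \<eta>: "schwartz_line \<eta>"
    and W: "line_curve T W" and J: "line_curve T J"
    and dW: "\<And>t f. 0 < t \<Longrightarrow> t < T \<Longrightarrow> schwartz_line f \<Longrightarrow> ((\<lambda>\<tau>. W \<tau> f) has_vector_derivative
        (- of_int k * W t (vd f) + \<i> * of_real (\<alpha> * k) * J t f)) (at t)"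
    and dJ: "\<And>t f. 0 < t \<Longrightarrow> t < T \<Longrightarrow> schwartz_line f \<Longrightarrow> ((\<lambda>\<tau>. J \<tau> f) has_vector_derivative
        (- of_int k * J t (vd f) + \<i> * of_real (\<alpha> * k) * W t f - J t (\<lambda>x. damping \<kappa> k 0 (of_real x) * f x))) (at t)"
    and holA: "\<And>t. A t holomorphic_on strip" and holB: "\<And>t. B t holomorphic_on strip"
    and AT: "\<And>z. z \<in> strip \<Longrightarrow> A T z = x" and BT: "\<And>z. z \<in> strip \<Longrightarrow> B T z = y"
    and dA: "\<And>t z. z \<in> strip \<Longrightarrow> ((\<lambda>t. A t z) has_vector_derivative - (\<i> * of_real (\<alpha> * k) * B t z)) (at t)"
    and dB: "\<And>t z. z \<in> strip \<Longrightarrow> ((\<lambda>t. B t z) has_vector_derivative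
        damping \<kappa> k t z * B t z - \<i> * of_real (\<alpha> * k) * A t z) (at t)"
  shows "x * W T (translate (of_int k * T) \<eta>) + y * J T (translate (of_int k * T) \<eta>) =
     W 0 (\<lambda>x. A 0 (of_real x) * \<eta> x) + J 0 (\<lambda>x. B 0 (of_real x) * \<eta> x)"
proof -
  define \<beta> where "\<beta> = \<i> * of_real (\<alpha> * k)"
  define tr where "tr t = translate (of_int k * t)" for t
  define Wm where "Wm t f = W t (tr t f)" for t f
  define Jm where "Jm t f = J t (tr t f)" for t f
  have Wm: "line_curve T Wm" and Jm: "line_curve T Jm"
    unfolding Wm_def Jm_def tr_def by (intro line_curve_translate W J)+
  have lin: "line_linear (W t)" "line_linear (J t)" "line_linear (Wm t)" "line_linear (Jm t)" if "t \<in> {0..T}" for t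
    using W J Wm Jm that unfolding line_curve_def by blast+
  have tc: "test_curve T (\<lambda>t. tr t f) (\<lambda>t x. of_int k * tr t (vd f) x)" if "schwartz_line f" for f
    using translate_test_curve[OF that, of T "of_int k"] by (simp add: tr_def)
  \<comment> \<open>In the moving frame the transport term -k W(f') is cancelled by the derivative
    of the translation.\<close>
  have dWm: "((\<lambda>\<tau>. Wm \<tau> f) has_vector_derivative \<beta> * Jm t f) (at t)"
    if t: "0 < t" "t < T" and f: "schwartz_line f" for t f
  proof -
    have tT: "t \<in> {0..T}" using t by simp
    have s: "schwartz_line (tr t f)" "schwartz_line (tr t (vd f))" "vd (tr t f) = tr t (vd f)"
      unfolding tr_def by (intro schwartz_line_translate schwartz_line_vd vd_translate schwartz_line_smooth f)+
    have "((\<lambda>\<tau>. W \<tau> (tr \<tau> f)) has_vector_derivative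
        (- of_int k * W t (vd (tr t f)) + \<i> * of_real (\<alpha> * k) * J t (tr t f)) + W t (\<lambda>x. of_int k * tr t (vd f) x)) (at t)"
      by (rule curve_product_derivative[OF W tc[OF f] t dW[OF t s(1)]])
    moreover have "W t (\<lambda>x. of_int k * tr t (vd f) x) = of_int k * W t (tr t (vd f))"
      by (rule line_linear_cmult[OF lin(1)[OF tT] s(2)])
    ultimately show ?thesis by (simp add: Wm_def Jm_def \<beta>_def s(3))
  qed
  \<comment> \<open>The same cancellation; in addition, passing the multiplier through the
    translation turns the damping at time 0 into that at time t.\<close>
  have dJm: "((\<lambda>\<tau>. Jm \<tau> f) has_vector_derivative \<beta> * Wm t f - Jm t (\<lambda>x. damping \<kappa> k t (of_real x) * f x)) (at t)"
    if t: "0 < t" "t < T" and f: "schwartz_line f" for t f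
  proof -
    have tT: "t \<in> {0..T}" using t by simp
    have s: "schwartz_line (tr t f)" "schwartz_line (tr t (vd f))" "vd (tr t f) = tr t (vd f)"
      unfolding tr_def by (intro schwartz_line_translate schwartz_line_vd vd_translate schwartz_line_smooth f)+
    have "((\<lambda>\<tau>. J \<tau> (tr \<tau> f)) has_vector_derivative
        (- of_int k * J t (vd (tr t f)) + \<i> * of_real (\<alpha> * k) * W t (tr t f)
          - J t (\<lambda>x. damping \<kappa> k 0 (of_real x) * tr t f x)) + J t (\<lambda>x. of_int k * tr t (vd f) x)) (at t)"
      by (rule curve_product_derivative[OF J tc[OF f] t dJ[OF t s(1)]])
    moreover have "J t (\<lambda>x. of_int k * tr t (vd f) x) = of_int k * J t (tr t (vd f))"
      by (rule line_linear_cmult[OF lin(2)[OF tT] s(2)])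
    moreover have "(\<lambda>x. damping \<kappa> k 0 (of_real x) * tr t f x) = tr t (\<lambda>x. damping \<kappa> k t (of_real x) * f x)"
      unfolding damping_translate[of \<kappa> k _ t] by (simp add: tr_def translate_def)
    ultimately show ?thesis by (simp add: Wm_def Jm_def \<beta>_def s(3))
  qed
  define GA GB where G: "GA t x = A t (of_real x) * \<eta> x" "GB t x = B t (of_real x) * \<eta> x" for t x
  define GA' where "GA' t x = - (\<i> * of_real (\<alpha> * k) * B t (of_real x)) * \<eta> x" for t x
  define GB' where "GB' t x = (damping \<kappa> k t (of_real x) * B t (of_real x) - \<i> * of_real (\<alpha> * k) * A t (of_real x)) * \<eta> x" for t x
  have tcA: "test_curve T GA GA'" and tcB: "test_curve T GB GB'"
    using backward_system_test_curves[OF \<kappa> T \<eta> holA holB AT BT dA dB]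
    by (simp_all add: G[abs_def] GA'_def[abs_def] GB'_def[abs_def])
  have "((\<lambda>t. Wm t (GA t) + Jm t (GB t)) has_vector_derivative 0) (at t)" if t: "0 < t" "t < T" for t
  proof -
    have tT: "t \<in> {0..T}" using t by simp
    have s: "schwartz_line (GA t)" "schwartz_line (GB t)" using tcA tcB tT unfolding test_curve_def by blast+
    have sd: "schwartz_line (\<lambda>x. damping \<kappa> k t (of_real x) * GB t x)"
      by (rule schwartz_line_damping_mult[OF \<kappa> s(2)])
    have "GA' t = (\<lambda>x. (- \<beta>) * GB t x)" by (simp add: GA'_def[abs_def] G \<beta>_def mult_ac)
    then have 1: "Wm t (GA' t) = - \<beta> * Wm t (GB t)" by (simp only: line_linear_cmult[OF lin(3)[OF tT] s(2)])
    have "GB' t = (\<lambda>x. damping \<kappa> k t (of_real x) * GB t x - \<beta> * GA t x)"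
      by (simp add: GB'_def[abs_def] G \<beta>_def algebra_simps)
    then have 2: "Jm t (GB' t) = Jm t (\<lambda>x. damping \<kappa> k t (of_real x) * GB t x) - \<beta> * Jm t (GA t)"
      by (simp only: line_linear_diff[OF lin(4)[OF tT] sd schwartz_line_cmult[OF s(1)]] line_linear_cmult[OF lin(4)[OF tT] s(1)])
    \<comment> \<open>By the choice of the adjoint system, every coupling and damping term occurs
      twice with opposite signs.\<close>
    have "((\<lambda>t. Wm t (GA t) + Jm t (GB t)) has_vector_derivative
       (\<beta> * Jm t (GA t) + Wm t (GA' t)) + ((\<beta> * Wm t (GB t) - Jm t (\<lambda>x. damping \<kappa> k t (of_real x) * GB t x)) + Jm t (GB' t))) (at t)"
      by (intro has_vector_derivative_add curve_product_derivative[OF Wm tcA t dWm[OF t s(1)]]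
          curve_product_derivative[OF Jm tcB t dJm[OF t s(2)]])
    then show ?thesis by (simp add: 1 2)
  qed
  then have const: "Wm T (GA T) + Jm T (GB T) = Wm 0 (GA 0) + Jm 0 (GB 0)"
    by (intro constant_on_interval[OF T] continuous_on_add curve_product_continuous[OF Wm tcA] curve_product_continuous[OF Jm tcB])
  have TT: "T \<in> {0..T}" using T by simp
  \<comment> \<open>The final data of the adjoint system do not depend on the frequency, so at time
    T only scalar multiples of the profile are paired.\<close>
  have "GA T = (\<lambda>u. x * \<eta> u)" "GB T = (\<lambda>u. y * \<eta> u)" by (simp_all add: G[abs_def] AT BT)
  then have "Wm T (GA T) = x * Wm T \<eta>" "Jm T (GB T) = y * Jm T \<eta>"
    by (simp_all only: line_linear_cmult[OF lin(3)[OF TT] \<eta>] line_linear_cmult[OF lin(4)[OF TT] \<eta>])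
  moreover have "Wm 0 (GA 0) = W 0 (GA 0)" "Jm 0 (GB 0) = J 0 (GB 0)"
    by (simp_all add: Wm_def Jm_def tr_def translate_def)
  ultimately show ?thesis using const by (simp add: Wm_def Jm_def tr_def G[abs_def])
qed

section \<open>Reduction of the equations to single modes\<close>

lemma tempered_linear: "tempered u \<Longrightarrow> linear_on_tests u"
  by (simp add: tempered_def)

lemma line_linear_mode:
  assumes "linear_on_tests u" shows "line_linear (\<lambda>f. u (mode k f))"
  unfolding line_linear_def
proof (intro conjI allI impI)
  show "u (mode k (\<lambda>x. f x + g x)) = u (mode k f) + u (mode k g)" if "schwartz_line f" "schwartz_line g" for f g
    using assms test_function_mode[OF that(1), of k] test_function_mode[OF that(2), of k]
    unfolding mode_add[OF that] linear_on_tests_def by blast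
  show "u (mode k (\<lambda>x. c * f x)) = c * u (mode k f)" if "schwartz_line f" for c f
    using assms test_function_mode[OF that, of k] unfolding mode_cmult linear_on_tests_def by blast
qed

lemma line_curve_mode:
  assumes u: "continuous_tempered_curve u"
  shows "line_curve T (\<lambda>t f. u t (mode k f))"
  unfolding line_curve_def
proof (intro conjI ballI allI impI)
  show "line_linear (\<lambda>f. u t (mode k f))" if "t \<in> {0..T}" for t
    using u that unfolding continuous_tempered_curve_def by (intro line_linear_mode tempered_linear) auto
  show "continuous_on {0..T} (\<lambda>t. u t (mode k f))" if "schwartz_line f" for f
  proof -
    have "continuous_on {0..} (\<lambda>t. u t (mode k f))"
      using u test_function_mode[OF that, of k] unfolding continuous_tempered_curve_def by blast
    then show ?thesis by (rule continuous_on_subset) auto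
  qed
  obtain N C where C: "\<And>t \<phi>. t \<in> {0..T} \<Longrightarrow> test_function \<phi> \<Longrightarrow> cmod (u t \<phi>) \<le> C * schwartz_seminorm N \<phi>"
    using u unfolding continuous_tempered_curve_def by meson
  obtain M D where D: "0 \<le> D" "\<And>f K. schwartz_line f \<Longrightarrow> line_bound M f K \<Longrightarrow> schwartz_seminorm N (mode k f) \<le> D * K"
    using schwartz_seminorm_mode[of N k] by blast
  have "cmod (u t (mode k f)) \<le> (\<bar>C\<bar> * D) * K"
    if "t \<in> {0..T}" "schwartz_line f" "line_bound M f K" for t f K
  proof -
    note tf = test_function_mode[OF that(2), of k]
    have "cmod (u t (mode k f)) \<le> C * schwartz_seminorm N (mode k f)" by (rule C[OF that(1) tf])
    also have "\<dots> \<le> \<bar>C\<bar> * schwartz_seminorm N (mode k f)"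
      by (intro mult_right_mono schwartz_seminorm_nonneg tf) auto
    also have "\<dots> \<le> \<bar>C\<bar> * (D * K)" by (intro mult_left_mono D(2) that) auto
    finally show ?thesis by (simp only: mult.assoc)
  qed
  moreover have "0 \<le> \<bar>C\<bar> * D" using D(1) by simp
  ultimately show "\<exists>N C. 0 \<le> C \<and> (\<forall>t\<in>{0..T}. \<forall>f K. schwartz_line f \<longrightarrow> line_bound N f K \<longrightarrow> cmod (u t (mode k f)) \<le> C * K)"
    by blast
qed

lemma dist_curl_apply: "dist_curl u1 u2 \<phi> = u1 (pdy \<phi>) - u2 (pdx \<phi>)"
  by (simp add: dist_curl_def dist_dx_def dist_dy_def)

lemma linear_on_tests_curl:
  assumes "linear_on_tests u1" "linear_on_tests u2" shows "linear_on_tests (dist_curl u1 u2)"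
  unfolding linear_on_tests_def dist_curl_apply
proof (intro conjI allI impI)
  fix \<phi> \<psi> assume t: "test_function \<phi>" "test_function \<psi>"
  show "u1 (pdy (\<lambda>x y. \<phi> x y + \<psi> x y)) - u2 (pdx (\<lambda>x y. \<phi> x y + \<psi> x y))
     = u1 (pdy \<phi>) - u2 (pdx \<phi>) + (u1 (pdy \<psi>) - u2 (pdx \<psi>))"
    using assms t[THEN test_function_pdx] t[THEN test_function_pdy]
    unfolding linear_on_tests_def pdx_add[OF t] pdy_add[OF t] by simp
next
  fix c \<phi> assume t: "test_function \<phi>"
  show "u1 (pdy (\<lambda>x y. c * \<phi> x y)) - u2 (pdx (\<lambda>x y. c * \<phi> x y)) = c * (u1 (pdy \<phi>) - u2 (pdx \<phi>))"
    using assms test_function_pdx[OF t] test_function_pdy[OF t]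
    unfolding linear_on_tests_def pdx_cmult[OF t] pdy_cmult[OF t] by (simp add: right_diff_distrib)
qed

lemma schwartz_bound_mono:
  assumes "test_function \<phi>" "cmod v \<le> C * schwartz_seminorm M \<phi>" "M \<le> N"
  shows "cmod v \<le> (\<bar>C\<bar> * real (Suc M) ^ 3) * schwartz_seminorm N \<phi>"
proof -
  have "C * schwartz_seminorm M \<phi> \<le> \<bar>C\<bar> * schwartz_seminorm M \<phi>"
    by (intro mult_right_mono schwartz_seminorm_nonneg assms) auto
  also have "\<dots> \<le> \<bar>C\<bar> * (real (Suc M) ^ 3 * schwartz_seminorm N \<phi>)"
    by (intro mult_left_mono schwartz_seminorm_mono assms) auto
  finally show ?thesis using assms(2) by (simp only: mult.assoc)
qed

text \<open>The constants are explicit so that in \<open>continuous_tempered_curve_curl\<close> they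
  are visibly the same for all times in [0, T].\<close>

lemma curl_bound:
  assumes b1: "\<And>\<phi>. test_function \<phi> \<Longrightarrow> cmod (u1 \<phi>) \<le> C1 * schwartz_seminorm N1 \<phi>"
    and b2: "\<And>\<phi>. test_function \<phi> \<Longrightarrow> cmod (u2 \<phi>) \<le> C2 * schwartz_seminorm N2 \<phi>"
    and \<phi>: "test_function \<phi>"
  shows "cmod (dist_curl u1 u2 \<phi>) \<le>
    (\<bar>\<bar>C1\<bar> * real (Suc N1) ^ 3\<bar> * real (Suc (Suc N1)) ^ 3 + \<bar>\<bar>C2\<bar> * real (Suc N2) ^ 3\<bar> * real (Suc (Suc N2)) ^ 3)
      * schwartz_seminorm (Suc (N1 + N2)) \<phi>"
proof -
  have "cmod (u1 (pdy \<phi>)) \<le> \<bar>C1\<bar> * schwartz_seminorm N1 (pdy \<phi>)"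
    using b1[OF test_function_pdy[OF \<phi>]] mult_right_mono[OF abs_ge_self schwartz_seminorm_nonneg[OF test_function_pdy[OF \<phi>]]]
    by (rule order_trans)
  also have "\<dots> \<le> \<bar>C1\<bar> * (real (Suc N1) ^ 3 * schwartz_seminorm (Suc N1) \<phi>)"
    by (intro mult_left_mono schwartz_seminorm_pdy \<phi>) auto
  finally have 1: "cmod (u1 (pdy \<phi>)) \<le> \<bar>C1\<bar> * real (Suc N1) ^ 3 * schwartz_seminorm (Suc N1) \<phi>"
    by (simp only: mult.assoc)
  have "cmod (u2 (pdx \<phi>)) \<le> \<bar>C2\<bar> * schwartz_seminorm N2 (pdx \<phi>)"
    using b2[OF test_function_pdx[OF \<phi>]] mult_right_mono[OF abs_ge_self schwartz_seminorm_nonneg[OF test_function_pdx[OF \<phi>]]]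
    by (rule order_trans)
  also have "\<dots> \<le> \<bar>C2\<bar> * (real (Suc N2) ^ 3 * schwartz_seminorm (Suc N2) \<phi>)"
    by (intro mult_left_mono schwartz_seminorm_pdx \<phi>) auto
  finally have 2: "cmod (u2 (pdx \<phi>)) \<le> \<bar>C2\<bar> * real (Suc N2) ^ 3 * schwartz_seminorm (Suc N2) \<phi>"
    by (simp only: mult.assoc)
  have "cmod (dist_curl u1 u2 \<phi>) \<le> cmod (u1 (pdy \<phi>)) + cmod (u2 (pdx \<phi>))"
    unfolding dist_curl_apply by (rule norm_triangle_ineq4)
  also have "\<dots> \<le> (\<bar>\<bar>C1\<bar> * real (Suc N1) ^ 3\<bar> * real (Suc (Suc N1)) ^ 3) * schwartz_seminorm (Suc (N1 + N2)) \<phi>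
     + (\<bar>\<bar>C2\<bar> * real (Suc N2) ^ 3\<bar> * real (Suc (Suc N2)) ^ 3) * schwartz_seminorm (Suc (N1 + N2)) \<phi>"
    by (rule add_mono[OF schwartz_bound_mono[OF \<phi> 1] schwartz_bound_mono[OF \<phi> 2]]) auto
  finally show ?thesis by (simp only: distrib_right)
qed

lemma continuous_tempered_curve_curl:
  assumes u1: "continuous_tempered_curve u1" and u2: "continuous_tempered_curve u2"
  shows "continuous_tempered_curve (\<lambda>t. dist_curl (u1 t) (u2 t))"
proof -
  have "tempered (dist_curl (u1 t) (u2 t))" if "t \<ge> 0" for t
  proof -
    have t: "tempered (u1 t)" "tempered (u2 t)" using u1 u2 that unfolding continuous_tempered_curve_def by auto
    then obtain N1 C1 N2 C2 where "\<And>\<phi>. test_function \<phi> \<Longrightarrow> cmod (u1 t \<phi>) \<le> C1 * schwartz_seminorm N1 \<phi>"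
      "\<And>\<phi>. test_function \<phi> \<Longrightarrow> cmod (u2 t \<phi>) \<le> C2 * schwartz_seminorm N2 \<phi>"
      unfolding tempered_def by meson
    from curl_bound[OF this] show ?thesis
      using linear_on_tests_curl[OF t[THEN tempered_linear]] unfolding tempered_def by blast
  qed
  moreover have "continuous_on {0..} (\<lambda>t. dist_curl (u1 t) (u2 t) \<phi>)" if "test_function \<phi>" for \<phi>
    using u1 u2 test_function_pdx[OF that] test_function_pdy[OF that]
    unfolding continuous_tempered_curve_def dist_curl_apply by (intro continuous_on_diff) blast+
  moreover have "\<exists>N C. \<forall>t\<in>{0..T}. \<forall>\<phi>. test_function \<phi> \<longrightarrow> cmod (dist_curl (u1 t) (u2 t) \<phi>) \<le> C * schwartz_seminorm N \<phi>" for T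
  proof -
    obtain N1 C1 where b1: "\<And>t \<phi>. t \<in> {0..T} \<Longrightarrow> test_function \<phi> \<Longrightarrow> cmod (u1 t \<phi>) \<le> C1 * schwartz_seminorm N1 \<phi>"
      using u1 unfolding continuous_tempered_curve_def by meson
    obtain N2 C2 where b2: "\<And>t \<phi>. t \<in> {0..T} \<Longrightarrow> test_function \<phi> \<Longrightarrow> cmod (u2 t \<phi>) \<le> C2 * schwartz_seminorm N2 \<phi>"
      using u2 unfolding continuous_tempered_curve_def by meson
    show ?thesis
    proof (intro exI ballI allI impI)
      fix t \<phi> assume t: "t \<in> {0..T}" and \<phi>: "test_function \<phi>"
      show "cmod (dist_curl (u1 t) (u2 t) \<phi>) \<le>
        (\<bar>\<bar>C1\<bar> * real (Suc N1) ^ 3\<bar> * real (Suc (Suc N1)) ^ 3 + \<bar>\<bar>C2\<bar> * real (Suc N2) ^ 3\<bar> * real (Suc (Suc N2)) ^ 3)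
          * schwartz_seminorm (Suc (N1 + N2)) \<phi>"
        by (rule curl_bound[OF b1[OF t] b2[OF t] \<phi>])
    qed
  qed
  ultimately show ?thesis unfolding continuous_tempered_curve_def by blast
qed

lemma shear_profile_apply: "shear_profile t u \<phi> = u (shear t \<phi>)"
  by (simp add: shear_profile_def shear_def)

lemma tempered_shear_profile:
  assumes "tempered u" shows "tempered (shear_profile t u)"
proof -
  obtain N C where C: "\<And>\<phi>. test_function \<phi> \<Longrightarrow> cmod (u \<phi>) \<le> C * schwartz_seminorm N \<phi>"
    using assms unfolding tempered_def by blast
  obtain M D where D: "\<And>\<phi>. test_function \<phi> \<Longrightarrow> schwartz_seminorm N (shear t \<phi>) \<le> D * schwartz_seminorm M \<phi>"
    using schwartz_seminorm_shear by blast
  have "cmod (shear_profile t u \<phi>) \<le> (\<bar>C\<bar> * D) * schwartz_seminorm M \<phi>" if \<phi>: "test_function \<phi>" for \<phi>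
  proof -
    note s = test_function_shear[OF \<phi>, of t]
    have "cmod (u (shear t \<phi>)) \<le> \<bar>C\<bar> * schwartz_seminorm N (shear t \<phi>)"
      using C[OF s] mult_right_mono[OF abs_ge_self schwartz_seminorm_nonneg[OF s]] by (rule order_trans)
    also have "\<dots> \<le> \<bar>C\<bar> * (D * schwartz_seminorm M \<phi>)" by (intro mult_left_mono D \<phi>) auto
    finally show ?thesis by (simp only: shear_profile_apply mult.assoc)
  qed
  moreover have "linear_on_tests (shear_profile t u)"
  proof -
    have "shear t (\<lambda>x y. \<phi> x y + \<psi> x y) = (\<lambda>x y. shear t \<phi> x y + shear t \<psi> x y)"
      "shear t (\<lambda>x y. c * \<phi> x y) = (\<lambda>x y. c * shear t \<phi> x y)" for \<phi> \<psi> c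
      by (simp_all add: shear_def)
    then show ?thesis using tempered_linear[OF assms] test_function_shear
      unfolding linear_on_tests_def shear_profile_apply by simp
  qed
  ultimately show ?thesis unfolding tempered_def by blast
qed

text \<open>The shear multiplies the x-exponential by the phase cis(kty), and on the Fourier side
  this phase is a translation of the profile.\<close>

lemma shear_mode: "shear t (mode k f) = mode k (translate (of_int k * t) f)"
proof (intro ext)
  fix x y
  have "cis (- of_int k * (x - t * y)) = cis (- of_int k * x) * cis (of_int k * t * y)"
    by (simp only: cis_mult) (simp add: algebra_simps)
  then show "shear t (mode k f) x y = mode k (translate (of_int k * t) f) x y"
    by (simp only: shear_def mode_def fourier_line_translate mult.assoc)
qed

section \<open>Differential operators on a single mode\<close>

lemma mode_operators:
  assumes u: "linear_on_tests u" and f: "schwartz_line f"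
  shows "dist_dx u (mode k f) = \<i> * of_int k * u (mode k f)"
    "dist_dy u (mode k f) = \<i> * u (mode k (\<lambda>x. of_real x * f x))"
    "mult_y (dist_dx u) (mode k f) = of_int k * u (mode k (vd f))"
    "dist_laplace u (mode k f) = - ((of_int k)\<^sup>2 * u (mode k f) + u (mode k (\<lambda>x. of_real x * (of_real x * f x))))"
proof -
  have c: "u (mode k (\<lambda>x. c * g x)) = c * u (mode k g)" if "schwartz_line g" for c g
    using line_linear_cmult[OF line_linear_mode[OF u] that] .
  have dx: "dist_dx u (mode k g) = \<i> * of_int k * u (mode k g)" if "schwartz_line g" for g
    unfolding dist_dx_def pdx_mode c[OF that] by simp
  have dy: "dist_dy u (mode k g) = \<i> * u (mode k (\<lambda>x. of_real x * g x))" if "schwartz_line g" for g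
    unfolding dist_dy_def pdy_mode[OF that] c[OF schwartz_line_of_real_mult[OF that]] by simp
  show "dist_dx u (mode k f) = \<i> * of_int k * u (mode k f)" by (rule dx[OF f])
  show "dist_dy u (mode k f) = \<i> * u (mode k (\<lambda>x. of_real x * f x))" by (rule dy[OF f])
  have "(\<lambda>x y. of_real y * mode k f x y) = mode k (\<lambda>x. (- \<i>) * vd f x)"
    unfolding mode_cmult mode_vd[OF f] by (simp flip: mult.assoc)
  then show "mult_y (dist_dx u) (mode k f) = of_int k * u (mode k (vd f))"
    unfolding mult_y_def
    by (simp only: dx[OF schwartz_line_cmult[OF schwartz_line_vd[OF f]]] c[OF schwartz_line_vd[OF f]]) (simp add: mult_ac)
  have "dist_dx (dist_dx u) (mode k f) = - dist_dx u (mode k (\<lambda>x. (- \<i> * of_int k) * f x))"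
    by (simp only: dist_dx_def[of "dist_dx u"] pdx_mode)
  also have "\<dots> = - (of_int k)\<^sup>2 * u (mode k f)"
    by (simp only: dx[OF schwartz_line_cmult[OF f]] c[OF f]) (simp add: power2_eq_square mult_ac)
  finally have 1: "dist_dx (dist_dx u) (mode k f) = - (of_int k)\<^sup>2 * u (mode k f)" .
  note xf = schwartz_line_of_real_mult[OF f]
  have "dist_dy (dist_dy u) (mode k f) = - dist_dy u (mode k (\<lambda>x. (- \<i>) * (of_real x * f x)))"
    by (simp only: dist_dy_def[of "dist_dy u"] pdy_mode[OF f])
  also have "\<dots> = - (\<i> * u (mode k (\<lambda>x. (- \<i>) * (of_real x * (of_real x * f x)))))"
    by (simp only: dy[OF schwartz_line_cmult[OF xf]] mult.left_commute[of _ "- \<i>"])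
  also have "\<dots> = - u (mode k (\<lambda>x. of_real x * (of_real x * f x)))"
    by (simp only: c[OF schwartz_line_of_real_mult[OF xf]]) simp
  finally show "dist_laplace u (mode k f) = - ((of_int k)\<^sup>2 * u (mode k f) + u (mode k (\<lambda>x. of_real x * (of_real x * f x))))"
    using 1 by (simp add: dist_laplace_def)
qed

lemma curl_mode:
  assumes "linear_on_tests u1" "linear_on_tests u2" "schwartz_line f"
  shows "dist_curl u1 u2 (mode k f) = - \<i> * u1 (mode k (\<lambda>x. of_real x * f x)) + \<i> * of_int k * u2 (mode k f)"
  by (simp add: dist_curl_def mode_operators[OF assms(1,3)] mode_operators[OF assms(2,3)])

text \<open>The inverse symbol is bounded by 2 on the strip, hence a multiplier with growth exponent
  0.\<close>

lemma schwartz_line_div_symbol: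
  assumes "k \<noteq> 0" "schwartz_line f"
  shows "schwartz_line (\<lambda>x. 1 / ((of_int k)\<^sup>2 + (of_real x)\<^sup>2) * f x)"
proof (rule schwartz_line_tame_mult[OF _ assms(2)], rule strip_tame[where K=2 and m=0 and f="\<lambda>z. 1 / ((of_int k)\<^sup>2 + z\<^sup>2)"])
  show "(\<lambda>z. 1 / ((of_int k)\<^sup>2 + z\<^sup>2)) holomorphic_on strip"
    using symbol_nonzero[OF _ assms(1), of _ 0] by (intro holomorphic_intros) auto
  fix z assume z: "z \<in> strip"
  have "3/4 + (Re z)\<^sup>2 \<le> cmod ((of_int k)\<^sup>2 + z\<^sup>2)" using symbol_norm_lower[OF z assms(1), of 0] by simp
  then have "1/2 \<le> cmod ((of_int k)\<^sup>2 + z\<^sup>2)" by (rule order_trans[rotated]) (simp add: add_increasing2)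
  then have "1 \<le> 2 * cmod ((of_int k)\<^sup>2 + z\<^sup>2)" by simp
  moreover have "0 < cmod ((of_int k)\<^sup>2 + z\<^sup>2)" using symbol_nonzero[OF z assms(1), of 0] by simp
  ultimately show "cmod (1 / ((of_int k)\<^sup>2 + z\<^sup>2)) \<le> 2 * (1 + (cmod z)\<^sup>2) ^ 0"
    by (simp add: norm_divide pos_divide_le_eq)
qed

text \<open>Biot-Savart on a single Fourier mode: \<open>B\<^sub>1 = - \<partial>\<^sub>y \<Delta>\<^sup>-\<^sup>1 J\<close>, multiplied by \<open>k\<close> so that \<open>k = 0\<close> is not excluded.\<close>

lemma biot_savart_mode:
  assumes b1: "linear_on_tests b1" and b2: "linear_on_tests b2" and f: "schwartz_line f"
    and div: "\<And>\<phi>. test_function \<phi> \<Longrightarrow> dist_div b1 b2 \<phi> = 0"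
  shows "dist_curl b1 b2 (mode k (\<lambda>x. 2 * of_int k * of_real x / ((of_int k)\<^sup>2 + (of_real x)\<^sup>2) * f x))
    = - 2 * \<i> * of_int k * b1 (mode k f)"
proof (cases "k = 0")
  case True
  have "line_linear (\<lambda>f. dist_curl b1 b2 (mode k f))" by (intro line_linear_mode linear_on_tests_curl b1 b2)
  from line_linear_cmult[OF this f, of 0] show ?thesis using True by simp
next
  case False
  \<comment> \<open>Up to sign this is the inverse Laplacian applied to the profile, so that f =
    (k^2 + x^2) g.\<close>
  define g where "g x = 1 / ((of_int k)\<^sup>2 + (of_real x)\<^sup>2) * f x" for x :: real
  have g: "schwartz_line g" unfolding g_def[abs_def] by (rule schwartz_line_div_symbol[OF False f])
  note xg = schwartz_line_of_real_mult[OF g] and xxg = schwartz_line_of_real_mult[OF schwartz_line_of_real_mult[OF g]]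
  note l1 = line_linear_mode[OF b1, of k] and l2 = line_linear_mode[OF b2, of k]
  have "f x = (of_int k)\<^sup>2 * g x + of_real x * (of_real x * g x)" for x
  proof -
    have "(of_int k)\<^sup>2 + (complex_of_real x)\<^sup>2 \<noteq> 0"
      using symbol_nonzero[OF of_real_strip False, of x 0] by simp
    then have "f x = ((of_int k)\<^sup>2 + (of_real x)\<^sup>2) * g x" by (simp add: g_def)
    then show ?thesis by (simp add: power2_eq_square algebra_simps)
  qed
  then have "f = (\<lambda>x. (of_int k)\<^sup>2 * g x + of_real x * (of_real x * g x))" by (rule ext)
  then have b1f: "b1 (mode k f) = (of_int k)\<^sup>2 * b1 (mode k g) + b1 (mode k (\<lambda>x. of_real x * (of_real x * g x)))"
    using line_linear_add[OF l1 schwartz_line_cmult[OF g] xxg, of "(of_int k)\<^sup>2"] line_linear_cmult[OF l1 g, of "(of_int k)\<^sup>2"]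
    by metis
  have "dist_div b1 b2 (mode k g) = 0" by (rule div[OF test_function_mode[OF g]])
  then have "\<i> * (of_int k * b1 (mode k g) + b2 (mode k (\<lambda>x. of_real x * g x))) = 0"
    by (simp only: dist_div_def mode_operators[OF b1 g] mode_operators[OF b2 g] distrib_left mult.assoc)
  \<comment> \<open>The divergence condition trades the pairing of \<open>b2\<close> with xg for one
    of \<open>b1\<close> with g.\<close>
  then have b2xg: "b2 (mode k (\<lambda>x. of_real x * g x)) = - (of_int k * b1 (mode k g))"
    by (simp add: add_eq_0_iff)
  have lc: "line_linear (\<lambda>f. dist_curl b1 b2 (mode k f))" by (intro line_linear_mode linear_on_tests_curl b1 b2)
  have "(\<lambda>x. 2 * of_int k * of_real x / ((of_int k)\<^sup>2 + (of_real x)\<^sup>2) * f x) = (\<lambda>x. (2 * of_int k) * (of_real x * g x))"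
    by (simp add: g_def fun_eq_iff)
  then have "dist_curl b1 b2 (mode k (\<lambda>x. 2 * of_int k * of_real x / ((of_int k)\<^sup>2 + (of_real x)\<^sup>2) * f x))
     = (2 * of_int k) * dist_curl b1 b2 (mode k (\<lambda>x. of_real x * g x))"
    using line_linear_cmult[OF lc xg] by simp
  also have "\<dots> = (2 * of_int k) * (- \<i> * b1 (mode k f))"
    unfolding curl_mode[OF b1 b2 xg] b1f b2xg by (simp add: power2_eq_square algebra_simps)
  finally show ?thesis by simp
qed

lemma vd_of_real_mult:
  assumes "schwartz_line f" shows "vd (\<lambda>x. of_real x * f x) = (\<lambda>x. f x + of_real x * vd f x)"
proof (rule vd_eqI)
  fix x
  have "((\<lambda>x. of_real x * f x) has_vector_derivative (of_real x * vd f x + 1 * f x)) (at x)"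
    by (intro has_vector_derivative_mult smooth_has_vd schwartz_line_smooth assms) (auto intro!: derivative_eq_intros)
  then show "((\<lambda>x. of_real x * f x) has_vector_derivative (f x + of_real x * vd f x)) (at x)"
    by (simp add: add.commute)
qed

text \<open>The curl removes the pressure. The product rule for \<xi> f in the transport term leaves
  an extra pairing of \<open>V1\<close> with \<open>f\<close>, which the term V_2 cancels through
  div V = 0.\<close>

lemma mhd_vorticity_mode:
  assumes sol: "linear_mhd_solution \<alpha> \<kappa> V1 V2 B1 B2 p" and t: "t > 0" and f: "schwartz_line f"
  shows "((\<lambda>\<tau>. dist_curl (V1 \<tau>) (V2 \<tau>) (mode k f)) has_vector_derivative
     (- of_int k * dist_curl (V1 t) (V2 t) (mode k (vd f)) + \<i> * of_real (\<alpha> * k) * dist_curl (B1 t) (B2 t) (mode k f))) (at t)"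
proof -
  have lin: "linear_on_tests (V1 \<tau>)" "linear_on_tests (V2 \<tau>)" "linear_on_tests (B1 \<tau>)" "linear_on_tests (B2 \<tau>)" if "\<tau> \<ge> 0" for \<tau>
    using sol that unfolding linear_mhd_solution_def continuous_tempered_curve_def by (auto intro: tempered_linear)
  have linp: "linear_on_tests (p t)" using sol t unfolding linear_mhd_solution_def by (auto intro: tempered_linear)
  have t0: "t \<ge> 0" using t by simp
  note L = lin[OF t0]
  note xf = schwartz_line_of_real_mult[OF f]
  note tf = test_function_mode[OF f, of k] and txf = test_function_mode[OF xf, of k]
  have d1: "((\<lambda>\<tau>. V1 \<tau> (mode k (\<lambda>x. of_real x * f x))) has_vector_derivative
      (- mult_y (dist_dx (V1 t)) (mode k (\<lambda>x. of_real x * f x)) - V2 t (mode k (\<lambda>x. of_real x * f x))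
        - dist_dx (p t) (mode k (\<lambda>x. of_real x * f x)) + of_real \<alpha> * dist_dx (B1 t) (mode k (\<lambda>x. of_real x * f x)))) (at t)"
    using sol t txf unfolding linear_mhd_solution_def by blast
  have d2: "((\<lambda>\<tau>. V2 \<tau> (mode k f)) has_vector_derivative
      (- mult_y (dist_dx (V2 t)) (mode k f) - dist_dy (p t) (mode k f) + of_real \<alpha> * dist_dx (B2 t) (mode k f))) (at t)"
    using sol t tf unfolding linear_mhd_solution_def by blast
  have div: "dist_div (V1 t) (V2 t) (mode k f) = 0"
    using sol t0 tf unfolding linear_mhd_solution_def by blast
  have der: "((\<lambda>\<tau>. - \<i> * V1 \<tau> (mode k (\<lambda>x. of_real x * f x)) + \<i> * of_int k * V2 \<tau> (mode k f)) has_vector_derivative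
     (- \<i> * (- mult_y (dist_dx (V1 t)) (mode k (\<lambda>x. of_real x * f x)) - V2 t (mode k (\<lambda>x. of_real x * f x))
        - dist_dx (p t) (mode k (\<lambda>x. of_real x * f x)) + of_real \<alpha> * dist_dx (B1 t) (mode k (\<lambda>x. of_real x * f x)))
      + \<i> * of_int k * (- mult_y (dist_dx (V2 t)) (mode k f) - dist_dy (p t) (mode k f) + of_real \<alpha> * dist_dx (B2 t) (mode k f)))) (at t)"
    by (intro has_vector_derivative_add has_vector_derivative_mult_right d1 d2)
  \<comment> \<open>The mode formula for the curl is available at nonnegative times only, so the two
    functions are compared on the open half-line around t.\<close>
  have der': "((\<lambda>\<tau>. dist_curl (V1 \<tau>) (V2 \<tau>) (mode k f)) has_vector_derivative
     (- \<i> * (- mult_y (dist_dx (V1 t)) (mode k (\<lambda>x. of_real x * f x)) - V2 t (mode k (\<lambda>x. of_real x * f x))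
        - dist_dx (p t) (mode k (\<lambda>x. of_real x * f x)) + of_real \<alpha> * dist_dx (B1 t) (mode k (\<lambda>x. of_real x * f x)))
      + \<i> * of_int k * (- mult_y (dist_dx (V2 t)) (mode k f) - dist_dy (p t) (mode k f) + of_real \<alpha> * dist_dx (B2 t) (mode k f)))) (at t)"
    by (rule has_vector_derivative_transform_within_open[OF der, of "{0<..}"])
      (use t in \<open>auto simp: curl_mode[OF lin(1,2) f]\<close>)
  have split: "V1 t (mode k (vd (\<lambda>x. of_real x * f x))) = V1 t (mode k f) + V1 t (mode k (\<lambda>x. of_real x * vd f x))"
    unfolding vd_of_real_mult[OF f]
    by (rule line_linear_add[OF line_linear_mode[OF L(1)] f schwartz_line_of_real_mult[OF schwartz_line_vd[OF f]]])
  have div': "V2 t (mode k (\<lambda>x. of_real x * f x)) = - (of_int k * V1 t (mode k f))"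
  proof -
    have "\<i> * (of_int k * V1 t (mode k f) + V2 t (mode k (\<lambda>x. of_real x * f x))) = 0"
      using div by (simp only: dist_div_def mode_operators[OF L(1) f] mode_operators[OF L(2) f] distrib_left mult.assoc)
    then show ?thesis by (simp add: add_eq_0_iff)
  qed
  show ?thesis
    by (rule has_vector_derivative_eq_rhs[OF der'])
      (simp only: mode_operators[OF L(1) xf] mode_operators[OF linp xf] mode_operators[OF L(3) xf] mode_operators[OF L(2) f]
        mode_operators[OF linp f] mode_operators[OF L(4) f] curl_mode[OF L(1,2) schwartz_line_vd[OF f]] curl_mode[OF L(3,4) f] split div',
       simp add: algebra_simps)
qed

text \<open>Here the term B_2 enters with the opposite sign, so the extra pairing of
  \<open>B1\<close> with \<open>f\<close> is doubled instead of cancelled.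
  \<open>biot_savart_mode\<close> expresses it through the current, and this gives the rational part
  of \<open>damping\<close>.\<close>

lemma mhd_current_mode:
  assumes \<kappa>: "\<kappa> > 0" and sol: "linear_mhd_solution \<alpha> \<kappa> V1 V2 B1 B2 p" and t: "t > 0" and f: "schwartz_line f"
  shows "((\<lambda>\<tau>. dist_curl (B1 \<tau>) (B2 \<tau>) (mode k f)) has_vector_derivative
     (- of_int k * dist_curl (B1 t) (B2 t) (mode k (vd f)) + \<i> * of_real (\<alpha> * k) * dist_curl (V1 t) (V2 t) (mode k f)
      - dist_curl (B1 t) (B2 t) (mode k (\<lambda>x. damping \<kappa> k 0 (of_real x) * f x)))) (at t)"
proof -
  have lin: "linear_on_tests (V1 \<tau>)" "linear_on_tests (V2 \<tau>)" "linear_on_tests (B1 \<tau>)" "linear_on_tests (B2 \<tau>)" if "\<tau> \<ge> 0" for \<tau>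
    using sol that unfolding linear_mhd_solution_def continuous_tempered_curve_def by (auto intro: tempered_linear)
  have t0: "t \<ge> 0" using t by simp
  note L = lin[OF t0]
  note xf = schwartz_line_of_real_mult[OF f] note xxf = schwartz_line_of_real_mult[OF xf]
  note tf = test_function_mode[OF f, of k] and txf = test_function_mode[OF xf, of k]
  have d1: "((\<lambda>\<tau>. B1 \<tau> (mode k (\<lambda>x. of_real x * f x))) has_vector_derivative
      (- mult_y (dist_dx (B1 t)) (mode k (\<lambda>x. of_real x * f x)) + B2 t (mode k (\<lambda>x. of_real x * f x))
        + of_real \<kappa> * dist_laplace (B1 t) (mode k (\<lambda>x. of_real x * f x)) + of_real \<alpha> * dist_dx (V1 t) (mode k (\<lambda>x. of_real x * f x)))) (at t)"
    using sol t txf unfolding linear_mhd_solution_def by blast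
  have d2: "((\<lambda>\<tau>. B2 \<tau> (mode k f)) has_vector_derivative
      (- mult_y (dist_dx (B2 t)) (mode k f) + of_real \<kappa> * dist_laplace (B2 t) (mode k f) + of_real \<alpha> * dist_dx (V2 t) (mode k f))) (at t)"
    using sol t tf unfolding linear_mhd_solution_def by blast
  have div: "dist_div (B1 t) (B2 t) \<phi> = 0" if "test_function \<phi>" for \<phi>
    using sol t0 that unfolding linear_mhd_solution_def by blast
  have der: "((\<lambda>\<tau>. - \<i> * B1 \<tau> (mode k (\<lambda>x. of_real x * f x)) + \<i> * of_int k * B2 \<tau> (mode k f)) has_vector_derivative
     (- \<i> * (- mult_y (dist_dx (B1 t)) (mode k (\<lambda>x. of_real x * f x)) + B2 t (mode k (\<lambda>x. of_real x * f x))
        + of_real \<kappa> * dist_laplace (B1 t) (mode k (\<lambda>x. of_real x * f x)) + of_real \<alpha> * dist_dx (V1 t) (mode k (\<lambda>x. of_real x * f x)))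
      + \<i> * of_int k * (- mult_y (dist_dx (B2 t)) (mode k f) + of_real \<kappa> * dist_laplace (B2 t) (mode k f) + of_real \<alpha> * dist_dx (V2 t) (mode k f)))) (at t)"
    by (intro has_vector_derivative_add has_vector_derivative_mult_right d1 d2)
  have der': "((\<lambda>\<tau>. dist_curl (B1 \<tau>) (B2 \<tau>) (mode k f)) has_vector_derivative
     (- \<i> * (- mult_y (dist_dx (B1 t)) (mode k (\<lambda>x. of_real x * f x)) + B2 t (mode k (\<lambda>x. of_real x * f x))
        + of_real \<kappa> * dist_laplace (B1 t) (mode k (\<lambda>x. of_real x * f x)) + of_real \<alpha> * dist_dx (V1 t) (mode k (\<lambda>x. of_real x * f x)))
      + \<i> * of_int k * (- mult_y (dist_dx (B2 t)) (mode k f) + of_real \<kappa> * dist_laplace (B2 t) (mode k f) + of_real \<alpha> * dist_dx (V2 t) (mode k f)))) (at t)"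
    by (rule has_vector_derivative_transform_within_open[OF der, of "{0<..}"])
      (use t in \<open>auto simp: curl_mode[OF lin(3,4) f]\<close>)
  have split: "B1 t (mode k (vd (\<lambda>x. of_real x * f x))) = B1 t (mode k f) + B1 t (mode k (\<lambda>x. of_real x * vd f x))"
    unfolding vd_of_real_mult[OF f]
    by (rule line_linear_add[OF line_linear_mode[OF L(3)] f schwartz_line_of_real_mult[OF schwartz_line_vd[OF f]]])
  have div': "B2 t (mode k (\<lambda>x. of_real x * f x)) = - (of_int k * B1 t (mode k f))"
  proof -
    have "\<i> * (of_int k * B1 t (mode k f) + B2 t (mode k (\<lambda>x. of_real x * f x))) = 0"
      using div[OF tf] by (simp only: dist_div_def mode_operators[OF L(3) f] mode_operators[OF L(4) f] distrib_left mult.assoc)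
    then show ?thesis by (simp add: add_eq_0_iff)
  qed
  define J where "J g = dist_curl (B1 t) (B2 t) (mode k g)" for g
  have J: "line_linear J" unfolding J_def by (intro line_linear_mode linear_on_tests_curl L)
  define h where "h x = 2 * of_int k * of_real x / ((of_int k)\<^sup>2 + (of_real x)\<^sup>2) * f x" for x :: real
  have sp: "schwartz_line (\<lambda>x. of_real \<kappa> * ((of_int k)\<^sup>2 * f x + of_real x * (of_real x * f x)))"
    by (intro schwartz_line_cmult schwartz_line_add f xxf)
  have dh: "(\<lambda>x. damping \<kappa> k 0 (of_real x) * f x) = (\<lambda>x. of_real \<kappa> * ((of_int k)\<^sup>2 * f x + of_real x * (of_real x * f x)) + h x)"
    by (simp add: damping_def h_def fun_eq_iff power2_eq_square algebra_simps)
  \<comment> \<open>That \<open>h\<close> is a Schwartz function is read off from a difference of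
    two known ones, which treats k = 0 and the other modes alike.\<close>
  have "h = (\<lambda>x. damping \<kappa> k 0 (of_real x) * f x - of_real \<kappa> * ((of_int k)\<^sup>2 * f x + of_real x * (of_real x * f x)))"
    using fun_cong[OF dh] by (simp add: fun_eq_iff)
  then have h: "schwartz_line h"
    using schwartz_line_diff[OF schwartz_line_damping_mult[OF \<kappa> f, of k 0] sp] by simp
  have "J (\<lambda>x. damping \<kappa> k 0 (of_real x) * f x) = of_real \<kappa> * ((of_int k)\<^sup>2 * J f + J (\<lambda>x. of_real x * (of_real x * f x))) + J h"
    unfolding dh line_linear_add[OF J sp h] line_linear_cmult[OF J schwartz_line_add[OF schwartz_line_cmult[OF f] xxf]]
      line_linear_add[OF J schwartz_line_cmult[OF f] xxf] line_linear_cmult[OF J f] ..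
  moreover have "J h = - 2 * \<i> * of_int k * B1 t (mode k f)"
    unfolding J_def h_def[abs_def] by (rule biot_savart_mode[OF L(3,4) f div])
  ultimately have damp: "dist_curl (B1 t) (B2 t) (mode k (\<lambda>x. damping \<kappa> k 0 (of_real x) * f x)) =
     of_real \<kappa> * ((of_int k)\<^sup>2 * dist_curl (B1 t) (B2 t) (mode k f)
      + dist_curl (B1 t) (B2 t) (mode k (\<lambda>x. of_real x * (of_real x * f x)))) - 2 * \<i> * of_int k * B1 t (mode k f)"
    by (simp add: J_def)
  show ?thesis
    by (rule has_vector_derivative_eq_rhs[OF der'])
      (simp only: mode_operators[OF L(3) xf] mode_operators[OF L(1) xf] mode_operators[OF L(4) f] mode_operators[OF L(2) f]
        damp curl_mode[OF L(3,4) schwartz_line_vd[OF f]] curl_mode[OF L(1,2) f] curl_mode[OF L(3,4) f] curl_mode[OF L(3,4) xxf] split div',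
       simp add: algebra_simps)
qed

section \<open>The energy estimate\<close>

text \<open>At real frequency the damping is real, and time is measured from the critical time
  \<xi>/k at which \<xi> - kt changes sign. For k = 0 there is no critical time, and the adjoint
  energy is nondecreasing because the damping is nonnegative.\<close>

lemma real_backward_bound:
  fixes k :: int and A B :: "real \<Rightarrow> complex" and \<alpha> \<kappa> T \<xi> :: real
  assumes \<kappa>: "\<kappa> > 0" and T: "T > 0"
    and dA: "\<And>t. (A has_vector_derivative - (\<i> * of_real (\<alpha> * k) * B t)) (at t)"
    and dB: "\<And>t. (B has_vector_derivative damping \<kappa> k t (of_real \<xi>) * B t - \<i> * of_real (\<alpha> * k) * A t) (at t)"
  shows "(cmod (A 0))\<^sup>2 + (cmod (B 0))\<^sup>2 \<le> (1 + \<kappa> powr (-2/3))\<^sup>2 * ((cmod (A T))\<^sup>2 + (cmod (B T))\<^sup>2)"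
proof -
  define N where "N t = (cmod (A t))\<^sup>2 + (cmod (B t))\<^sup>2" for t
  define c where "c t = \<kappa> * ((of_int k)\<^sup>2 + (\<xi> - of_int k * t)\<^sup>2) + 2 * of_int k * (\<xi> - of_int k * t) / ((of_int k)\<^sup>2 + (\<xi> - of_int k * t)\<^sup>2)" for t
  have c: "damping \<kappa> k t (of_real \<xi>) = of_real (c t)" for t by (simp add: damping_def c_def)
  have N: "(N has_real_derivative 2 * c t * (cmod (B t))\<^sup>2) (at t)" for t
    unfolding N_def using energy_derivative[OF dA dB, of t] by (simp add: c)
  have BN: "0 \<le> (cmod (B t))\<^sup>2 \<and> (cmod (B t))\<^sup>2 \<le> N t" for t by (simp add: N_def)
  show ?thesis
  proof (cases "k = 0")
    case True
    have "N 0 \<le> N T"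
    proof (rule DERIV_nonneg_imp_nondecreasing[where f=N])
      fix t
      have "0 \<le> 2 * c t * (cmod (B t))\<^sup>2" using \<kappa> True by (simp add: c_def)
      then show "\<exists>y. (N has_real_derivative y) (at t) \<and> 0 \<le> y" using N by blast
    qed (use T in simp)
    also have "N T = 1 * N T" by simp
    also have "\<dots> \<le> (1 + \<kappa> powr (-2/3))\<^sup>2 * N T"
      by (intro mult_right_mono one_le_power) (auto simp: N_def)
    finally show ?thesis by (simp add: N_def)
  next
    case False
    define a where "a = \<xi> / of_int k"
    define h where "h \<tau> = - c (\<tau> + a)" for \<tau>
    have hc: "h \<tau> = 2 * \<tau> / (1 + \<tau>\<^sup>2) - \<kappa> * (of_int k)\<^sup>2 * (1 + \<tau>\<^sup>2)" for \<tau>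
    proof -
      have xi: "\<xi> - of_int k * (\<tau> + a) = - (of_int k * \<tau>)" using False by (simp add: a_def algebra_simps)
      have q: "(of_int k)\<^sup>2 + (of_int k * \<tau>)\<^sup>2 = (of_int k)\<^sup>2 * (1 + \<tau>\<^sup>2)" for \<tau> :: real
        by (simp add: power_mult_distrib distrib_left)
      have "2 * of_int k * (- (of_int k * \<tau>)) / ((of_int k)\<^sup>2 * (1 + \<tau>\<^sup>2)) = - (2 * \<tau> / (1 + \<tau>\<^sup>2))"
        using False by (simp add: power2_eq_square)
      then show ?thesis unfolding h_def c_def xi power2_minus q by (simp add: mult.assoc)
    qed
    have "N (- a + a) \<le> (1 + \<kappa> powr (-2/3))\<^sup>2 * N (T - a + a)"
    proof (rule bounded_growth[where n="\<lambda>\<tau>. N (\<tau> + a)" and h=h and r="\<lambda>\<tau>. (cmod (B (\<tau> + a)))\<^sup>2", OF \<kappa>])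
      fix \<tau>
      have "((\<lambda>\<tau>. N (\<tau> + a)) has_real_derivative (2 * c (\<tau> + a) * (cmod (B (\<tau> + a)))\<^sup>2)) (at \<tau>)"
        using N[of "\<tau> + a"] by (simp add: DERIV_shift)
      then show "((\<lambda>\<tau>. N (\<tau> + a)) has_real_derivative - 2 * h \<tau> * (cmod (B (\<tau> + a)))\<^sup>2) (at \<tau>)"
        by (simp add: h_def)
      show "0 \<le> (cmod (B (\<tau> + a)))\<^sup>2 \<and> (cmod (B (\<tau> + a)))\<^sup>2 \<le> N (\<tau> + a)" by (rule BN)
      have "1 \<le> k\<^sup>2" using False by (simp add: int_one_le_iff_zero_less)
      then have "1 \<le> (of_int k :: real)\<^sup>2" by (metis of_int_1_le_iff of_int_power)
      then have "\<kappa> * 1 * (1 + \<tau>\<^sup>2) \<le> \<kappa> * (of_int k)\<^sup>2 * (1 + \<tau>\<^sup>2)"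
        using \<kappa> by (intro mult_right_mono mult_left_mono) auto
      then show "h \<tau> \<le> growth_rate \<kappa> \<tau>" by (simp add: hc growth_rate_def)
    qed (use T in auto)
    then show ?thesis by (simp add: N_def)
  qed
qed

text \<open>A matrix and its transpose have the same operator norm. The squared length E of the
  image (X, Y) equals P w + Q j, where (P, Q) is the transpose applied to the conjugates of X and Y.
  Cauchy-Schwarz gives E^2 \<le> M^2 E F, and E cancels.\<close>

lemma transposed_bound:
  fixes a b c d w j :: complex
  assumes "\<And>x y. (cmod (x * a + y * c))\<^sup>2 + (cmod (x * b + y * d))\<^sup>2 \<le> M\<^sup>2 * ((cmod x)\<^sup>2 + (cmod y)\<^sup>2)" and "M \<ge> 0"
  shows "(cmod (a * w + b * j))\<^sup>2 + (cmod (c * w + d * j))\<^sup>2 \<le> M\<^sup>2 * ((cmod w)\<^sup>2 + (cmod j)\<^sup>2)"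
proof -
  define X where "X = a * w + b * j"
  define Y where "Y = c * w + d * j"
  define E where "E = (cmod X)\<^sup>2 + (cmod Y)\<^sup>2"
  define F where "F = (cmod w)\<^sup>2 + (cmod j)\<^sup>2"
  define P where "P = cnj X * a + cnj Y * c"
  define Q where "Q = cnj X * b + cnj Y * d"
  have PQ: "(cmod P)\<^sup>2 + (cmod Q)\<^sup>2 \<le> M\<^sup>2 * E"
    using assms(1)[of "cnj X" "cnj Y"] by (simp add: P_def Q_def E_def)
  have E0: "E \<ge> 0" and F0: "F \<ge> 0" by (simp_all add: E_def F_def)
  have "of_real E = cnj X * X + cnj Y * Y"
    unfolding E_def of_real_add complex_norm_square by (simp only: mult.commute)
  also have "\<dots> = P * w + Q * j" by (simp add: X_def Y_def P_def Q_def algebra_simps)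
  finally have "cmod (of_real E) = cmod (P * w + Q * j)" by simp
  then have "E \<le> cmod P * cmod w + cmod Q * cmod j"
    using norm_triangle_ineq[of "P * w" "Q * j"] E0 by (simp add: norm_mult)
  moreover have "(cmod P * cmod w + cmod Q * cmod j)\<^sup>2 \<le> ((cmod P)\<^sup>2 + (cmod Q)\<^sup>2) * F"
  proof -
    have "((cmod P)\<^sup>2 + (cmod Q)\<^sup>2) * F - (cmod P * cmod w + cmod Q * cmod j)\<^sup>2 = (cmod P * cmod j - cmod Q * cmod w)\<^sup>2"
      by (simp add: F_def power2_eq_square algebra_simps)
    then show ?thesis by (metis diff_ge_0_iff_ge zero_le_power2)
  qed
  ultimately have "E\<^sup>2 \<le> ((cmod P)\<^sup>2 + (cmod Q)\<^sup>2) * F"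
    using E0 power_mono order_trans by blast
  also have "\<dots> \<le> (M\<^sup>2 * E) * F" using PQ F0 by (rule mult_right_mono)
  finally have "E * E \<le> (M\<^sup>2 * F) * E" by (simp add: power2_eq_square mult_ac)
  then have "E \<le> M\<^sup>2 * F"
    using E0 F0 by (cases "E = 0") (auto simp: mult_le_cancel_right)
  then show ?thesis by (simp add: E_def F_def X_def Y_def)
qed

text \<open>Final data (1, 0) and (0, 1) of the adjoint system give the two rows of the matrix that
  takes initial to final Fourier data. The energy estimate bounds combinations of these rows, that
  is, the transposed matrix.\<close>

lemma mode_propagator:
  fixes k :: int
  assumes \<kappa>: "\<kappa> > 0" and sol: "linear_mhd_solution \<alpha> \<kappa> V1 V2 B1 B2 p" and T: "T > 0"
  obtains a b c d :: "real \<Rightarrow> complex" where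
    "\<And>g. g \<in> {a, b, c, d} \<Longrightarrow> tame g"
    "\<And>\<eta>. schwartz_line \<eta> \<Longrightarrow> shear_profile T (dist_curl (V1 T) (V2 T)) (mode k \<eta>) =
       dist_curl (V1 0) (V2 0) (mode k (\<lambda>x. a x * \<eta> x)) + dist_curl (B1 0) (B2 0) (mode k (\<lambda>x. b x * \<eta> x))"
    "\<And>\<eta>. schwartz_line \<eta> \<Longrightarrow> shear_profile T (dist_curl (B1 T) (B2 T)) (mode k \<eta>) =
       dist_curl (V1 0) (V2 0) (mode k (\<lambda>x. c x * \<eta> x)) + dist_curl (B1 0) (B2 0) (mode k (\<lambda>x. d x * \<eta> x))"
    "\<And>\<xi> w j. (cmod (a \<xi> * w + b \<xi> * j))\<^sup>2 + (cmod (c \<xi> * w + d \<xi> * j))\<^sup>2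
       \<le> (1 + \<kappa> powr (-2/3))\<^sup>2 * ((cmod w)\<^sup>2 + (cmod j)\<^sup>2)"
proof -
  define W where "W t f = dist_curl (V1 t) (V2 t) (mode k f)" for t f
  define J where "J t f = dist_curl (B1 t) (B2 t) (mode k f)" for t f
  have curves: "continuous_tempered_curve V1" "continuous_tempered_curve V2" "continuous_tempered_curve B1" "continuous_tempered_curve B2"
    using sol unfolding linear_mhd_solution_def by auto
  have WJ: "line_curve T W" "line_curve T J"
    unfolding W_def[abs_def] J_def[abs_def]
    by (intro line_curve_mode continuous_tempered_curve_curl curves)+
  have dW: "((\<lambda>\<tau>. W \<tau> f) has_vector_derivative (- of_int k * W t (vd f) + \<i> * of_real (\<alpha> * k) * J t f)) (at t)"
    if "0 < t" "t < T" "schwartz_line f" for t f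
    unfolding W_def J_def by (rule mhd_vorticity_mode[OF sol that(1,3)])
  have dJ: "((\<lambda>\<tau>. J \<tau> f) has_vector_derivative
        (- of_int k * J t (vd f) + \<i> * of_real (\<alpha> * k) * W t f - J t (\<lambda>x. damping \<kappa> k 0 (of_real x) * f x))) (at t)"
    if "0 < t" "t < T" "schwartz_line f" for t f
    unfolding W_def J_def by (rule mhd_current_mode[OF \<kappa> sol that(1,3)])
  obtain A B where AB: "\<And>t. A t holomorphic_on strip" "\<And>t. B t holomorphic_on strip"
    "\<And>z. z \<in> strip \<Longrightarrow> A T z = 1" "\<And>z. z \<in> strip \<Longrightarrow> B T z = 0"
    "\<And>t z. z \<in> strip \<Longrightarrow> ((\<lambda>t. A t z) has_vector_derivative - (\<i> * of_real (\<alpha> * k) * B t z)) (at t)"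
    "\<And>t z. z \<in> strip \<Longrightarrow> ((\<lambda>t. B t z) has_vector_derivative damping \<kappa> k t z * B t z - \<i> * of_real (\<alpha> * k) * A t z) (at t)"
    using backward_system_exists[where T=T and x=1 and y=0 and k=k and \<alpha>=\<alpha> and \<kappa>=\<kappa>] by blast
  obtain C D where CD: "\<And>t. C t holomorphic_on strip" "\<And>t. D t holomorphic_on strip"
    "\<And>z. z \<in> strip \<Longrightarrow> C T z = 0" "\<And>z. z \<in> strip \<Longrightarrow> D T z = 1"
    "\<And>t z. z \<in> strip \<Longrightarrow> ((\<lambda>t. C t z) has_vector_derivative - (\<i> * of_real (\<alpha> * k) * D t z)) (at t)"
    "\<And>t z. z \<in> strip \<Longrightarrow> ((\<lambda>t. D t z) has_vector_derivative damping \<kappa> k t z * D t z - \<i> * of_real (\<alpha> * k) * C t z) (at t)"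
    using backward_system_exists[where T=T and x=0 and y=1 and k=k and \<alpha>=\<alpha> and \<kappa>=\<kappa>] by blast
  define M where "M = 1 + \<kappa> powr (-2/3)"
  have M: "M \<ge> 0" by (simp add: M_def)
  define K where "K = \<kappa> + 4 * \<bar>of_int k\<bar>"
  \<comment> \<open>The crude bound on the strip, used only to make the matrix entries
    multipliers.\<close>
  have energy: "cmod (F 0 z) \<le> sqrt (exp (2 * K * T))" "cmod (G 0 z) \<le> sqrt (exp (2 * K * T))"
    if z: "z \<in> strip" and d: "\<And>t. ((\<lambda>t. F t z) has_vector_derivative - (\<i> * of_real (\<alpha> * k) * G t z)) (at t)"
      "\<And>t. ((\<lambda>t. G t z) has_vector_derivative damping \<kappa> k t z * G t z - \<i> * of_real (\<alpha> * k) * F t z) (at t)"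
      and 1: "(cmod (F T z))\<^sup>2 + (cmod (G T z))\<^sup>2 = 1" for F G :: "real \<Rightarrow> complex \<Rightarrow> complex" and z
  proof -
    have "(cmod (F 0 z))\<^sup>2 + (cmod (G 0 z))\<^sup>2 \<le> exp (2 * K * T) * ((cmod (F T z))\<^sup>2 + (cmod (G T z))\<^sup>2)"
      using \<kappa> T unfolding K_def by (intro backward_energy_bound[OF d] damping_Re_lower z) auto
    then have "(cmod (F 0 z))\<^sup>2 + (cmod (G 0 z))\<^sup>2 \<le> exp (2 * K * T)" unfolding 1 by simp
    moreover have "(cmod (F 0 z))\<^sup>2 \<le> (cmod (F 0 z))\<^sup>2 + (cmod (G 0 z))\<^sup>2" "(cmod (G 0 z))\<^sup>2 \<le> (cmod (F 0 z))\<^sup>2 + (cmod (G 0 z))\<^sup>2"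
      by auto
    ultimately show "cmod (F 0 z) \<le> sqrt (exp (2 * K * T))" "cmod (G 0 z) \<le> sqrt (exp (2 * K * T))"
      by (meson order_trans real_le_rsqrt)+
  qed
  have tame: "tame (\<lambda>x. F (of_real x))"
    if "F holomorphic_on strip" "\<And>z. z \<in> strip \<Longrightarrow> cmod (F z) \<le> sqrt (exp (2 * K * T))" for F
    by (rule strip_tame[where m=0 and K="sqrt (exp (2 * K * T))", OF that(1)]) (use that(2) in simp)
  show ?thesis
  proof (rule that[of "\<lambda>x. A 0 (of_real x)" "\<lambda>x. B 0 (of_real x)" "\<lambda>x. C 0 (of_real x)" "\<lambda>x. D 0 (of_real x)"])
    show "tame g" if "g \<in> {\<lambda>x. A 0 (complex_of_real x), \<lambda>x. B 0 (of_real x), \<lambda>x. C 0 (of_real x), \<lambda>x. D 0 (of_real x)}" for g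
    proof -
      have "tame (\<lambda>x. A 0 (of_real x))" "tame (\<lambda>x. B 0 (of_real x))"
        by (intro tame AB energy[OF _ AB(5,6)]; simp add: AB)+
      moreover have "tame (\<lambda>x. C 0 (of_real x))" "tame (\<lambda>x. D 0 (of_real x))"
        by (intro tame CD energy[OF _ CD(5,6)]; simp add: CD)+
      ultimately show ?thesis using that by blast
    qed
    fix \<eta> assume \<eta>: "schwartz_line \<eta>"
    show "shear_profile T (dist_curl (V1 T) (V2 T)) (mode k \<eta>) =
       dist_curl (V1 0) (V2 0) (mode k (\<lambda>x. A 0 (of_real x) * \<eta> x)) + dist_curl (B1 0) (B2 0) (mode k (\<lambda>x. B 0 (of_real x) * \<eta> x))"
    proof -
      note duality = line_duality[where W=W and J=J and A=A and B=B, OF \<kappa> T \<eta> WJ dW dJ AB]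
      show ?thesis using duality unfolding W_def J_def shear_profile_apply shear_mode by simp
    qed
    show "shear_profile T (dist_curl (B1 T) (B2 T)) (mode k \<eta>) =
       dist_curl (V1 0) (V2 0) (mode k (\<lambda>x. C 0 (of_real x) * \<eta> x)) + dist_curl (B1 0) (B2 0) (mode k (\<lambda>x. D 0 (of_real x) * \<eta> x))"
    proof -
      note duality = line_duality[where W=W and J=J and A=C and B=D, OF \<kappa> T \<eta> WJ dW dJ CD]
      show ?thesis using duality unfolding W_def J_def shear_profile_apply shear_mode by simp
    qed
  next
    fix \<xi> :: real and w j :: complex
    let ?\<xi> = "complex_of_real \<xi>"
    \<comment> \<open>By linearity, x times the first plus y times the second adjoint solution has
      final data (x, y), so the sharp adjoint estimate applies to it at real frequencies.\<close>
    have bound: "(cmod (x * A 0 ?\<xi> + y * C 0 ?\<xi>))\<^sup>2 + (cmod (x * B 0 ?\<xi> + y * D 0 ?\<xi>))\<^sup>2 \<le> M\<^sup>2 * ((cmod x)\<^sup>2 + (cmod y)\<^sup>2)" for x y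
    proof -
      define F where "F t = x * A t ?\<xi> + y * C t ?\<xi>" for t
      define G where "G t = x * B t ?\<xi> + y * D t ?\<xi>" for t
      have "(F has_vector_derivative (x * - (\<i> * of_real (\<alpha> * k) * B t ?\<xi>) + y * - (\<i> * of_real (\<alpha> * k) * D t ?\<xi>))) (at t)" for t
        unfolding F_def[abs_def] by (intro has_vector_derivative_add has_vector_derivative_mult_right AB(5) CD(5) of_real_strip)
      then have dF: "(F has_vector_derivative - (\<i> * of_real (\<alpha> * k) * G t)) (at t)" for t
        by (rule has_vector_derivative_eq_rhs) (simp add: G_def algebra_simps)
      have "(G has_vector_derivative (x * (damping \<kappa> k t ?\<xi> * B t ?\<xi> - \<i> * of_real (\<alpha> * k) * A t ?\<xi>)
          + y * (damping \<kappa> k t ?\<xi> * D t ?\<xi> - \<i> * of_real (\<alpha> * k) * C t ?\<xi>))) (at t)" for t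
        unfolding G_def[abs_def] by (intro has_vector_derivative_add has_vector_derivative_mult_right AB(6) CD(6) of_real_strip)
      then have dG: "(G has_vector_derivative damping \<kappa> k t ?\<xi> * G t - \<i> * of_real (\<alpha> * k) * F t) (at t)" for t
        by (rule has_vector_derivative_eq_rhs) (simp add: F_def G_def algebra_simps)
      have "(cmod (F 0))\<^sup>2 + (cmod (G 0))\<^sup>2 \<le> (1 + \<kappa> powr (-2/3))\<^sup>2 * ((cmod (F T))\<^sup>2 + (cmod (G T))\<^sup>2)"
        by (rule real_backward_bound[OF \<kappa> T dF dG])
      then show ?thesis by (simp add: F_def G_def M_def AB(3,4) CD(3,4))
    qed
    show "(cmod (A 0 ?\<xi> * w + B 0 ?\<xi> * j))\<^sup>2 + (cmod (C 0 ?\<xi> * w + D 0 ?\<xi> * j))\<^sup>2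
       \<le> (1 + \<kappa> powr (-2/3))\<^sup>2 * ((cmod w)\<^sup>2 + (cmod j)\<^sup>2)"
      using transposed_bound[OF bound M] by (simp add: M_def)
  qed
qed

section \<open>From mode bounds to Sobolev norms\<close>

lemma is_fourier_transform_mode:
  "is_fourier_transform u f \<longleftrightarrow> (\<forall>k. f k \<in> borel_measurable borel) \<and>
    (\<forall>k \<eta>. schwartz_line \<eta> \<longrightarrow> integrable lborel (\<lambda>\<xi>. f k \<xi> * \<eta> \<xi>) \<and> u (mode k \<eta>) = (LINT \<xi>|lborel. f k \<xi> * \<eta> \<xi>))"
  by (simp add: is_fourier_transform_def mode_def)

text \<open>Makes the arbitrary choice in \<open>fourier_transform\<close> harmless: for each k two
  transforms agree almost everywhere, and the energy is an integral.\<close>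

lemma sobolev_energy_unique:
  assumes "is_fourier_transform u f" "is_fourier_transform u g"
  shows "sobolev_energy s f = sobolev_energy s g"
  unfolding sobolev_energy_def
proof (rule nn_integral_cong)
  fix k
  have "AE \<xi> in lborel. f k \<xi> = g k \<xi>"
    using assms unfolding is_fourier_transform_mode by (intro schwartz_test_AE_unique) metis+
  then show "(\<integral>\<^sup>+\<xi>. ennreal ((1 + (of_int k)\<^sup>2 + \<xi>\<^sup>2) powr s * (cmod (f k \<xi>))\<^sup>2) \<partial>lborel) =
      (\<integral>\<^sup>+\<xi>. ennreal ((1 + (of_int k)\<^sup>2 + \<xi>\<^sup>2) powr s * (cmod (g k \<xi>))\<^sup>2) \<partial>lborel)"
    by (intro nn_integral_cong_AE) auto
qed

lemma sobolev_energy_fourier_transform: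
  assumes "is_fourier_transform u f"
  shows "sobolev_energy s (fourier_transform u) = sobolev_energy s f"
proof -
  have "is_fourier_transform u (fourier_transform u)"
    unfolding fourier_transform_def using assms by (rule someI[of "is_fourier_transform u"])
  then show ?thesis using assms by (rule sobolev_energy_unique)
qed

text \<open>The multipliers move from the profile to the given transforms inside the integral. This
  is how the fields at positive times are shown to have functions as Fourier transforms.\<close>

lemma is_fourier_transform_combination:
  assumes w: "is_fourier_transform u w" and j: "is_fourier_transform v j"
    and t: "\<And>k. tame (a k)" "\<And>k. tame (b k)"
    and r: "\<And>k \<eta>. schwartz_line \<eta> \<Longrightarrow> r (mode k \<eta>) = u (mode k (\<lambda>x. a k x * \<eta> x)) + v (mode k (\<lambda>x. b k x * \<eta> x))"
  shows "is_fourier_transform r (\<lambda>k \<xi>. a k \<xi> * w k \<xi> + b k \<xi> * j k \<xi>)"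
  unfolding is_fourier_transform_mode
proof (intro conjI allI impI)
  fix k
  have [measurable]: "a k \<in> borel_measurable borel" "b k \<in> borel_measurable borel"
    using t unfolding tame_def by (auto intro: smooth_measurable)
  have [measurable]: "w k \<in> borel_measurable borel" "j k \<in> borel_measurable borel"
    using w j unfolding is_fourier_transform_mode by auto
  show "(\<lambda>\<xi>. a k \<xi> * w k \<xi> + b k \<xi> * j k \<xi>) \<in> borel_measurable borel" by measurable
  fix \<eta> assume \<eta>: "schwartz_line \<eta>"
  note s = schwartz_line_tame_mult[OF t(1)[of k] \<eta>] schwartz_line_tame_mult[OF t(2)[of k] \<eta>]
  have w': "integrable lborel (\<lambda>\<xi>. w k \<xi> * (a k \<xi> * \<eta> \<xi>))" "u (mode k (\<lambda>x. a k x * \<eta> x)) = (LINT \<xi>|lborel. w k \<xi> * (a k \<xi> * \<eta> \<xi>))"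
    using w s(1) unfolding is_fourier_transform_mode by blast+
  have j': "integrable lborel (\<lambda>\<xi>. j k \<xi> * (b k \<xi> * \<eta> \<xi>))" "v (mode k (\<lambda>x. b k x * \<eta> x)) = (LINT \<xi>|lborel. j k \<xi> * (b k \<xi> * \<eta> \<xi>))"
    using j s(2) unfolding is_fourier_transform_mode by blast+
  have eq: "(\<lambda>\<xi>. (a k \<xi> * w k \<xi> + b k \<xi> * j k \<xi>) * \<eta> \<xi>) = (\<lambda>\<xi>. w k \<xi> * (a k \<xi> * \<eta> \<xi>) + j k \<xi> * (b k \<xi> * \<eta> \<xi>))"
    by (simp add: fun_eq_iff algebra_simps)
  show "integrable lborel (\<lambda>\<xi>. (a k \<xi> * w k \<xi> + b k \<xi> * j k \<xi>) * \<eta> \<xi>)"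
    unfolding eq by (rule Bochner_Integration.integrable_add[OF w'(1) j'(1)])
  show "r (mode k \<eta>) = (LINT \<xi>|lborel. (a k \<xi> * w k \<xi> + b k \<xi> * j k \<xi>) * \<eta> \<xi>)"
    unfolding eq r[OF \<eta>] w'(2) j'(2) by (rule Bochner_Integration.integral_add[OF w'(1) j'(1), symmetric])
qed

lemma sobolev_energy_mono:
  assumes meas: "\<And>k. f k \<in> borel_measurable borel" "\<And>k. g k \<in> borel_measurable borel"
      "\<And>k. w k \<in> borel_measurable borel" "\<And>k. j k \<in> borel_measurable borel"
    and le: "\<And>k \<xi>. (cmod (f k \<xi>))\<^sup>2 + (cmod (g k \<xi>))\<^sup>2 \<le> C * ((cmod (w k \<xi>))\<^sup>2 + (cmod (j k \<xi>))\<^sup>2)" and C: "C \<ge> 0"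
  shows "sobolev_energy s f + sobolev_energy s g \<le> ennreal C * (sobolev_energy s w + sobolev_energy s j)"
proof -
  note [measurable] = meas
  define E where "E h k = (\<integral>\<^sup>+\<xi>. ennreal ((1 + (of_int k)\<^sup>2 + \<xi>\<^sup>2) powr s * (cmod (h k \<xi>))\<^sup>2) \<partial>lborel)"
    for h :: "int \<Rightarrow> real \<Rightarrow> complex" and k
  have "E f k + E g k \<le> ennreal C * (E w k + E j k)" for k
  proof -
    have "E f k + E g k = (\<integral>\<^sup>+\<xi>. ennreal ((1 + (of_int k)\<^sup>2 + \<xi>\<^sup>2) powr s * (cmod (f k \<xi>))\<^sup>2)
        + ennreal ((1 + (of_int k)\<^sup>2 + \<xi>\<^sup>2) powr s * (cmod (g k \<xi>))\<^sup>2) \<partial>lborel)"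
      unfolding E_def by (intro nn_integral_add[symmetric]) measurable
    also have "\<dots> \<le> (\<integral>\<^sup>+\<xi>. ennreal C * (ennreal ((1 + (of_int k)\<^sup>2 + \<xi>\<^sup>2) powr s * (cmod (w k \<xi>))\<^sup>2)
        + ennreal ((1 + (of_int k)\<^sup>2 + \<xi>\<^sup>2) powr s * (cmod (j k \<xi>))\<^sup>2)) \<partial>lborel)"
    proof (intro nn_integral_mono)
      fix \<xi> :: real
      let ?m = "(1 + (of_int k)\<^sup>2 + \<xi>\<^sup>2) powr s"
      have "?m * ((cmod (f k \<xi>))\<^sup>2 + (cmod (g k \<xi>))\<^sup>2) \<le> ?m * (C * ((cmod (w k \<xi>))\<^sup>2 + (cmod (j k \<xi>))\<^sup>2))"
        by (intro mult_left_mono le) auto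
      then have le': "ennreal (?m * (cmod (f k \<xi>))\<^sup>2 + ?m * (cmod (g k \<xi>))\<^sup>2)
          \<le> ennreal (C * (?m * (cmod (w k \<xi>))\<^sup>2 + ?m * (cmod (j k \<xi>))\<^sup>2))"
        by (intro ennreal_leI) (simp add: algebra_simps)
      have e: "ennreal C * (ennreal a + ennreal b) = ennreal (C * (a + b))" if "0 \<le> a" "0 \<le> b" for a b
        using C that by (simp add: ennreal_mult)
      have e': "ennreal a + ennreal b = ennreal (a + b)" if "0 \<le> a" "0 \<le> b" for a b
        using that by simp
      show "ennreal (?m * (cmod (f k \<xi>))\<^sup>2) + ennreal (?m * (cmod (g k \<xi>))\<^sup>2)
          \<le> ennreal C * (ennreal (?m * (cmod (w k \<xi>))\<^sup>2) + ennreal (?m * (cmod (j k \<xi>))\<^sup>2))"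
        using le' by (subst e', simp, simp, subst e, simp, simp)
    qed
    also have "\<dots> = ennreal C * (\<integral>\<^sup>+\<xi>. (ennreal ((1 + (of_int k)\<^sup>2 + \<xi>\<^sup>2) powr s * (cmod (w k \<xi>))\<^sup>2)
        + ennreal ((1 + (of_int k)\<^sup>2 + \<xi>\<^sup>2) powr s * (cmod (j k \<xi>))\<^sup>2)) \<partial>lborel)"
      by (intro nn_integral_cmult) measurable
    also have "\<dots> = ennreal C * (E w k + E j k)"
    proof -
      have "(\<lambda>\<xi>. ennreal ((1 + (of_int k)\<^sup>2 + \<xi>\<^sup>2) powr s * (cmod (w k \<xi>))\<^sup>2)) \<in> borel_measurable lborel"
        "(\<lambda>\<xi>. ennreal ((1 + (of_int k)\<^sup>2 + \<xi>\<^sup>2) powr s * (cmod (j k \<xi>))\<^sup>2)) \<in> borel_measurable lborel"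
        by measurable
      then show ?thesis by (simp only: E_def nn_integral_add)
    qed
    finally show ?thesis .
  qed
  then have "(\<integral>\<^sup>+k. E f k + E g k \<partial>count_space UNIV) \<le> (\<integral>\<^sup>+k. ennreal C * (E w k + E j k) \<partial>count_space UNIV)"
    by (intro nn_integral_mono)
  then show ?thesis unfolding sobolev_energy_def E_def[symmetric]
    by (simp add: nn_integral_add nn_integral_cmult)
qed

theorem lemma1:
  fixes \<alpha> \<kappa> s t :: real
    and V1 V2 B1 B2 p :: "real \<Rightarrow> distribution"
  assumes "\<kappa> > 0"
    and "linear_mhd_solution \<alpha> \<kappa> V1 V2 B1 B2 p"
    and "dist_curl (V1 0) (V2 0) \<in> sobolev_space s"
    and "dist_curl (B1 0) (B2 0) \<in> sobolev_space s"
    and "t > 0"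
  shows "shear_profile t (dist_curl (V1 t) (V2 t)) \<in> sobolev_space s
    \<and> shear_profile t (dist_curl (B1 t) (B2 t)) \<in> sobolev_space s
    \<and> (sobolev_norm s (shear_profile t (dist_curl (V1 t) (V2 t))))\<^sup>2
      + (sobolev_norm s (shear_profile t (dist_curl (B1 t) (B2 t))))\<^sup>2
      \<le> (1 + \<kappa> powr (-2/3))\<^sup>2 *
        ((sobolev_norm s (dist_curl (V1 0) (V2 0)))\<^sup>2
         + (sobolev_norm s (dist_curl (B1 0) (B2 0)))\<^sup>2)"
proof -
  define C where "C = (1 + \<kappa> powr (-2/3))\<^sup>2"
  define W0 J0 where WJ0: "W0 = dist_curl (V1 0) (V2 0)" "J0 = dist_curl (B1 0) (B2 0)"
  define W J where WJ: "W = shear_profile t (dist_curl (V1 t) (V2 t))" "J = shear_profile t (dist_curl (B1 t) (B2 t))"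
  obtain w j where w: "is_fourier_transform W0 w" and j: "is_fourier_transform J0 j"
    using assms(3,4) unfolding sobolev_space_def WJ0 by blast
  \<comment> \<open>The four multipliers of a mode are bundled into a tuple, so that a single use of
    choice selects them for all k.\<close>
  define Q where "Q k P \<longleftrightarrow> (case P of (a, b, c, d) \<Rightarrow> (tame a \<and> tame b \<and> tame c \<and> tame d) \<and>
      (\<forall>\<eta>. schwartz_line \<eta> \<longrightarrow> W (mode k \<eta>) = W0 (mode k (\<lambda>x. a x * \<eta> x)) + J0 (mode k (\<lambda>x. b x * \<eta> x))) \<and>
      (\<forall>\<eta>. schwartz_line \<eta> \<longrightarrow> J (mode k \<eta>) = W0 (mode k (\<lambda>x. c x * \<eta> x)) + J0 (mode k (\<lambda>x. d x * \<eta> x))) \<and>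
      (\<forall>\<xi> w j. (cmod (a \<xi> * w + b \<xi> * j))\<^sup>2 + (cmod (c \<xi> * w + d \<xi> * j))\<^sup>2 \<le> C * ((cmod w)\<^sup>2 + (cmod j)\<^sup>2)))"
    for k and P :: "(real \<Rightarrow> complex) \<times> (real \<Rightarrow> complex) \<times> (real \<Rightarrow> complex) \<times> (real \<Rightarrow> complex)"
  have "\<exists>P. Q k P" for k
  proof (rule mode_propagator[OF assms(1,2,5), of k])
    fix a b c d :: "real \<Rightarrow> complex"
    assume *: "\<And>g. g \<in> {a, b, c, d} \<Longrightarrow> tame g"
      "\<And>\<eta>. schwartz_line \<eta> \<Longrightarrow> shear_profile t (dist_curl (V1 t) (V2 t)) (mode k \<eta>) =
         dist_curl (V1 0) (V2 0) (mode k (\<lambda>x. a x * \<eta> x)) + dist_curl (B1 0) (B2 0) (mode k (\<lambda>x. b x * \<eta> x))"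
      "\<And>\<eta>. schwartz_line \<eta> \<Longrightarrow> shear_profile t (dist_curl (B1 t) (B2 t)) (mode k \<eta>) =
         dist_curl (V1 0) (V2 0) (mode k (\<lambda>x. c x * \<eta> x)) + dist_curl (B1 0) (B2 0) (mode k (\<lambda>x. d x * \<eta> x))"
      "\<And>\<xi> w j. (cmod (a \<xi> * w + b \<xi> * j))\<^sup>2 + (cmod (c \<xi> * w + d \<xi> * j))\<^sup>2
         \<le> (1 + \<kappa> powr (-2/3))\<^sup>2 * ((cmod w)\<^sup>2 + (cmod j)\<^sup>2)"
    have "Q k (a, b, c, d)"
      unfolding Q_def WJ WJ0 C_def prod.case by (intro conjI allI impI *) simp_all
    then show "\<exists>P. Q k P" by blast
  qed
  then have "\<forall>k. \<exists>P. Q k P" by blast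
  from choice[OF this] obtain P where P: "\<And>k. Q k (P k)" by blast
  define a b c d where abcd: "a k = fst (P k)" "b k = fst (snd (P k))" "c k = fst (snd (snd (P k)))" "d k = snd (snd (snd (P k)))" for k
  have t: "tame (a k)" "tame (b k)" "tame (c k)" "tame (d k)"
    and rW: "schwartz_line \<eta> \<Longrightarrow> W (mode k \<eta>) = W0 (mode k (\<lambda>x. a k x * \<eta> x)) + J0 (mode k (\<lambda>x. b k x * \<eta> x))"
    and rJ: "schwartz_line \<eta> \<Longrightarrow> J (mode k \<eta>) = W0 (mode k (\<lambda>x. c k x * \<eta> x)) + J0 (mode k (\<lambda>x. d k x * \<eta> x))"
    and le: "(cmod (a k \<xi> * x + b k \<xi> * y))\<^sup>2 + (cmod (c k \<xi> * x + d k \<xi> * y))\<^sup>2 \<le> C * ((cmod x)\<^sup>2 + (cmod y)\<^sup>2)" for k \<eta> \<xi> x y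
    using P[of k] unfolding abcd Q_def case_prod_beta by simp_all
  define f where "f k \<xi> = a k \<xi> * w k \<xi> + b k \<xi> * j k \<xi>" for k \<xi>
  define g where "g k \<xi> = c k \<xi> * w k \<xi> + d k \<xi> * j k \<xi>" for k \<xi>
  have f: "is_fourier_transform W f" and g: "is_fourier_transform J g"
    unfolding f_def[abs_def] g_def[abs_def]
    by (rule is_fourier_transform_combination[OF w j t(1,2) rW] is_fourier_transform_combination[OF w j t(3,4) rJ]; assumption)+
  have energy: "sobolev_energy s f + sobolev_energy s g \<le> ennreal C * (sobolev_energy s w + sobolev_energy s j)"
  proof (rule sobolev_energy_mono)
    show "f k \<in> borel_measurable borel" "g k \<in> borel_measurable borel" "w k \<in> borel_measurable borel" "j k \<in> borel_measurable borel" for k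
      using f g w j unfolding is_fourier_transform_def by auto
    show "(cmod (f k \<xi>))\<^sup>2 + (cmod (g k \<xi>))\<^sup>2 \<le> C * ((cmod (w k \<xi>))\<^sup>2 + (cmod (j k \<xi>))\<^sup>2)" for k \<xi>
      unfolding f_def g_def by (rule le)
  qed (simp add: C_def)
  have "sobolev_energy s w < \<infinity>" "sobolev_energy s j < \<infinity>"
    using assms(3,4) sobolev_energy_fourier_transform[OF w] sobolev_energy_fourier_transform[OF j]
    unfolding sobolev_space_def WJ0 by auto
  then have fin: "ennreal C * (sobolev_energy s w + sobolev_energy s j) < \<infinity>"
    by (simp add: ennreal_mult_less_top)
  \<comment> \<open>Finiteness at time t, and with it membership in the Sobolev space, comes out of
    the estimate in the extended reals.\<close>
  have sum: "sobolev_energy s f + sobolev_energy s g < \<infinity>"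
    using energy fin by (rule order_le_less_trans)
  have fg: "sobolev_energy s f < \<infinity>" "sobolev_energy s g < \<infinity>"
    by (rule order_le_less_trans[OF _ sum], simp add: add_increasing add_increasing2)+
  have curl: "continuous_tempered_curve (\<lambda>t. dist_curl (V1 t) (V2 t))" "continuous_tempered_curve (\<lambda>t. dist_curl (B1 t) (B2 t))"
    using assms(2) unfolding linear_mhd_solution_def by (auto intro: continuous_tempered_curve_curl)
  have "tempered W" "tempered J"
    unfolding WJ using curl assms(5) unfolding continuous_tempered_curve_def by (auto intro!: tempered_shear_profile)
  then have mem: "W \<in> sobolev_space s" "J \<in> sobolev_space s"
    unfolding sobolev_space_def using f g fg sobolev_energy_fourier_transform[OF f] sobolev_energy_fourier_transform[OF g]
    by auto
  have norm: "(sobolev_norm s u)\<^sup>2 = enn2real (sobolev_energy s h)" if "is_fourier_transform u h" for u h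
    by (simp add: sobolev_norm_def sobolev_energy_fourier_transform[OF that])
  \<comment> \<open>Finiteness matters from here on: \<open>enn2real\<close> sends infinity to 0, so
    sums and inequalities pass through it only when the values are finite.\<close>
  have "enn2real (sobolev_energy s f) + enn2real (sobolev_energy s g) = enn2real (sobolev_energy s f + sobolev_energy s g)"
    using fg by (simp add: enn2real_plus)
  also have "\<dots> \<le> enn2real (ennreal C * (sobolev_energy s w + sobolev_energy s j))"
    using energy fin by (intro enn2real_mono) auto
  also have "\<dots> = C * (enn2real (sobolev_energy s w) + enn2real (sobolev_energy s j))"
    using \<open>sobolev_energy s w < \<infinity>\<close> \<open>sobolev_energy s j < \<infinity>\<close> by (simp add: enn2real_mult enn2real_plus C_def)
  finally have "(sobolev_norm s W)\<^sup>2 + (sobolev_norm s J)\<^sup>2 \<le> C * ((sobolev_norm s W0)\<^sup>2 + (sobolev_norm s J0)\<^sup>2)"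
    unfolding norm[OF f] norm[OF g] norm[OF w] norm[OF j] .
  then show ?thesis using mem unfolding WJ WJ0 C_def by blast
qed

end
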